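(* For every integer $m\ge0$ and every positive integer $r$, $$a_5(5^rm-1)\equiv0\pmod{5^r},$$ $$a_7(7^rm-2)\equiv0\pmod{7^r},$$ $$a_{11}(11^rm-5)\equiv0\pmod{11^r}.$$
   Context: $a_\ell(n)$ is the number of $\ell$-core partitions of $n$, defined by $\sum_{n\ge0}a_\ell(n)q^n=\prod_{n\ge1}\frac{(1-q^{\ell n})^\ell}{1-q^n}$, with $a_\ell(n)=0$ for $n<0$. *)

theory Defs
  imports
    "HOL-Analysis.Infinite_Products"
    "HOL-Computational_Algebra.Formal_Power_Series"
    "HOL-Number_Theory.Cong"
begin

text \<open>
  The factor with index \<open>n\<close> is the one with exponent \<open>n + 1\<close>, since the product in \<open>q\<close> starts
  at 1. The product is the limit of the partial products in the \<open>q\<close>-adic topology; the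
  coefficients are rational only so that \<open>/\<close> is available.
\<close>

definition core_gf :: "nat \<Rightarrow> rat fps" where
  "core_gf l = (\<Prod>n. (1 - fps_X ^ (l * Suc n)) ^ l / (1 - fps_X ^ Suc n))"

text \<open>
  The number of \<open>l\<close>-core partitions of \<open>n\<close>. Rounding down only converts to type \<^typ>\<open>int\<close>:
  the coefficients are integers, by \<open>of_int_core_count\<close> below.
\<close>

definition core_count :: "nat \<Rightarrow> int \<Rightarrow> int" where
  "core_count l n = (if n < 0 then 0 else \<lfloor>fps_nth (core_gf l) (nat n)\<rfloor>)"

abbreviation (input) core_factor :: "nat \<Rightarrow> nat \<Rightarrow> rat fps" where
  "core_factor l n \<equiv> (1 - fps_X ^ (l * Suc n)) ^ l / (1 - fps_X ^ Suc n)"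

lemma inverse_one_minus_X_power:
  "inverse (1 - fps_X ^ Suc n :: rat fps) = Abs_fps (\<lambda>k. if Suc n dvd k then 1 else 0)"
proof (rule fps_inverse_unique, rule fps_ext)
  fix k
  have "Suc n dvd k" if "Suc n dvd k - Suc n" "Suc n \<le> k"
    using that by (metis dvd_add_triv_right_iff le_add_diff_inverse2)
  then show "fps_nth ((1 - fps_X ^ Suc n) * Abs_fps (\<lambda>k. if Suc n dvd k then 1 else 0 :: rat)) k
    = fps_nth 1 k"
    by (auto simp: algebra_simps fps_X_power_mult_nth dvd_diff_nat dest: dvd_imp_le
        simp del: power_Suc)
qed

lemma core_factor_Ints: "fps_nth (core_factor l n) k \<in> \<int>"
proof -
  have mult: "fps_nth (F * G) k \<in> \<int>"
    if "\<And>k. fps_nth F k \<in> \<int>" "\<And>k. fps_nth G k \<in> \<int>" for F G :: "rat fps" and k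
    using that by (auto simp: fps_mult_nth intro!: Ints_sum Ints_mult)
  have pow: "fps_nth (F ^ j) k \<in> \<int>" if "\<And>k. fps_nth F k \<in> \<int>" for F :: "rat fps" and j k
    by (induction j arbitrary: k) (auto intro!: mult that)
  have "fps_nth ((1 - fps_X ^ (l * Suc n)) ^ l * inverse (1 - fps_X ^ Suc n :: rat fps)) k \<in> \<int>"
    unfolding inverse_one_minus_X_power by (intro mult pow) (auto simp: fps_X_power_nth)
  then show ?thesis
    by (simp add: fps_divide_unit del: power_Suc)
qed

lemma core_factor_dvd:
  assumes "l > 0"
  shows "fps_X ^ Suc n dvd core_factor l n - 1"
proof -
  let ?b = "1 - fps_X ^ Suc n :: rat fps" and ?a = "1 - fps_X ^ (l * Suc n) :: rat fps"
  have u: "inverse ?b * ?b = 1"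
    by (rule inverse_mult_eq_1) simp
  have *: "fps_X ^ Suc n dvd ?a ^ j - 1" for j
  proof (induction j)
    case (Suc j)
    have "?a ^ Suc j - 1 = ?a * (?a ^ j - 1) - fps_X ^ (l * Suc n)"
      by (simp add: algebra_simps)
    moreover have "fps_X ^ Suc n dvd (fps_X ^ (l * Suc n) :: rat fps)"
      using assms by (intro le_imp_power_dvd) (simp del: mult_Suc_right)
    ultimately show ?case
      using Suc by (metis dvd_diff dvd_mult)
  qed simp
  have "core_factor l n - 1 = (?a ^ l - 1 + fps_X ^ Suc n) * inverse ?b"
    using u by (simp add: fps_divide_unit algebra_simps del: power_Suc)
  then show ?thesis
    using * by (metis dvd_add dvd_mult2 dvd_refl)
qed

lemma core_gf_has_prod_Ints:
  assumes "l > 0"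
  shows "core_factor l has_prod core_gf l \<and> (\<forall>k. fps_nth (core_gf l) k \<in> \<int>)"
proof -
  define P where "P n = (\<Prod>i\<le>n. core_factor l i)" for n
  define L where "L = Abs_fps (\<lambda>k. fps_nth (P k) k)"
  have step: "fps_nth (P (Suc n)) k = fps_nth (P n) k" if "k \<le> n" for n k
  proof -
    have "fps_X ^ Suc (Suc n) dvd P n * (core_factor l (Suc n) - 1)"
      by (intro dvd_mult core_factor_dvd assms)
    then obtain H where "P n * (core_factor l (Suc n) - 1) = fps_X ^ Suc (Suc n) * H" ..
    moreover have "P (Suc n) - P n = P n * (core_factor l (Suc n) - 1)"
      by (simp only: P_def prod.atMost_Suc right_diff_distrib mult_1_right)
    ultimately have "fps_nth (P (Suc n) - P n) k = 0"
      using that by (simp add: fps_X_power_mult_nth del: power_Suc)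
    then show ?thesis by simp
  qed
  have stable: "fps_nth (P n) k = fps_nth L k" if "k \<le> n" for n k
    using that
  proof (induction rule: dec_induct)
    case base
    show ?case by (simp add: L_def)
  next
    case (step n)
    then show ?case using \<open>\<And>n k. k \<le> n \<Longrightarrow> fps_nth (P (Suc n)) k = fps_nth (P n) k\<close> by metis
  qed
  have lim: "P \<longlonglongrightarrow> L"
    unfolding tendsto_fps_iff
    using stable by (auto simp: eventually_sequentially)
  have "fps_nth (core_factor l 0 - 1) 0 = 0"
  proof -
    obtain H where "core_factor l 0 - 1 = fps_X ^ Suc 0 * H"
      using core_factor_dvd[OF assms, of 0] by (auto elim: dvdE)
    then show ?thesis by (simp only: fps_X_power_mult_nth) simp
  qed
  then have "fps_nth L 0 = 1"
    by (simp add: L_def P_def)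
  then have "L \<noteq> 0"
    by auto
  with lim have hp: "core_factor l has_prod L"
    unfolding has_prod_def raw_has_prod_def P_def[abs_def] add_0_right by blast
  then have L: "core_gf l = L"
    unfolding core_gf_def by (metis has_prod_unique)
  have "fps_nth (P n) k \<in> \<int>" for n k
  proof (induction n arbitrary: k)
    case 0
    show ?case using core_factor_Ints[of l 0 k] by (simp add: P_def)
  next
    case (Suc n)
    have "P (Suc n) = P n * core_factor l (Suc n)"
      by (simp only: P_def prod.atMost_Suc)
    then show ?case
      by (simp only: fps_mult_nth) (intro Ints_sum Ints_mult Suc core_factor_Ints)
  qed
  then show ?thesis
    using hp L by (auto simp: L_def)
qed

lemma core_gf_has_prod:
  assumes "l > 0"
  shows "core_factor l has_prod core_gf l"
  using core_gf_has_prod_Ints[OF assms] by blast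

lemma of_int_core_count:
  assumes "l > 0"
  shows "of_int (core_count l (int n)) = fps_nth (core_gf l) n"
  using core_gf_has_prod_Ints[OF assms] by (auto simp: core_count_def elim: Ints_cases)

end

theory Submission
  imports Defs "HOL-Complex_Analysis.Complex_Analysis" "HOL-Real_Asymp.Real_Asymp"
begin

text \<open>
  Write \<open>L = 2 * d + 1\<close> for one of 5, 7, 11 and put \<open>\<delta> = (L\<^sup>2 - 1) / 24\<close>. The
  shifted generating function \<open>f = \<Sum>n. a\<^bsub>L\<^esub>(n) q\<^bsup>n+\<delta>\<^esup>\<close> equals \<open>\<eta>(L \<tau>)\<^sup>L / \<eta>(\<tau>)\<close>, a
  modular form of weight \<open>d\<close> and level \<open>L\<close>. The operator \<open>U\<close>, which picks out every
  \<open>L\<close>-th coefficient, acts on the small space of forms of this type that vanish at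
  infinity, and so does the Hecke operator \<open>T\<close> at 2. It turns out that \<open>U f = 5 f\<close>
  for \<open>L = 5\<close>, \<open>U f = 7 (2 + T) f\<close> for \<open>L = 7\<close>, and
  \<open>3 U f = 11 (33 - 24 T + T\<^sup>2 - T\<^sup>3) f\<close> for \<open>L = 11\<close> (with a sign in \<open>T\<close>, see
  \<open>hecke2_seq\<close>). On coefficients \<open>U\<close> and \<open>T\<close> visibly commute, so \<open>k U f = L P(T) f\<close>
  with an integer polynomial \<open>P\<close> iterates to \<open>k\<^sup>r U\<^sup>r f = L\<^sup>r P(T)\<^sup>r f\<close>. As \<open>k\<close> is
  prime to \<open>L\<close>, every coefficient of \<open>U\<^sup>r f\<close> is divisible by \<open>L\<^sup>r\<close>; these are the
  three congruences at once. The polynomial exists because \<open>f\<close> generates that space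
  under \<open>T\<close>.

  What needs proof is the identity \<open>k U f = L P(T) f\<close>, which is a comparison of
  finitely many coefficients once modularity is available (\<open>core_family_sturm\<close>). To
  avoid multiplier systems, \<open>f\<close> is written as a product of reciprocals of Klein
  forms. A Klein form is a theta function evaluated at a division point, with an
  exponential factor that makes it transform under the two generators of \<open>SL\<^sub>2(\<int>)\<close>
  without any root of unity; the only analytic input is the inversion formula
  \<open>theta_modular_S\<close>, a consequence of Liouville's theorem. In this way \<open>f\<close> becomes
  one member of a family indexed by vectors modulo \<open>L\<close> that \<open>SL\<^sub>2(\<int>)\<close> permutes
  (\<open>modular_family\<close>), and \<open>T\<close> acts on such families. The difference \<open>H\<close> of the two
  sides of the identity, divided by \<open>f\<close>, is invariant under a congruence subgroup.
  The product of its \<open>L + 1\<close> conjugates is a bounded holomorphic function of level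
  one that tends to 0 at infinity as soon as \<open>H\<close> has order larger than \<open>\<delta>\<close>, because
  \<open>f\<close> has no zeros in the upper half plane, order \<open>\<delta>\<close> at infinity and order 0 at the
  other cusp. By the maximum principle the product vanishes, hence so does \<open>H\<close>.
\<close>

section \<open>Infinite products\<close>

lemma has_prod_one_plus:
  fixes f :: "nat \<Rightarrow> complex"
  assumes "summable (\<lambda>n. norm (f n))"
  shows "(\<lambda>n. 1 + f n) has_prod (\<Prod>n. 1 + f n)"
proof (rule convergent_prod_has_prod)
  show "convergent_prod (\<lambda>n. 1 + f n)"
    by (intro abs_convergent_prod_imp_convergent_prod summable_imp_abs_convergent_prod)
       (use assms in simp)
qed

lemma tendsto_prodinf_one_plus:
  fixes f :: "nat \<Rightarrow> complex"
  assumes "summable (\<lambda>n. norm (f n))"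
  shows "(\<lambda>N. \<Prod>n<N. 1 + f n) \<longlonglongrightarrow> (\<Prod>n. 1 + f n)"
  using has_prod_one_plus[OF assms] by (rule has_prod_imp_tendsto')

lemma uniform_limit_prodinf_one_plus:
  fixes f :: "nat \<Rightarrow> complex \<Rightarrow> complex"
  assumes K: "compact K" and cont: "\<And>n. continuous_on K (f n)"
    and M: "summable M" "\<And>n x. x \<in> K \<Longrightarrow> norm (f n x) \<le> M n"
  shows "uniform_limit K (\<lambda>N x. \<Prod>n<N. 1 + f n x) (\<lambda>x. \<Prod>n. 1 + f n x) sequentially"
proof -
  have "uniformly_convergent_on K (\<lambda>N x. \<Sum>n<N. norm (f n x))"
    by (rule Weierstrass_m_test'[where M = M]) (use M in auto)
  then have "uniformly_convergent_on K (\<lambda>N x. \<Prod>n<N. 1 + f n x)"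
    by (intro uniformly_convergent_on_prod cont K)
  then obtain l where l: "uniform_limit K (\<lambda>N x. \<Prod>n<N. 1 + f n x) l sequentially"
    by (auto simp: uniformly_convergent_on_def)
  have "l x = (\<Prod>n. 1 + f n x)" if x: "x \<in> K" for x
  proof -
    have "summable (\<lambda>n. norm (f n x))"
      by (rule summable_comparison_test[OF _ M(1)]) (use M(2)[OF x] in auto)
    then show ?thesis
      by (intro LIMSEQ_unique[OF tendsto_uniform_limitI[OF l x]] tendsto_prodinf_one_plus)
  qed
  then have "uniform_limit K (\<lambda>N x. \<Prod>n<N. 1 + f n x) l sequentially
      \<longleftrightarrow> uniform_limit K (\<lambda>N x. \<Prod>n<N. 1 + f n x) (\<lambda>x. \<Prod>n. 1 + f n x) sequentially"
    by (intro uniform_limit_cong') auto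
  then show ?thesis
    using l by blast
qed

lemma holomorphic_on_prodinf_one_plus:
  fixes f :: "nat \<Rightarrow> complex \<Rightarrow> complex"
  assumes A: "open A" and hol: "\<And>n. f n holomorphic_on A"
    and M: "\<And>K. compact K \<Longrightarrow> K \<subseteq> A \<Longrightarrow> \<exists>M. summable M \<and> (\<forall>n. \<forall>x\<in>K. norm (f n x) \<le> M n)"
  shows "(\<lambda>x. \<Prod>n. 1 + f n x) holomorphic_on A"
proof (rule holomorphic_uniform_sequence[OF A])
  show "(\<lambda>x. \<Prod>n<N. 1 + f n x) holomorphic_on A" for N
    by (intro holomorphic_intros hol)
  fix x assume "x \<in> A"
  then obtain d where d: "d > 0" "cball x d \<subseteq> A"
    using A open_contains_cball by blast
  then obtain M where "summable M" "\<forall>n. \<forall>y\<in>cball x d. norm (f n y) \<le> M n"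
    using M[of "cball x d"] by auto
  moreover have "continuous_on (cball x d) (f n)" for n
    using hol d(2) holomorphic_on_imp_continuous_on continuous_on_subset by blast
  ultimately show "\<exists>d>0. cball x d \<subseteq> A \<and>
      uniform_limit (cball x d) (\<lambda>N x. \<Prod>n<N. 1 + f n x) (\<lambda>x. \<Prod>n. 1 + f n x) sequentially"
    using d by (intro exI[of _ d] conjI uniform_limit_prodinf_one_plus) auto
qed

lemma norm_prod_one_plus_ge:
  fixes f :: "nat \<Rightarrow> complex"
  assumes s: "summable (\<lambda>n. norm (f n))" and le: "(\<Sum>n. norm (f n)) \<le> c" and c: "c \<le> 1"
  shows "norm (\<Prod>n. 1 + f n) \<ge> 1 - c"
proof -
  have "norm (\<Prod>n<N. 1 + f n) \<ge> 1 - c" for N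
  proof -
    have part: "(\<Sum>n<N. norm (f n)) \<le> c" for N
      using sum_le_suminf[OF s, of "{..<N}"] le by force
    have each: "norm (f n) \<in> {0..1}" for n
      using part[of "Suc n"] c sum_nonneg[of "{..<n}" "\<lambda>n. norm (f n)"] by simp
    have "1 - c \<le> 1 - (\<Sum>n<N. norm (f n))"
      using part by simp
    also have "\<dots> \<le> (\<Prod>n<N. 1 - norm (f n))"
      by (rule Weierstrass_prod_ineq) (use each in auto)
    also have "\<dots> \<le> (\<Prod>n<N. norm (1 + f n))"
    proof (rule prod_mono)
      fix n assume "n \<in> {..<N}"
      show "0 \<le> 1 - norm (f n) \<and> 1 - norm (f n) \<le> norm (1 + f n)"
        using each[of n] norm_diff_ineq[of 1 "f n"] by auto
    qed
    finally show ?thesis by (simp add: prod_norm)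
  qed
  then show ?thesis
    using LIMSEQ_le_const[OF tendsto_norm[OF tendsto_prodinf_one_plus[OF s]]] by blast
qed

lemma norm_prod_one_plus_le:
  fixes f :: "nat \<Rightarrow> complex"
  assumes s: "summable (\<lambda>n. norm (f n))" and le: "(\<Sum>n. norm (f n)) \<le> c"
  shows "norm (\<Prod>n. 1 + f n) \<le> exp c"
proof -
  have "norm (\<Prod>n<N. 1 + f n) \<le> exp c" for N
  proof -
    have part: "(\<Sum>n<N. norm (f n)) \<le> c"
      using sum_le_suminf[OF s, of "{..<N}"] le by force
    have "norm (\<Prod>n<N. 1 + f n) = (\<Prod>n<N. norm (1 + f n))"
      by (simp add: prod_norm)
    also have "\<dots> \<le> (\<Prod>n<N. 1 + norm (f n))"
      by (rule prod_mono) (auto intro: order.trans[OF norm_triangle_ineq])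
    also have "\<dots> \<le> exp (\<Sum>n<N. norm (f n))"
      by (rule prod_le_exp_sum) auto
    also have "\<dots> \<le> exp c" using part by simp
    finally show ?thesis .
  qed
  then show ?thesis
    using LIMSEQ_le_const2[OF tendsto_norm[OF tendsto_prodinf_one_plus[OF s]]] by blast
qed

section \<open>The theta function\<close>

definition ee :: "complex \<Rightarrow> complex" where "ee z = exp (2 * of_real pi * \<i> * z)"

lemma ee_add: "ee (z + w) = ee z * ee w"
  by (simp add: ee_def ring_distribs exp_add)

lemma ee_0 [simp]: "ee 0 = 1"
  by (simp add: ee_def)

lemma ee_nonzero [simp]: "ee z \<noteq> 0"
  by (simp add: ee_def)

lemma ee_minus: "ee (- z) = inverse (ee z)"
  by (simp add: ee_def exp_minus)

lemma ee_diff: "ee (z - w) = ee z / ee w"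
  by (simp add: ee_def ring_distribs exp_diff)

lemma ee_of_nat_mult: "ee (of_nat n * z) = ee z ^ n"
  by (simp add: ee_def exp_of_nat_mult [symmetric] mult_ac)

lemma ee_sum: "ee (\<Sum>i\<in>A. f i) = (\<Prod>i\<in>A. ee (f i))"
  by (induction A rule: infinite_finite_induct) (simp_all add: ee_add)


lemma ee_eq_1_iff: "ee z = 1 \<longleftrightarrow> z \<in> \<int>"
proof -
  have "ee z = 1 \<longleftrightarrow> Im z = 0 \<and> (\<exists>n::int. Re z = of_int n)"
    unfolding ee_def exp_eq_1 by (simp add: field_simps)
  then show ?thesis by (auto simp: Ints_def complex_eq_iff)
qed

lemma ee_Ints [simp]: "z \<in> \<int> \<Longrightarrow> ee z = 1"
  by (simp add: ee_eq_1_iff)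

lemma ee_half [simp]: "ee (1/2) = -1"
  by (simp add: ee_def)

lemma norm_ee: "norm (ee z) = exp (- 2 * pi * Im z)"
  by (simp add: ee_def)

lemma holomorphic_on_ee [holomorphic_intros]:
  "f holomorphic_on A \<Longrightarrow> (\<lambda>z. ee (f z)) holomorphic_on A"
  unfolding ee_def by (intro holomorphic_intros)

lemma norm_ee_less_1: "Im \<tau> > 0 \<Longrightarrow> norm (ee \<tau>) < 1"
  by (simp add: norm_ee)

text \<open>
  This is \<open>2 * \<i> * sin (pi * z)\<close>; the exponential form suits the shifts by \<open>\<tau>\<close>.
\<close>

definition sn :: "complex \<Rightarrow> complex" where "sn z = ee (z/2) - ee (-z/2)"

lemma holomorphic_on_sn [holomorphic_intros]:
  "f holomorphic_on A \<Longrightarrow> (\<lambda>z. sn (f z)) holomorphic_on A"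
  unfolding sn_def by (intro holomorphic_intros) auto

lemma sn_eq_ee: "sn z = ee (-z/2) * (ee z - 1)"
proof -
  have "ee (-z/2) * ee z = ee (z/2)"
    by (simp flip: ee_add)
  then show ?thesis by (simp add: sn_def algebra_simps)
qed

lemma sn_sq: "(sn z)\<^sup>2 = ee z + ee (-z) - 2"
proof -
  have "ee (z/2) * ee (-z/2) = 1" "(ee (z/2))\<^sup>2 = ee z" "(ee (-z/2))\<^sup>2 = ee (-z)"
    by (simp_all add: power2_eq_square flip: ee_add)
  then show ?thesis unfolding sn_def by (simp add: power2_eq_square algebra_simps)
qed

lemma sn_eq_0_iff: "sn z = 0 \<longleftrightarrow> z \<in> \<int>"
  by (simp add: sn_eq_ee ee_eq_1_iff)

lemma sn_minus: "sn (-z) = - sn z"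
  by (simp add: sn_def)

lemma sn_plus_1: "sn (z + 1) = - sn z"
proof -
  have "ee ((z+1)/2) = - ee (z/2)"
    by (simp add: add_divide_distrib ee_add)
  moreover have "ee (-(z+1)/2) = - ee (-z/2)"
    using ee_diff[of "-z/2" "1/2"] by (simp add: diff_divide_distrib)
  ultimately show ?thesis by (simp add: sn_def)
qed

text \<open>
  The factor \<open>(1 - q\<^sup>n e(z)) (1 - q\<^sup>n e(-z)) / (1 - q\<^sup>n)\<^sup>2\<close> of Jacobi's product,
  with 1 subtracted. Writing it through \<open>sn\<close> makes the dependence on \<open>z\<close> polynomial,
  so that one majorant serves for convergence, holomorphy and the behaviour at the
  cusp; \<open>one_plus_theta_term\<close> gives the factored form.
\<close>

definition theta_term :: "complex \<Rightarrow> complex \<Rightarrow> nat \<Rightarrow> complex" where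
  "theta_term z \<tau> n = - (sn z)\<^sup>2 * ee \<tau> ^ Suc n / (1 - ee \<tau> ^ Suc n)\<^sup>2"

text \<open>
  Jacobi's odd theta function, normalised to have derivative \<open>2 * pi * \<i>\<close> at 0 for
  every \<open>\<tau>\<close>. With this normalisation the inversion formula has weight -1 and
  involves no square root.
\<close>

definition theta :: "complex \<Rightarrow> complex \<Rightarrow> complex" where
  "theta z \<tau> = sn z * (\<Prod>n. 1 + theta_term z \<tau> n)"

lemma ee_power_neq_1: "Im \<tau> > 0 \<Longrightarrow> ee \<tau> ^ Suc n \<noteq> 1"
  using norm_ee_less_1[of \<tau>] power_Suc_less_one[of "norm (ee \<tau>)" n]
  by (metis norm_ge_zero norm_one norm_power order_less_irrefl norm_ee exp_gt_zero)

lemma norm_theta_term_le: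
  assumes "y > 0" "Im \<tau> \<ge> y" 
  shows "norm (theta_term z \<tau> n)
    \<le> (norm (sn z))\<^sup>2 / (1 - exp (-2*pi*y))\<^sup>2 * exp (-2*pi*y) ^ Suc n"
proof -
  define t where "t = exp (-2*pi*y)"
  have t: "0 < t" "t < 1" using assms by (simp_all add: t_def)
  have q: "norm (ee \<tau>) \<le> t" using assms by (simp add: norm_ee t_def)
  have qn: "norm (ee \<tau> ^ Suc n) \<le> t ^ Suc n"
    using q by (metis norm_ge_zero norm_power power_mono)
  also have "\<dots> \<le> t"
    using t by (simp add: mult_left_le power_le_one)
  finally have "norm (1 - ee \<tau> ^ Suc n) \<ge> 1 - t"
    using norm_triangle_ineq2[of 1 "ee \<tau> ^ Suc n"] by simp
  then have "(norm (1 - ee \<tau> ^ Suc n))\<^sup>2 \<ge> (1 - t)\<^sup>2"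
    using t by (intro power_mono) auto
  then have "(norm (sn z))\<^sup>2 * norm (ee \<tau> ^ Suc n) / (norm (1 - ee \<tau> ^ Suc n))\<^sup>2
      \<le> (norm (sn z))\<^sup>2 * t ^ Suc n / (1 - t)\<^sup>2"
    using t qn by (intro frac_le mult_mono) auto
  then show ?thesis
    unfolding theta_term_def t_def[symmetric] by (simp add: norm_mult norm_divide norm_power)
qed

lemma summable_theta_bound:
  assumes "y > 0"
  shows "summable (\<lambda>n. c * exp (-2*pi*y) ^ Suc n)"
  using assms by (intro summable_mult summable_Suc_iff[THEN iffD2] summable_geometric) auto

lemma summable_norm_theta_term:
  assumes "Im \<tau> > 0"
  shows "summable (\<lambda>n. norm (theta_term z \<tau> n))"
proof (rule summable_comparison_test'[OF summable_theta_bound[OF assms]])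
  show "norm (norm (theta_term z \<tau> n)) \<le>
      (norm (sn z))\<^sup>2 / (1 - exp (-2*pi*Im \<tau>))\<^sup>2 * exp (-2*pi*Im \<tau>) ^ Suc n" if "n \<ge> 0" for n
    using norm_theta_term_le[OF assms order.refl] by (simp del: power_Suc)
qed

lemma theta_tendsto:
  assumes "Im \<tau> > 0"
  shows "(\<lambda>N. sn z * (\<Prod>n<N. 1 + theta_term z \<tau> n)) \<longlonglongrightarrow> theta z \<tau>"
  unfolding theta_def
  by (intro tendsto_mult tendsto_const tendsto_prodinf_one_plus summable_norm_theta_term assms)

lemma holomorphic_theta_comp:
  assumes A: "open A" and f: "f holomorphic_on A" and g: "g holomorphic_on A"
    and im: "\<And>w. w \<in> A \<Longrightarrow> Im (g w) > 0"
  shows "(\<lambda>w. theta (f w) (g w)) holomorphic_on A"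
  unfolding theta_def
proof (intro holomorphic_intros f holomorphic_on_prodinf_one_plus A)
  fix n
  show "(\<lambda>w. theta_term (f w) (g w) n) holomorphic_on A"
    unfolding theta_term_def
    using ee_power_neq_1[OF im, of _ n] by (intro holomorphic_intros f g) auto
next
  fix K assume K: "compact K" "K \<subseteq> A"
  have cf: "continuous_on K (\<lambda>w. norm (sn (f w)))" and cg: "continuous_on K (\<lambda>w. Im (g w))"
    by (intro continuous_intros holomorphic_on_imp_continuous_on holomorphic_intros
        holomorphic_on_subset[OF f] holomorphic_on_subset[OF g] K)+
  show "\<exists>M. summable M \<and> (\<forall>n. \<forall>w\<in>K. norm (theta_term (f w) (g w) n) \<le> M n)"
  proof (cases "K = {}")
    case True
    then show ?thesis using summable_zero by auto
  next
    case False
    from continuous_attains_sup[OF K(1) False cf] obtain B where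
      B: "\<And>w. w \<in> K \<Longrightarrow> norm (sn (f w)) \<le> B" by auto
    from continuous_attains_inf[OF K(1) False cg] obtain w0 where
      w0: "w0 \<in> K" "\<And>w. w \<in> K \<Longrightarrow> Im (g w0) \<le> Im (g w)" by auto
    define y where "y = Im (g w0)"
    have y: "y > 0" using im w0 K by (auto simp: y_def)
    define M where "M n = B\<^sup>2 / (1 - exp (-2*pi*y))\<^sup>2 * exp (-2*pi*y) ^ Suc n" for n
    have "norm (theta_term (f w) (g w) n) \<le> M n" if w: "w \<in> K" for w n
    proof -
      have "norm (theta_term (f w) (g w) n) \<le>
          (norm (sn (f w)))\<^sup>2 / (1 - exp (-2*pi*y))\<^sup>2 * exp (-2*pi*y) ^ Suc n"
        using w0(2)[OF w] y by (intro norm_theta_term_le) (auto simp: y_def)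
      also have "\<dots> \<le> M n"
        unfolding M_def using B[OF w] by (intro mult_right_mono divide_right_mono power_mono) auto
      finally show ?thesis .
    qed
    then show ?thesis
      using summable_theta_bound[OF y] unfolding M_def by blast
  qed
qed

lemma theta_minus: "theta (-z) \<tau> = - theta z \<tau>"
  by (simp add: theta_def sn_minus theta_term_def)

lemma theta_plus_1: "theta (z + 1) \<tau> = - theta z \<tau>"
  by (simp add: theta_def sn_plus_1 theta_term_def)

lemma theta_tau_plus_1: "theta z (\<tau> + 1) = theta z \<tau>"
  by (simp add: theta_def theta_term_def ee_add)

lemma one_plus_theta_term:
  assumes "Im \<tau> > 0"
  shows "1 + theta_term z \<tau> n
    = (1 - ee \<tau> ^ Suc n * ee z) * (1 - ee \<tau> ^ Suc n * ee (-z)) / (1 - ee \<tau> ^ Suc n)\<^sup>2"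
proof -
  have "ee z * ee (-z) = 1" by (simp add: ee_minus)
  moreover have "(1 - q * X) * (1 - q * Y) = (1 - q)\<^sup>2 - (X + Y - 2) * q" if "X * Y = 1"
    for q X Y :: complex
    using that by algebra
  ultimately have "(1 - ee \<tau> ^ Suc n * ee z) * (1 - ee \<tau> ^ Suc n * ee (-z))
     = (1 - ee \<tau> ^ Suc n)\<^sup>2 - (ee z + ee (-z) - 2) * ee \<tau> ^ Suc n"
    by blast
  then show ?thesis
    using ee_power_neq_1[OF assms, of n] unfolding theta_term_def sn_sq
    by (simp add: field_simps del: power_Suc)
qed

text \<open>
  A zero must be a zero of some factor of the product, so \<open>z\<close> lies in the lattice
  spanned by 1 and \<open>\<tau>\<close>.
\<close>

lemma theta_nonzero:
  assumes \<tau>: "Im \<tau> > 0" and z: "\<And>m n :: int. z \<noteq> of_int m * \<tau> + of_int n"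
  shows "theta z \<tau> \<noteq> 0"
proof -
  have no: "False" if "of_int m * \<tau> + of_int n = z" for m n
    using z[of m n] that by metis
  have s0: "sn z \<noteq> 0"
  proof
    assume "sn z = 0"
    then obtain n where "z = of_int n"
      unfolding sn_eq_0_iff by (rule Ints_cases)
    then show False using no[of 0 n] by simp
  qed
  have t0: "1 + theta_term z \<tau> n \<noteq> 0" for n
  proof -
    define N where "N = int (Suc n)"
    have N: "ee \<tau> ^ Suc n = ee (of_int N * \<tau>)"
      unfolding N_def by (metis ee_of_nat_mult of_int_of_nat_eq)
    have "ee (of_int N * \<tau> + z) \<noteq> 1"
    proof
      assume "ee (of_int N * \<tau> + z) = 1"
      then obtain m where "of_int N * \<tau> + z = of_int m"
        unfolding ee_eq_1_iff by (rule Ints_cases)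
      then show False using no[of "-N" m] by (simp add: algebra_simps)
    qed
    moreover have "ee (of_int N * \<tau> - z) \<noteq> 1"
    proof
      assume "ee (of_int N * \<tau> - z) = 1"
      then obtain m where "of_int N * \<tau> - z = of_int m"
        unfolding ee_eq_1_iff by (rule Ints_cases)
      then show False using no[of N "-m"] by (simp add: algebra_simps)
    qed
    ultimately show ?thesis
      using ee_power_neq_1[OF \<tau>, of n]
      unfolding one_plus_theta_term[OF \<tau>] N
      by (simp add: ee_add ee_diff ee_minus divide_inverse)
  qed
  have "(\<Prod>n. 1 + theta_term z \<tau> n) \<noteq> 0"
  proof
    assume "(\<Prod>n. 1 + theta_term z \<tau> n) = 0"
    then have "(\<lambda>n. 1 + theta_term z \<tau> n) has_prod 0"
      using has_prod_one_plus[OF summable_norm_theta_term[OF \<tau>, of z]] by simp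
    then show False using t0 has_prod_0D by fastforce
  qed
  then show ?thesis
    using s0 by (simp add: theta_def)
qed

text \<open>
  The shift moves each factor of the product to the next one, so the partial
  products at \<open>z + \<tau>\<close> and at \<open>z\<close> differ only by an exponential and two boundary
  factors, and these tend to 1.
\<close>

lemma theta_plus_tau:
  assumes \<tau>: "Im \<tau> > 0"
  shows "theta (z + \<tau>) \<tau> = - ee (- z - \<tau>/2) * theta z \<tau>"
proof -
  let ?q = "ee \<tau>" and ?X = "ee z"
  define P where "P N z = sn z * (\<Prod>n<N. 1 + theta_term z \<tau> n)" for N z
  have X: "?X * ee (-z) = 1" "?X \<noteq> 0" by (simp_all add: ee_minus)
  have q0: "?q \<noteq> 0" by simp
  have sn: "sn (z + \<tau>) * (?X - 1) = ee (-\<tau>/2) * (?q * ?X - 1) * sn z"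
    by (simp add: sn_eq_ee ee_add ee_diff ee_minus add_divide_distrib diff_divide_distrib)
       (simp add: ee_minus divide_simps algebra_simps)
  have fact: "P N (z + \<tau>) * (1 - ?q ^ N * ee (-z)) = - ee (- z - \<tau>/2) * P N z * (1 - ?q ^ Suc N * ?X)" for N
  proof (induction N)
    case 0
    have "sn (z + \<tau>) * (1 - ee (-z)) = ee (-z) * (sn (z + \<tau>) * (?X - 1))"
      using X by (simp add: algebra_simps)
    then show ?case
      unfolding P_def sn using ee_add[of "-z" "-\<tau>/2"] by (simp add: algebra_simps)
  next
    case (Suc N)
    have u: "1 + theta_term (z + \<tau>) \<tau> N
      = (1 - ?q ^ Suc (Suc N) * ?X) * (1 - ?q ^ N * ee (-z)) / (1 - ?q ^ Suc N)\<^sup>2"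
      unfolding one_plus_theta_term[OF \<tau>] using q0
      by (simp add: ee_add ee_diff ee_minus mult_ac)
    have v: "1 + theta_term z \<tau> N
      = (1 - ?q ^ Suc N * ?X) * (1 - ?q ^ Suc N * ee (-z)) / (1 - ?q ^ Suc N)\<^sup>2"
      by (rule one_plus_theta_term[OF \<tau>])
    have "P (Suc N) (z + \<tau>) * (1 - ?q ^ Suc N * ee (-z))
       = (P N (z + \<tau>) * (1 - ?q ^ N * ee (-z))) * (1 - ?q ^ Suc (Suc N) * ?X) * (1 - ?q ^ Suc N * ee (-z)) / (1 - ?q ^ Suc N)\<^sup>2"
      unfolding P_def prod.lessThan_Suc u by simp
    also have "\<dots> = - ee (- z - \<tau>/2) * P (Suc N) z * (1 - ?q ^ Suc (Suc N) * ?X)"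
      unfolding Suc unfolding P_def prod.lessThan_Suc v by simp
    finally show ?case .
  qed
  have q: "(\<lambda>N. ?q ^ N) \<longlonglongrightarrow> 0"
    using norm_ee_less_1[OF \<tau>] by (simp add: LIMSEQ_power_zero)
  have "(\<lambda>N. P N (z + \<tau>) * (1 - ?q ^ N * ee (-z))) \<longlonglongrightarrow> theta (z + \<tau>) \<tau> * (1 - 0 * ee (-z))"
    unfolding P_def by (intro tendsto_intros theta_tendsto \<tau> q)
  moreover have "(\<lambda>N. - ee (- z - \<tau>/2) * P N z * (1 - ?q ^ Suc N * ?X))
      \<longlonglongrightarrow> - ee (- z - \<tau>/2) * theta z \<tau> * (1 - 0 * ?X)"
    unfolding P_def by (intro tendsto_intros theta_tendsto \<tau> LIMSEQ_Suc[OF q])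
  ultimately show ?thesis
    unfolding fact using LIMSEQ_unique by fastforce
qed

section \<open>Inversion of the theta function\<close>

lemma periodic_int:
  fixes f :: "complex \<Rightarrow> 'a"
  assumes "\<And>z. f (z + w) = f z"
  shows "f (z + of_int n * w) = f z"
proof -
  have nat: "f (z + of_nat k * w) = f z" for k z
  proof (induction k)
    case (Suc k)
    have "f (z + of_nat (Suc k) * w) = f ((z + of_nat k * w) + w)"
      by (simp add: algebra_simps)
    then show ?case using Suc assms by simp
  qed simp
  show ?thesis
  proof (cases "n \<ge> 0")
    case True
    then show ?thesis using nat[of z "nat n"] by simp
  next
    case False
    then have "f ((z + of_int n * w) + of_nat (nat (-n)) * w) = f (z + of_int n * w)"
      by (intro nat)
    moreover have "(z + of_int n * w) + of_nat (nat (-n)) * w = z"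
      using False by (simp add: algebra_simps)
    ultimately show ?thesis by simp
  qed
qed

lemma periodic_lattice:
  fixes f :: "complex \<Rightarrow> 'a"
  assumes "\<And>z. f (z + w) = f z" "\<And>z. f (z + 1) = f z"
  shows "f (z + (of_int m * w + of_int n)) = f z"
  using periodic_int[of f w "z + of_int n" m, OF assms(1)] periodic_int[of f 1 z n, OF assms(2)]
  by (simp add: algebra_simps)

lemma theta_0 [simp]: "theta 0 \<tau> = 0"
  by (simp add: theta_def sn_def)

lemma theta_lattice:
  assumes "Im \<tau> > 0"
  shows "theta (of_int m * \<tau> + of_int n) \<tau> = 0"
  using periodic_lattice[of "\<lambda>z. theta z \<tau> = 0" \<tau> 0 m n] assms
  by (simp add: theta_plus_tau theta_plus_1)

lemma theta_eq_0_iff: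
  assumes "Im \<tau> > 0"
  shows "theta z \<tau> = 0 \<longleftrightarrow> (\<exists>m n :: int. z = of_int m * \<tau> + of_int n)"
  using theta_lattice[OF assms] theta_nonzero[OF assms] by blast

lemma holomorphic_theta_left:
  assumes "Im \<tau> > 0" "f holomorphic_on UNIV"
  shows "(\<lambda>z. theta (f z) \<tau>) holomorphic_on UNIV"
  by (rule holomorphic_theta_comp) (use assms in auto)

lemma theta_over_z_tendsto:
  assumes \<tau>: "Im \<tau> > 0"
  shows "((\<lambda>z. theta z \<tau> / z) \<longlongrightarrow> 2 * of_real pi * \<i>) (at 0)"
proof -
  have "(sn has_field_derivative 2 * of_real pi * \<i>) (at 0)"
    unfolding sn_def ee_def by (auto intro!: derivative_eq_intros)
  then have 1: "((\<lambda>z. sn z / z) \<longlongrightarrow> 2 * of_real pi * \<i>) (at 0)"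
    by (simp add: has_field_derivative_iff sn_def)
  have "(\<lambda>z. \<Prod>n. 1 + theta_term z \<tau> n) holomorphic_on UNIV"
  proof (rule holomorphic_on_prodinf_one_plus)
    show "(\<lambda>z. theta_term z \<tau> n) holomorphic_on UNIV" for n
      unfolding theta_term_def using ee_power_neq_1[OF \<tau>, of n]
      by (intro holomorphic_intros) auto
    fix K :: "complex set" assume K: "compact K"
    have "bounded ((\<lambda>z. sn z) ` K)"
      by (intro compact_imp_bounded compact_continuous_image K
          holomorphic_on_imp_continuous_on holomorphic_intros)
    then obtain B where B: "\<And>z. z \<in> K \<Longrightarrow> norm (sn z) \<le> B"
      unfolding bounded_iff by auto
    let ?y = "Im \<tau>"
    have "norm (theta_term z \<tau> n) \<le> B\<^sup>2 / (1 - exp (-2*pi*?y))\<^sup>2 * exp (-2*pi*?y) ^ Suc n"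
      if "z \<in> K" for z n
      by (rule order.trans[OF norm_theta_term_le[OF \<tau> order.refl]])
         (use B[OF that] in \<open>intro mult_right_mono divide_right_mono power_mono; simp\<close>)
    then show "\<exists>M. summable M \<and> (\<forall>n. \<forall>z\<in>K. norm (theta_term z \<tau> n) \<le> M n)"
      using summable_theta_bound[OF \<tau>] by blast
  qed auto
  then have "isCont (\<lambda>z. \<Prod>n. 1 + theta_term z \<tau> n) 0"
    using holomorphic_on_imp_continuous_on continuous_on_eq_continuous_at[OF open_UNIV] by blast
  then have 2: "((\<lambda>z. \<Prod>n. 1 + theta_term z \<tau> n) \<longlongrightarrow> 1) (at 0)"
    by (simp add: isCont_def theta_term_def sn_def)
  have "((\<lambda>z. (sn z / z) * (\<Prod>n. 1 + theta_term z \<tau> n)) \<longlongrightarrow> 2 * of_real pi * \<i> * 1) (at 0)"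
    by (intro tendsto_mult 1 2)
  then show ?thesis
    by (simp add: theta_def)
qed

text \<open>
  Both sides, as functions of \<open>z\<close>, pick up the same factors under \<open>z + 1\<close> and
  \<open>z + \<tau>\<close> and have the same simple zeros. Hence their quotient is entire and doubly
  periodic, so constant by Liouville's theorem; the constant is 1 because both sides
  have the same derivative at 0.
\<close>

lemma theta_modular_S:
  assumes \<tau>: "Im \<tau> > 0"
  shows "theta (z / \<tau>) (- 1 / \<tau>) = ee (z\<^sup>2 / (2 * \<tau>)) / \<tau> * theta z \<tau>"
proof -
  define \<sigma> where "\<sigma> = - 1 / \<tau>"
  have \<tau>0: "\<tau> \<noteq> 0" using \<tau> by auto
  have \<sigma>: "Im \<sigma> > 0"
    using \<tau> by (auto simp: \<sigma>_def Im_divide field_simps sum_power2_gt_zero_iff)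
  define den where "den z = theta z \<tau>" for z
  define num where "num z = ee (- z\<^sup>2 / (2 * \<tau>)) * \<tau> * theta (z / \<tau>) \<sigma>" for z
  \<comment> \<open>The value 1 at the zeros of \<open>den\<close> is the limit of the quotient at 0, hence at every lattice point.\<close>
  define g where "g z = (if den z = 0 then 1 else num z / den z)" for z
  have den1: "den (z + 1) = - den z" and den\<tau>: "den (z + \<tau>) = - ee (- z - \<tau>/2) * den z" for z
    using theta_plus_1 theta_plus_tau[OF \<tau>] by (simp_all add: den_def)
  have num\<tau>: "num (z + \<tau>) = - ee (- z - \<tau>/2) * num z" for z
  proof -
    have "- (z + \<tau>)\<^sup>2 / (2 * \<tau>) = - z\<^sup>2 / (2 * \<tau>) + (- z - \<tau>/2)"
      using \<tau>0 by (simp add: field_simps power2_eq_square)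
    moreover have "(z + \<tau>) / \<tau> = z / \<tau> + 1" using \<tau>0 by (simp add: field_simps)
    ultimately show ?thesis
      by (simp only: num_def theta_plus_1 ee_add) (simp add: mult_ac)
  qed
  have num1: "num (z + 1) = - num z" for z
  proof -
    have "theta (z / \<tau>) \<sigma> = theta ((z + 1) / \<tau> + \<sigma>) \<sigma>"
      by (simp add: \<sigma>_def add_divide_distrib)
    also have "\<dots> = - ee (- ((z + 1) / \<tau>) - \<sigma> / 2) * theta ((z + 1) / \<tau>) \<sigma>"
      by (rule theta_plus_tau[OF \<sigma>])
    finally have "num z = - (ee (- z\<^sup>2 / (2 * \<tau>)) * ee (- ((z + 1) / \<tau>) - \<sigma> / 2)) * \<tau> * theta ((z + 1) / \<tau>) \<sigma>"
      by (simp add: num_def)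
    also have "ee (- z\<^sup>2 / (2 * \<tau>)) * ee (- ((z + 1) / \<tau>) - \<sigma> / 2) = ee (- (z + 1)\<^sup>2 / (2 * \<tau>))"
      using \<tau>0 by (subst ee_add [symmetric], intro arg_cong[of _ _ ee])
        (simp add: \<sigma>_def field_simps power2_eq_square)
    finally show ?thesis by (simp add: num_def)
  qed
  have g1: "g (z + 1) = g z" and g\<tau>: "g (z + \<tau>) = g z" for z
    by (simp_all add: g_def den1 den\<tau> num1 num\<tau>)
  note gper = periodic_lattice[of g \<tau>, OF g\<tau> g1]
  have hol_den: "den holomorphic_on UNIV"
    unfolding den_def by (intro holomorphic_theta_left \<tau> holomorphic_intros)
  have hol_num: "num holomorphic_on UNIV"
    unfolding num_def
    by (intro holomorphic_intros holomorphic_theta_left \<sigma>) (use \<tau>0 in auto)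
  have lim_den: "((\<lambda>z. den z / z) \<longlongrightarrow> 2 * of_real pi * \<i>) (at 0)"
    unfolding den_def by (rule theta_over_z_tendsto[OF \<tau>])
  have lim_num: "((\<lambda>z. num z / z) \<longlongrightarrow> 2 * of_real pi * \<i>) (at 0)"
  proof -
    have "filterlim (\<lambda>z. z / \<tau>) (at 0) (at 0)"
      using \<tau>0 by (auto simp: filterlim_at eventually_at_filter intro!: tendsto_eq_intros)
    from filterlim_compose[OF theta_over_z_tendsto[OF \<sigma>] this]
    have 1: "((\<lambda>z. theta (z / \<tau>) \<sigma> / (z / \<tau>)) \<longlongrightarrow> 2 * of_real pi * \<i>) (at 0)" .
    have "isCont (\<lambda>z. ee (- z\<^sup>2 / (2 * \<tau>))) 0"
      unfolding ee_def using \<tau>0 by (intro continuous_intros) auto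
    then have 2: "((\<lambda>z. ee (- z\<^sup>2 / (2 * \<tau>))) \<longlongrightarrow> 1) (at 0)"
      by (simp add: isCont_def)
    show ?thesis
      using tendsto_mult[OF 2 1] by (simp add: num_def mult_ac)
  qed
  have ev: "eventually (\<lambda>z. den z \<noteq> 0) (at 0)"
    using tendsto_imp_eventually_ne[OF lim_den, of 0] by (auto elim!: eventually_mono)
  have "((\<lambda>z. (num z / z) / (den z / z)) \<longlongrightarrow> 1) (at 0)"
    using tendsto_divide[OF lim_num lim_den] by simp
  then have lim_g: "(g \<longlongrightarrow> 1) (at 0)"
  proof (rule Lim_transform_eventually)
    have "eventually (\<lambda>z. z \<noteq> (0::complex)) (at 0)"
      by (simp add: eventually_at_filter)
    with ev show "eventually (\<lambda>z. num z / z / (den z / z) = g z) (at 0)"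
      by eventually_elim (simp add: g_def)
  qed
  have g0: "g 0 = 1" by (simp add: g_def den_def)
  have diff_off: "g field_differentiable at z" if z: "den z \<noteq> 0" for z
  proof -
    have op: "open {z. den z \<noteq> 0}"
      by (intro open_Collect_neq holomorphic_on_imp_continuous_on hol_den continuous_intros)
    have "(\<lambda>z. num z / den z) holomorphic_on {z. den z \<noteq> 0}"
      by (intro holomorphic_intros holomorphic_on_subset[OF hol_num] holomorphic_on_subset[OF hol_den]) auto
    then have "g holomorphic_on {z. den z \<noteq> 0}"
      by (rule holomorphic_transform) (simp add: g_def)
    then show ?thesis
      using op z holomorphic_on_imp_differentiable_at by blast
  qed
  \<comment> \<open>The singularity at 0 is removable since \<open>g\<close> is continuous there.\<close>
  have diff0: "g field_differentiable at 0"
  proof -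
    from ev obtain d where d: "d > 0" "\<And>z. z \<noteq> 0 \<Longrightarrow> dist z 0 < d \<Longrightarrow> den z \<noteq> 0"
      unfolding eventually_at by auto
    have diff_ball: "g field_differentiable at z" if "z \<in> ball 0 d" "z \<noteq> 0" for z
      by (intro diff_off d(2)) (use that in \<open>simp_all add: dist_commute\<close>)
    have hol: "g holomorphic_on (ball 0 d - {0})"
      by (rule holomorphic_onI, rule field_differentiable_at_within, rule diff_ball) simp_all
    have "continuous_on (ball 0 d) g"
      unfolding continuous_on_eq_continuous_at[OF open_ball]
    proof
      fix z assume "z \<in> ball (0::complex) d"
      then show "isCont g z"
        using lim_g g0 diff_ball[of z] field_differentiable_imp_continuous_at[of g z UNIV]
        by (cases "z = 0") (simp_all add: isCont_def)
    qed
    from no_isolated_singularity[OF this hol] have "g holomorphic_on ball 0 d"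
      by auto
    then show ?thesis
      using d(1) holomorphic_on_imp_differentiable_at by (metis centre_in_ball open_ball)
  qed
  have hol_g: "g holomorphic_on UNIV"
  proof (rule holomorphic_onI)
    fix z :: complex
    show "g field_differentiable (at z within UNIV)"
    proof (cases "den z = 0")
      case True
      then obtain m n where mn: "z = of_int m * \<tau> + of_int n"
        using theta_eq_0_iff[OF \<tau>] by (auto simp: den_def)
      obtain D where "(g has_field_derivative D) (at (z + - z))"
        using diff0 by (auto simp: field_differentiable_def)
      then have "((\<lambda>w. g (w + - z)) has_field_derivative D) (at z)"
        by (simp only: DERIV_shift)
      moreover have "g (w + - z) = g w" for w
        using gper[of "w + - z" m n] by (simp add: mn)
      ultimately show ?thesis by (auto simp: field_differentiable_def)
    qed (use diff_off in simp)
  qed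
  have "bounded (range g)"
  proof -
    define K where "K = (\<lambda>(a, b). of_real a * \<tau> + of_real b) ` ({0..1::real} \<times> {0..1::real})"
    have "compact K"
      unfolding K_def case_prod_unfold
      by (intro compact_continuous_image compact_Times continuous_intros) auto
    then have "bounded (g ` K)"
      by (intro compact_imp_bounded compact_continuous_image
            holomorphic_on_imp_continuous_on holomorphic_on_subset[OF hol_g]) auto
    moreover have "range g \<subseteq> g ` K"
    proof safe
      fix z
      define a where "a = Im z / Im \<tau>"
      define b where "b = Re z - a * Re \<tau>"
      have z: "z = of_real a * \<tau> + of_real b"
        using \<tau> by (simp add: complex_eq_iff a_def b_def)
      have "g z = g (of_real (frac a) * \<tau> + of_real (frac b) + (of_int \<lfloor>a\<rfloor> * \<tau> + of_int \<lfloor>b\<rfloor>))"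
        by (rule arg_cong[of _ _ g]) (simp add: z frac_def algebra_simps)
      also have "\<dots> = g (of_real (frac a) * \<tau> + of_real (frac b))" by (rule gper)
      also have "\<dots> \<in> g ` K"
        unfolding K_def using frac_lt_1[of a] frac_lt_1[of b]
        by (intro imageI rev_image_eqI[of "(frac a, frac b)"]) auto
      finally show "g z \<in> g ` K" .
    qed
    ultimately show ?thesis by (rule bounded_subset)
  qed
  with hol_g have "g constant_on UNIV"
    by (rule Liouville_theorem)
  then have g: "g w = 1" for w
    using g0 by (metis constant_on_def UNIV_I)
  have "num z = den z"
  proof (cases "den z = 0")
    case True
    then obtain m n where mn: "z = of_int m * \<tau> + of_int n"
      using theta_eq_0_iff[OF \<tau>] by (auto simp: den_def)
    have "z / \<tau> = of_int (- n) * \<sigma> + of_int m"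
      using \<tau>0 by (simp add: mn \<sigma>_def field_simps)
    then have "theta (z / \<tau>) \<sigma> = 0"
      by (simp only: theta_lattice[OF \<sigma>])
    then show ?thesis using True by (simp add: num_def)
  next
    case False
    then show ?thesis using g[of z] by (simp add: g_def)
  qed
  then have "ee (z\<^sup>2 / (2 * \<tau>)) / \<tau> * theta z \<tau>
      = (ee (z\<^sup>2 / (2 * \<tau>)) * ee (- z\<^sup>2 / (2 * \<tau>))) * (\<tau> * theta (z / \<tau>) \<sigma> / \<tau>)"
    unfolding den_def [symmetric] \<open>num z = den z\<close> [symmetric] num_def
    using \<tau>0 by (simp add: mult_ac)
  also have "ee (z\<^sup>2 / (2 * \<tau>)) * ee (- z\<^sup>2 / (2 * \<tau>)) = 1"
    by (simp flip: ee_add)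
  finally show ?thesis
    using \<tau>0 by (simp add: \<sigma>_def)
qed

section \<open>Klein forms\<close>

text \<open>
  The Klein form with characteristic \<open>(r, s)\<close>, up to a constant factor. The
  exponential is chosen so that the laws \<open>klein_T\<close> and \<open>klein_S\<close> permute the
  characteristics without any further factor except the weight.
\<close>

definition klein :: "real \<Rightarrow> real \<Rightarrow> complex \<Rightarrow> complex" where
  "klein r s \<tau> = ee (r * (r * \<tau> + s) / 2) * theta (r * \<tau> + s) \<tau>"

lemma klein_T: "klein r s (\<tau> + 1) = klein r (r + s) \<tau>"
  unfolding klein_def theta_tau_plus_1 by (simp add: algebra_simps)

lemma klein_minus: "klein (-r) (-s) \<tau> = - klein r s \<tau>"
  using theta_minus[of "r * \<tau> + s" \<tau>] by (simp add: klein_def algebra_simps)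

lemma klein_S:
  assumes \<tau>: "Im \<tau> > 0"
  shows "klein r s (- 1 / \<tau>) = klein s (- r) \<tau> / \<tau>"
proof -
  have \<tau>0: "\<tau> \<noteq> 0" using \<tau> by auto
  let ?z = "of_real s * \<tau> - of_real r"
  have "of_real r * (- 1 / \<tau>) + of_real s = ?z / \<tau>"
    using \<tau>0 by (simp add: field_simps)
  then have "klein r s (- 1 / \<tau>) = ee (r * (?z / \<tau>) / 2) * theta (?z / \<tau>) (- 1 / \<tau>)"
    unfolding klein_def by (simp only: )
  also have "\<dots> = (ee (r * (?z / \<tau>) / 2) * ee (?z\<^sup>2 / (2 * \<tau>))) * theta ?z \<tau> / \<tau>"
    unfolding theta_modular_S[OF \<tau>] by simp
  also have "ee (r * (?z / \<tau>) / 2) * ee (?z\<^sup>2 / (2 * \<tau>)) = ee (s * ?z / 2)"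
    using \<tau>0 by (subst ee_add [symmetric], intro arg_cong[of _ _ ee])
      (simp add: field_simps power2_eq_square)
  finally show ?thesis by (simp add: klein_def)
qed

text \<open>
  An odd shift would bring in a sign besides the exponential; for even shifts it is
  1.
\<close>

lemma klein_shift:
  assumes \<tau>: "Im \<tau> > 0"
  shows "klein (r + 2 * of_int m) (s + 2 * of_int n) \<tau> = ee (r * n - s * m) * klein r s \<tau>"
proof -
  have 1: "klein (r + 2) s \<tau> = ee (- s) * klein r s \<tau>" for r s
  proof -
    let ?z = "of_real r * \<tau> + of_real s"
    have "theta (?z + \<tau> + \<tau>) \<tau> = ee (- ?z - \<tau> - \<tau>/2) * ee (- ?z - \<tau>/2) * theta ?z \<tau>"
      unfolding theta_plus_tau[OF \<tau>] by (simp add: algebra_simps)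
    also have "ee (- ?z - \<tau> - \<tau>/2) * ee (- ?z - \<tau>/2) = ee (- 2 * ?z - 2 * \<tau>)"
      by (subst ee_add [symmetric], intro arg_cong[of _ _ ee]) (simp add: field_simps)
    also have "?z + \<tau> + \<tau> = ?z + 2 * \<tau>"
      by simp
    finally have t: "theta (?z + 2 * \<tau>) \<tau> = ee (- 2 * ?z - 2 * \<tau>) * theta ?z \<tau>" .
    have z: "complex_of_real (r + 2) * \<tau> + of_real s = ?z + 2 * \<tau>"
      by (simp add: algebra_simps)
    have "klein (r + 2) s \<tau> = ee ((r + 2) * (?z + 2 * \<tau>) / 2) * ee (- 2 * ?z - 2 * \<tau>) * theta ?z \<tau>"
      unfolding klein_def z t by simp
    also have "ee ((r + 2) * (?z + 2 * \<tau>) / 2) * ee (- 2 * ?z - 2 * \<tau>) = ee (- s) * ee (r * ?z / 2)"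
      unfolding ee_add [symmetric] by (intro arg_cong[of _ _ ee]) (simp add: field_simps)
    finally show ?thesis by (simp add: klein_def)
  qed
  have 2: "klein r (s + 2) \<tau> = ee r * klein r s \<tau>" for r s
  proof -
    let ?z = "of_real r * \<tau> + of_real s"
    have t: "theta (?z + 1 + 1) \<tau> = theta ?z \<tau>"
      by (simp only: theta_plus_1 minus_minus)
    have z: "of_real r * \<tau> + complex_of_real (s + 2) = ?z + 1 + 1"
      by (simp add: algebra_simps)
    have "ee (r * (?z + 1 + 1) / 2) = ee r * ee (r * ?z / 2)"
      unfolding ee_add [symmetric] by (intro arg_cong[of _ _ ee]) (simp add: field_simps)
    then show ?thesis
      unfolding klein_def z t by simp
  qed
  \<comment> \<open>Multiplied by a suitable exponential, the form becomes periodic in \<open>r\<close>, and likewise in \<open>s\<close>.\<close>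
  have 3: "klein (r + 2 * of_int m) s \<tau> = ee (- s * m) * klein r s \<tau>" for r s
  proof -
    define f where "f w = ee (s * Re w / 2) * klein (Re w) s \<tau>" for w
    have "f (w + 2) = f w" for w
    proof -
      have "ee (s * (Re w + 2) / 2) * ee (- s) = ee (s * Re w / 2)"
        unfolding ee_add [symmetric] by (intro arg_cong[of _ _ ee]) (simp add: field_simps)
      then show ?thesis by (simp add: f_def 1 mult_ac)
    qed
    from periodic_int[of f 2 "of_real r" m, OF this]
    have "ee (s * (r + m * 2) / 2) * klein (r + m * 2) s \<tau> = ee (s * r / 2) * klein r s \<tau>"
      by (simp add: f_def)
    moreover have "ee (s * r / 2) = ee (s * (r + m * 2) / 2) * ee (- s * m)"
      unfolding ee_add [symmetric] by (intro arg_cong[of _ _ ee]) (simp add: field_simps)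
    ultimately show ?thesis by (simp add: mult.commute)
  qed
  have 4: "klein r (s + 2 * of_int n) \<tau> = ee (r * n) * klein r s \<tau>" for r s
  proof -
    define f where "f w = ee (- r * Re w / 2) * klein r (Re w) \<tau>" for w
    have "f (w + 2) = f w" for w
    proof -
      have "ee (- r * (Re w + 2) / 2) * ee r = ee (- r * Re w / 2)"
        unfolding ee_add [symmetric] by (intro arg_cong[of _ _ ee]) (simp add: field_simps)
      then show ?thesis by (simp add: f_def 2 mult_ac)
    qed
    from periodic_int[of f 2 "of_real s" n, OF this]
    have "ee (- r * (s + n * 2) / 2) * klein r (s + n * 2) \<tau> = ee (- r * s / 2) * klein r s \<tau>"
      by (simp add: f_def)
    moreover have "ee (- r * s / 2) = ee (- r * (s + n * 2) / 2) * ee (r * n)"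
      unfolding ee_add [symmetric] by (intro arg_cong[of _ _ ee]) (simp add: field_simps)
    ultimately show ?thesis by (simp add: mult.commute)
  qed
  have "klein (r + 2 * of_int m) (s + 2 * of_int n) \<tau>
      = ee (- (s + 2 * of_int n) * m) * (ee (r * n) * klein r s \<tau>)"
    unfolding 3[of r "s + 2 * of_int n"] 4[of r s] by simp
  also have "\<dots> = (ee (- (s + 2 * of_int n) * m) * ee (r * n)) * klein r s \<tau>"
    by simp
  also have "ee (- (s + 2 * of_int n) * m) * ee (r * n) = ee ((r * n - s * m) + of_int (- 2 * n * m))"
    unfolding ee_add [symmetric] by (intro arg_cong[of _ _ ee]) (simp add: algebra_simps)
  also have "\<dots> = ee (r * n - s * m)"
    by (simp only: of_real_add ee_add of_real_of_int_eq ee_Ints Ints_of_int mult_1_right)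
  finally show ?thesis .
qed

lemma lattice_coords_unique:
  assumes "Im \<tau> > 0" "of_real r * \<tau> + of_real s = of_real r' * \<tau> + of_real s'"
  shows "r = r' \<and> s = s'"
  using assms by (auto simp: complex_eq_iff)

lemma klein_eq_0_iff:
  assumes "Im \<tau> > 0"
  shows "klein r s \<tau> = 0 \<longleftrightarrow> r \<in> \<int> \<and> s \<in> \<int>"
proof -
  have "klein r s \<tau> = 0 \<longleftrightarrow> (\<exists>m n :: int. of_real r * \<tau> + of_real s = of_real (of_int m) * \<tau> + of_real (of_int n))"
    by (simp add: klein_def theta_eq_0_iff[OF assms])
  also have "\<dots> \<longleftrightarrow> (\<exists>m n :: int. r = of_int m \<and> s = of_int n)"
    using lattice_coords_unique[OF assms] by blast
  also have "\<dots> \<longleftrightarrow> r \<in> \<int> \<and> s \<in> \<int>"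
    by (auto elim!: Ints_cases)
  finally show ?thesis .
qed

lemma holomorphic_klein_comp:
  assumes A: "open A" and g: "g holomorphic_on A" and im: "\<And>w. w \<in> A \<Longrightarrow> Im (g w) > 0"
  shows "(\<lambda>w. klein r s (g w)) holomorphic_on A"
  unfolding klein_def by (intro holomorphic_intros holomorphic_theta_comp A g im) auto

section \<open>Behaviour at the cusp\<close>

definition cusp_bounded :: "(complex \<Rightarrow> complex) \<Rightarrow> bool" where
  "cusp_bounded f \<longleftrightarrow> (\<exists>B Y. \<forall>\<tau>. Im \<tau> \<ge> Y \<longrightarrow> norm (f \<tau>) \<le> B)"

lemma cusp_boundedI:
  assumes "eventually (\<lambda>y. \<forall>\<tau>. Im \<tau> = y \<longrightarrow> norm (f \<tau>) \<le> B) at_top"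
  shows "cusp_bounded f"
  using assms unfolding cusp_bounded_def eventually_at_top_linorder by metis

lemma cusp_bounded_const [intro]: "cusp_bounded (\<lambda>_. c)"
  unfolding cusp_bounded_def by auto

lemma cusp_bounded_add:
  assumes "cusp_bounded f" "cusp_bounded g"
  shows "cusp_bounded (\<lambda>\<tau>. f \<tau> + g \<tau>)"
proof -
  from assms obtain A X B Y where "\<And>\<tau>. Im \<tau> \<ge> X \<Longrightarrow> norm (f \<tau>) \<le> A" "\<And>\<tau>. Im \<tau> \<ge> Y \<Longrightarrow> norm (g \<tau>) \<le> B"
    unfolding cusp_bounded_def by metis
  then have "\<forall>\<tau>. Im \<tau> \<ge> max X Y \<longrightarrow> norm (f \<tau> + g \<tau>) \<le> A + B"
    by (auto intro!: norm_triangle_mono)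
  then show ?thesis unfolding cusp_bounded_def by blast
qed

lemma cusp_bounded_mult:
  assumes "cusp_bounded f" "cusp_bounded g"
  shows "cusp_bounded (\<lambda>\<tau>. f \<tau> * g \<tau>)"
proof -
  from assms obtain A X B Y where AB: "\<And>\<tau>. Im \<tau> \<ge> X \<Longrightarrow> norm (f \<tau>) \<le> A" "\<And>\<tau>. Im \<tau> \<ge> Y \<Longrightarrow> norm (g \<tau>) \<le> B"
    unfolding cusp_bounded_def by metis
  have "norm (f \<tau> * g \<tau>) \<le> A * B" if "Im \<tau> \<ge> max X Y" for \<tau>
    unfolding norm_mult using AB[of \<tau>] that
    by (intro mult_mono) (auto intro: order.trans[OF norm_ge_zero])
  then show ?thesis unfolding cusp_bounded_def by blast
qed

lemma cusp_bounded_sum: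
  assumes "\<And>i. i \<in> I \<Longrightarrow> cusp_bounded (f i)"
  shows "cusp_bounded (\<lambda>\<tau>. \<Sum>i\<in>I. f i \<tau>)"
  using assms by (induction I rule: infinite_finite_induct) (auto intro: cusp_bounded_add)

lemma cusp_bounded_prod:
  assumes "\<And>i. i \<in> I \<Longrightarrow> cusp_bounded (f i)"
  shows "cusp_bounded (\<lambda>\<tau>. \<Prod>i\<in>I. f i \<tau>)"
  using assms by (induction I rule: infinite_finite_induct) (auto intro: cusp_bounded_mult)

lemma cusp_bounded_affine:
  assumes "cusp_bounded f" "a > 0"
  shows "cusp_bounded (\<lambda>\<tau>. f (of_real a * \<tau> + of_real b))"
proof -
  from assms obtain A X where A: "\<And>\<tau>. Im \<tau> \<ge> X \<Longrightarrow> norm (f \<tau>) \<le> A"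
    unfolding cusp_bounded_def by metis
  have "norm (f (of_real a * \<tau> + of_real b)) \<le> A" if "Im \<tau> \<ge> X / a" for \<tau>
    using that assms(2) by (intro A) (simp add: field_simps)
  then show ?thesis unfolding cusp_bounded_def by blast
qed

text \<open>
  For \<open>z = r \<tau> + s\<close> and \<open>y = Im \<tau>\<close> one has \<open>|sn z|\<^sup>2 \<le> 4 exp (2 * pi * y * |r|)\<close>,
  while the \<open>n\<close>-th term of the product carries a factor of absolute value
  \<open>exp (- 2 * pi * y * (n + 1))\<close>. So the terms sum to a quantity that tends to 0
  when \<open>|r| < 1\<close>, and the product tends to 1.
\<close>

lemma theta_prod_bounds:
  fixes r s :: real
  assumes r: "\<bar>r\<bar> < 1"
  shows "eventually (\<lambda>y. \<forall>\<tau>. Im \<tau> = y \<longrightarrow>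
     1/2 \<le> norm (\<Prod>n. 1 + theta_term (of_real r * \<tau> + of_real s) \<tau> n) \<and>
     norm (\<Prod>n. 1 + theta_term (of_real r * \<tau> + of_real s) \<tau> n) \<le> exp (1/2)) at_top"
proof -
  define a where "a = 1 - \<bar>r\<bar>"
  have a: "a > 0" using r by (simp add: a_def)
  have "((\<lambda>y. 4 * exp (- 2 * pi * y * a) / (1 - exp (- 2 * pi * y)) ^ 3) \<longlongrightarrow> 0) at_top"
    using a by real_asymp
  then have "eventually (\<lambda>y. 4 * exp (- 2 * pi * y * a) / (1 - exp (- 2 * pi * y)) ^ 3 < 1/2) at_top"
    by (rule order_tendstoD) simp
  with eventually_gt_at_top[of 0] show ?thesis
  proof eventually_elim
    case (elim y)
    show ?case
    proof (intro allI impI)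
      fix \<tau> assume y: "Im \<tau> = y"
      define z where "z = of_real r * \<tau> + of_real s"
      define t where "t = exp (- 2 * pi * y)"
      have t: "0 < t" "t < 1" using elim by (simp_all add: t_def)
      have \<tau>: "Im \<tau> > 0" using y elim by simp
      have e1: "norm (ee (z/2)) \<le> exp (pi * y * \<bar>r\<bar>)" and e2: "norm (ee (-z/2)) \<le> exp (pi * y * \<bar>r\<bar>)"
        using elim(1) by (simp_all add: norm_ee z_def y abs_if mult.assoc)
      have "norm (sn z) \<le> 2 * exp (pi * y * \<bar>r\<bar>)"
        unfolding sn_def using norm_triangle_ineq4[of "ee (z/2)" "ee (-z/2)"] e1 e2 by linarith
      then have "(norm (sn z))\<^sup>2 \<le> (2 * exp (pi * y * \<bar>r\<bar>))\<^sup>2"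
        by (intro power_mono) auto
      also have "\<dots> = 4 * exp (2 * pi * y * \<bar>r\<bar>)"
        by (simp add: power_mult_distrib exp_double mult_ac flip: exp_of_nat_mult)
      finally have sn: "(norm (sn z))\<^sup>2 \<le> 4 * exp (2 * pi * y * \<bar>r\<bar>)" .
      define c where "c = (norm (sn z))\<^sup>2 / (1 - t)\<^sup>2"
      have tm: "norm (theta_term z \<tau> n) \<le> c * t ^ Suc n" for n
        using norm_theta_term_le[OF elim(1), of \<tau> z n] y by (simp add: c_def t_def)
      have sums: "(\<lambda>n. c * t ^ Suc n) sums (c * (t / (1 - t)))"
        using sums_mult[OF sums_mult[OF geometric_sums[of t], of t], of c] t by (simp add: mult_ac)
      have "(\<Sum>n. norm (theta_term z \<tau> n)) \<le> (\<Sum>n. c * t ^ Suc n)"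
        by (intro suminf_le tm summable_norm_theta_term \<tau> sums_summable[OF sums])
      also have "\<dots> = (norm (sn z))\<^sup>2 * (t / (1 - t) ^ 3)"
        using sums_unique[OF sums] by (simp add: c_def power2_eq_square power3_eq_cube)
      also have "\<dots> \<le> 4 * exp (2 * pi * y * \<bar>r\<bar>) * (t / (1 - t) ^ 3)"
        using t by (intro mult_right_mono sn) auto
      also have "\<dots> = 4 * (exp (2 * pi * y * \<bar>r\<bar>) * t) / (1 - t) ^ 3"
        by simp
      also have "exp (2 * pi * y * \<bar>r\<bar>) * t = exp (- 2 * pi * y * a)"
        unfolding t_def a_def exp_add [symmetric] by (rule arg_cong[of _ _ exp]) (simp add: algebra_simps)
      also have "4 * exp (- 2 * pi * y * a) / (1 - t) ^ 3 \<le> 1/2"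
        using elim(2) by (simp add: t_def)
      finally have le: "(\<Sum>n. norm (theta_term z \<tau> n)) \<le> 1/2" .
      show "1/2 \<le> norm (\<Prod>n. 1 + theta_term (of_real r * \<tau> + of_real s) \<tau> n) \<and>
          norm (\<Prod>n. 1 + theta_term (of_real r * \<tau> + of_real s) \<tau> n) \<le> exp (1/2)"
        using norm_prod_one_plus_ge[OF summable_norm_theta_term[OF \<tau>] le]
          norm_prod_one_plus_le[OF summable_norm_theta_term[OF \<tau>] le]
        by (simp add: z_def)
    qed
  qed
qed

lemma norm_klein:
  "norm (klein r s \<tau>) = exp (- pi * r\<^sup>2 * Im \<tau>) * norm (sn (of_real r * \<tau> + of_real s)) *
     norm (\<Prod>n. 1 + theta_term (of_real r * \<tau> + of_real s) \<tau> n)"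
  by (simp add: klein_def theta_def norm_mult norm_ee power2_eq_square)

lemma cusp_bounded_klein_0: "cusp_bounded (klein 0 s)"
proof (rule cusp_boundedI)
  have "norm (sn (of_real s)) \<le> 2"
    unfolding sn_def using norm_triangle_ineq4[of "ee (of_real s/2)" "ee (- of_real s/2)"]
    by (simp add: norm_ee)
  then show "eventually (\<lambda>y. \<forall>\<tau>. Im \<tau> = y \<longrightarrow> norm (klein 0 s \<tau>) \<le> 2 * exp (1/2)) at_top"
    using theta_prod_bounds[of 0 s] by (auto elim!: eventually_mono simp: norm_klein intro!: mult_mono)
qed

text \<open>
  For \<open>r \<noteq> 0\<close> the form grows like \<open>exp (pi * y * (|r| - r\<^sup>2))\<close>, whose exponent is
  nonnegative for \<open>|r| < 1\<close>. For \<open>r = 0\<close> it tends to the constant \<open>sn s\<close>; if that is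
  0, the form is identically 0 and the inverse is 0 by convention.
\<close>

lemma cusp_bounded_inverse_klein_aux:
  assumes r: "\<bar>r\<bar> < 1"
  shows "cusp_bounded (\<lambda>\<tau>. inverse (klein r s \<tau>))"
proof (cases "r = 0")
  case True
  show ?thesis
  proof (cases "sn (of_real s) = 0")
    case True
    then have "klein r s \<tau> = 0" for \<tau>
      by (simp add: klein_def theta_def \<open>r = 0\<close>)
    then show ?thesis by auto
  next
    case False
    have "eventually (\<lambda>y. \<forall>\<tau>. Im \<tau> = y \<longrightarrow> norm (inverse (klein r s \<tau>)) \<le> inverse (norm (sn (of_real s)) * (1/2))) at_top"
      using theta_prod_bounds[OF r, of s]
    proof eventually_elim
      case (elim y)
      show ?case
      proof (intro allI impI)
        fix \<tau> assume "Im \<tau> = y"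
        then have "norm (klein r s \<tau>) \<ge> norm (sn (of_real s)) * (1/2)"
          using mult_left_mono[of "1/2" "norm (\<Prod>n. 1 + theta_term (of_real s) \<tau> n)" "norm (sn (of_real s))"]
            elim True by (auto simp: norm_klein)
        then show "norm (inverse (klein r s \<tau>)) \<le> inverse (norm (sn (of_real s)) * (1/2))"
          using False unfolding norm_inverse by (intro le_imp_inverse_le) auto
      qed
    qed
    then show ?thesis by (rule cusp_boundedI)
  qed
next
  case False
  define a where "a = \<bar>r\<bar>"
  have a: "a > 0" using False by (simp add: a_def)
  have "((\<lambda>y. exp (- 2 * pi * y * a)) \<longlongrightarrow> 0) at_top"
    using a by real_asymp
  then have "eventually (\<lambda>y. exp (- 2 * pi * y * a) < 1/2) at_top"
    by (rule order_tendstoD) simp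
  with theta_prod_bounds[OF r, of s] eventually_gt_at_top[of 0]
  have "eventually (\<lambda>y. \<forall>\<tau>. Im \<tau> = y \<longrightarrow> norm (inverse (klein r s \<tau>)) \<le> 4) at_top"
  proof eventually_elim
    case (elim y)
    show ?case
    proof (intro allI impI)
      fix \<tau> assume y: "Im \<tau> = y"
      let ?z = "of_real r * \<tau> + of_real s"
      have "norm (sn ?z) \<ge> \<bar>norm (ee (?z/2)) - norm (ee (-?z/2))\<bar>"
        unfolding sn_def by (rule norm_triangle_ineq3)
      also have "\<bar>norm (ee (?z/2)) - norm (ee (-?z/2))\<bar> = exp (pi * y * a) - exp (- pi * y * a)"
      proof (cases "r > 0")
        case True
        then have "exp (- (pi * r * y)) \<le> exp (pi * r * y)"
          using elim(2) by simp
        then show ?thesis using True by (simp add: norm_ee y a_def mult_ac)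
      next
        case False
        then have "exp (pi * r * y) \<le> exp (- (pi * r * y))"
          using elim(2) by (simp add: mult_le_0_iff)
        then show ?thesis using False by (simp add: norm_ee y a_def mult_ac)
      qed
      also have "exp (- pi * y * a) = exp (pi * y * a) * exp (- 2 * pi * y * a)"
        by (simp flip: exp_add)
      also have "exp (pi * y * a) - exp (pi * y * a) * exp (- 2 * pi * y * a) \<ge> exp (pi * y * a) / 2"
        using mult_left_mono[of "exp (- 2 * pi * y * a)" "1/2" "exp (pi * y * a)"] elim(3) by simp
      finally have sn: "norm (sn ?z) \<ge> exp (pi * y * a) / 2" .
      have "pi * y * (a - r\<^sup>2) \<ge> 0"
        using elim(2) r abs_le_square_iff[of r 1] mult_left_le[of "\<bar>r\<bar>" "\<bar>r\<bar>"]
        by (intro mult_nonneg_nonneg) (auto simp: a_def power2_eq_square)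
      then have "1 \<le> exp (pi * y * (a - r\<^sup>2))"
        by simp
      also have "\<dots> = exp (- pi * r\<^sup>2 * Im \<tau>) * exp (pi * y * a)"
        by (simp add: y algebra_simps flip: exp_add)
      finally have "1/4 \<le> exp (- pi * r\<^sup>2 * Im \<tau>) * (exp (pi * y * a) / 2) * (1/2)"
        by simp
      also have "\<dots> \<le> norm (klein r s \<tau>)"
        unfolding norm_klein using sn elim(1) y by (intro mult_mono) auto
      finally have "inverse (norm (klein r s \<tau>)) \<le> inverse (1/4)"
        by (intro le_imp_inverse_le) auto
      then show "norm (inverse (klein r s \<tau>)) \<le> 4"
        by (simp add: norm_inverse)
    qed
  qed
  then show ?thesis by (rule cusp_boundedI)
qed

lemma cusp_bounded_cong:
  assumes "cusp_bounded g" "\<And>\<tau>. Im \<tau> > 0 \<Longrightarrow> norm (f \<tau>) = norm (g \<tau>)"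
  shows "cusp_bounded f"
proof -
  from assms(1) obtain A X where A: "\<And>\<tau>. Im \<tau> \<ge> X \<Longrightarrow> norm (g \<tau>) \<le> A"
    unfolding cusp_bounded_def by metis
  have "norm (f \<tau>) \<le> A" if "Im \<tau> \<ge> max X 1" for \<tau>
    using that A[of \<tau>] assms(2)[of \<tau>] by simp
  then show ?thesis unfolding cusp_bounded_def by blast
qed

text \<open>
  An even shift brings \<open>r\<close> into the interval from -1 to 1 without changing the norm;
  the endpoint is what the assumption excludes.
\<close>

lemma cusp_bounded_inverse_klein:
  assumes "\<And>m :: int. r \<noteq> 2 * of_int m + 1"
  shows "cusp_bounded (\<lambda>\<tau>. inverse (klein r s \<tau>))"
proof -
  define m where "m = - \<lfloor>(r + 1) / 2\<rfloor>"
  define r' where "r' = r + 2 * of_int m"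
  have "r' \<noteq> -1"
    using assms[of "- m - 1"] by (auto simp: r'_def)
  moreover have "-1 \<le> r'" "r' < 1"
    using floor_correct[of "(r + 1) / 2"] by (simp_all add: r'_def m_def field_simps)
  ultimately have "\<bar>r'\<bar> < 1" by linarith
  then have "cusp_bounded (\<lambda>\<tau>. inverse (klein r' s \<tau>))"
    by (rule cusp_bounded_inverse_klein_aux)
  then show ?thesis
  proof (rule cusp_bounded_cong)
    fix \<tau> assume "Im \<tau> > 0"
    from klein_shift[OF this, of r m s 0] show "norm (inverse (klein r s \<tau>)) = norm (inverse (klein r' s \<tau>))"
      by (simp add: r'_def norm_mult norm_ee norm_inverse)
  qed
qed

section \<open>Families permuted by the modular group\<close>

abbreviation upper_half :: "complex set" where "upper_half \<equiv> {\<tau>. Im \<tau> > 0}"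

lemma open_upper_half [simp]: "open upper_half"
  by (rule open_halfspace_Im_gt)

lemma Im_neg_inverse_pos: "Im \<tau> > 0 \<Longrightarrow> Im (- 1 / \<tau>) > 0"
  by (auto simp: Im_divide field_simps sum_power2_gt_zero_iff)

text \<open>
  Such a family is a homogeneous function of degree \<open>-d\<close> of a lattice with a point
  \<open>P\<close> of the lattice divided by \<open>L = 2 * d + 1\<close>: \<open>\<Psi> x y \<tau>\<close> is its value at the
  lattice spanned by \<open>\<tau>\<close> and 1 and at \<open>P = (x \<tau> + y) / L\<close>. A change of basis
  therefore acts on the row vector \<open>(x, y)\<close> by multiplication from the right. Only
  the two generators are recorded; \<open>modular\<close> derives the law for the whole group.
  The scalar \<open>\<sigma>\<close> is the value at 2 of the nebentypus character.
\<close>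

locale modular_family =
  fixes d :: nat and \<sigma> :: complex and \<Psi> :: "int \<Rightarrow> int \<Rightarrow> complex \<Rightarrow> complex"
  assumes hol: "\<Psi> x y holomorphic_on upper_half"
    and bdd: "cusp_bounded (\<Psi> x y)"
    and T: "Im \<tau> > 0 \<Longrightarrow> \<Psi> x y (\<tau> + 1) = \<Psi> x (x + y) \<tau>"
    and S: "Im \<tau> > 0 \<Longrightarrow> \<Psi> x y (- 1 / \<tau>) = \<tau> ^ d * \<Psi> y (- x) \<tau>"
    and level: "Im \<tau> > 0 \<Longrightarrow> \<Psi> (x + (2 * int d + 1) * m) (y + (2 * int d + 1) * n) \<tau> = \<Psi> x y \<tau>"
    and twice: "Im \<tau> > 0 \<Longrightarrow> \<Psi> (2 * x) (2 * y) \<tau> = \<sigma> * \<Psi> x y \<tau>"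
begin

lemma cong_level:
  assumes "Im \<tau> > 0" "[x = x'] (mod 2 * int d + 1)" "[y = y'] (mod 2 * int d + 1)"
  shows "\<Psi> x y \<tau> = \<Psi> x' y' \<tau>"
proof -
  from assms(2,3) obtain m n where "x = x' + (2 * int d + 1) * m" "y = y' + (2 * int d + 1) * n"
    by (auto simp: cong_iff_dvd_diff dvd_def algebra_simps)
  then show ?thesis using level[OF assms(1)] by simp
qed

lemma T_int:
  assumes "Im \<tau> > 0"
  shows "\<Psi> x y (\<tau> + of_int n) = \<Psi> x (y + n * x) \<tau>"
proof -
  have nat: "\<Psi> x y (\<tau> + of_nat k) = \<Psi> x (y + int k * x) \<tau>" if "Im \<tau> > 0" for k y \<tau>
    using that
  proof (induction k arbitrary: y)
    case (Suc k)
    have "\<Psi> x y (\<tau> + of_nat (Suc k)) = \<Psi> x y ((\<tau> + of_nat k) + 1)"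
      by (simp add: algebra_simps)
    also have "\<dots> = \<Psi> x (x + y) (\<tau> + of_nat k)"
      using Suc.prems by (intro T) simp
    also have "\<dots> = \<Psi> x (x + y + int k * x) \<tau>"
      using Suc by blast
    finally show ?case by (simp add: algebra_simps)
  qed simp
  show ?thesis
  proof (cases "n \<ge> 0")
    case True
    then show ?thesis using nat[OF assms, of y "nat n"] by simp
  next
    case False
    then show ?thesis using nat[of "\<tau> + of_int n" "y + n * x" "nat (-n)"] assms by simp
  qed
qed

lemma minus:
  assumes "Im \<tau> > 0"
  shows "\<Psi> (- x) (- y) \<tau> = (- 1) ^ d * \<Psi> x y \<tau>"
proof -
  have "\<Psi> x y \<tau> = \<Psi> x y (- 1 / (- 1 / \<tau>))"
    using assms by (auto simp: field_simps)
  also have "\<dots> = ((- 1 / \<tau>) * \<tau>) ^ d * \<Psi> (- x) (- y) \<tau>"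
    unfolding S[OF Im_neg_inverse_pos[OF assms]] S[OF assms] power_mult_distrib by simp
  also have "(- 1 / \<tau>) * \<tau> = - 1"
    using assms by auto
  finally show ?thesis
    by (simp flip: power_mult_distrib mult.assoc)
qed

text \<open>
  Euclid's algorithm on the first column of the matrix, with \<open>T_int\<close> as division
  step and \<open>S\<close> as swap.
\<close>

lemma modular:
  assumes "a * e - b * c = 1" "Im \<tau> > 0"
  shows "Im ((of_int a * \<tau> + of_int b) / (of_int c * \<tau> + of_int e)) > 0 \<and>
    \<Psi> x y ((of_int a * \<tau> + of_int b) / (of_int c * \<tau> + of_int e))
     = (of_int c * \<tau> + of_int e) ^ d * \<Psi> (x * a + y * c) (x * b + y * e) \<tau>"
  using assms
proof (induction "nat \<bar>c\<bar>" arbitrary: a b c e x y rule: less_induct)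
  case less
  note \<tau> = less.prems(2)
  show ?case
  proof (cases "c = 0")
    case True
    then have "a * e = 1" using less.prems by simp
    then have "a = 1 \<and> e = 1 \<or> a = -1 \<and> e = -1"
      using zmult_eq_1_iff by blast
    then consider "a = 1" "e = 1" | "a = -1" "e = -1" by blast
    then show ?thesis
    proof cases
      case 1
      then show ?thesis using True T_int[OF \<tau>, of x y b] \<tau> by (simp add: algebra_simps)
    next
      case 2
      have "(-1) ^ d * ((-1) ^ d * w) = (w :: complex)" for w
        by (simp flip: power_mult_distrib mult.assoc)
      then show ?thesis
        using 2 True T_int[OF \<tau>, of x y "-b"] minus[OF \<tau>, of x "y - b * x"] \<tau>
        by (simp add: algebra_simps)
    qed
  next
    case False
    \<comment> \<open>The matrix is the translation by \<open>n\<close>, times the inversion, times the matrix with rows \<open>(c, e)\<close> and \<open>(- a', - b')\<close>.\<close>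
    define n where "n = a div c"
    define a' where "a' = a mod c"
    define b' where "b' = b - n * e"
    have a: "a = n * c + a'" and b: "b = n * e + b'"
      by (simp_all add: n_def a'_def b'_def)
    have lt: "\<bar>a'\<bar> < \<bar>c\<bar>"
      using False abs_mod_less by (simp add: a'_def)
    define w where "w = (of_int c * \<tau> + of_int e) / (of_int (- a') * \<tau> + of_int (- b'))"
    have det: "c * (- b') - e * (- a') = 1"
      using less.prems(1) by (simp add: a b algebra_simps)
    have IH: "Im w > 0" and IH': "\<And>x y. \<Psi> x y w
       = (of_int (- a') * \<tau> + of_int (- b')) ^ d * \<Psi> (x * c + y * (- a')) (x * e + y * (- b')) \<tau>"
      using less.hyps[of "- a'" c "- b'" e] lt det \<tau> unfolding w_def by auto
    let ?D = "of_int c * \<tau> + of_int e" and ?D' = "of_int (- a') * \<tau> + of_int (- b') :: complex"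
    have D': "?D' \<noteq> 0"
    proof
      assume "?D' = 0"
      then have "w = 0" by (simp add: w_def)
      with IH show False by simp
    qed
    have D: "?D \<noteq> 0"
      using IH by (auto simp: w_def)
    have eq: "(of_int a * \<tau> + of_int b) / ?D = - 1 / w + of_int n"
      using D D' unfolding w_def a b by (simp add: field_simps)
    have "Im (- 1 / w + of_int n) > 0"
      using Im_neg_inverse_pos[OF IH] by simp
    moreover have "\<Psi> x y (- 1 / w + of_int n) = \<Psi> x (y + n * x) (- 1 / w)"
      using T_int[OF Im_neg_inverse_pos[OF IH]] .
    moreover have "\<dots> = w ^ d * \<Psi> (y + n * x) (- x) w"
      using S[OF IH] .
    moreover have "\<dots> = (w * ?D') ^ d * \<Psi> ((y + n * x) * c + x * a') ((y + n * x) * e + x * b') \<tau>"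
      unfolding IH' power_mult_distrib by simp
    moreover have "w * ?D' = ?D"
      using D' by (simp add: w_def)
    moreover have "(y + n * x) * c + x * a' = x * a + y * c" "(y + n * x) * e + x * b' = x * b + y * e"
      by (simp_all add: a b algebra_simps)
    ultimately show ?thesis
      unfolding eq by simp
  qed
qed

lemma scale:
  assumes "Im \<tau> > 0"
  shows "\<Psi> ((- 1) ^ j * 2 ^ i * x) ((- 1) ^ j * 2 ^ i * y) \<tau> = ((- 1) ^ d) ^ j * \<sigma> ^ i * \<Psi> x y \<tau>"
proof -
  have "\<Psi> (2 ^ i * x) (2 ^ i * y) \<tau> = \<sigma> ^ i * \<Psi> x y \<tau>" for x y
    by (induction i) (simp_all add: mult.assoc twice[OF assms])
  moreover have "\<Psi> ((- 1) ^ j * x) ((- 1) ^ j * y) \<tau> = ((- 1) ^ d) ^ j * \<Psi> x y \<tau>" for x y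
    by (induction j) (simp_all add: minus[OF assms])
  ultimately show ?thesis by (simp add: mult.assoc)
qed

end

text \<open>
  The Hecke operator at 2: a sum over the three lattices that contain the given one
  with index 2, up to scaling. The vectors are the coordinates of \<open>2 P\<close> instead of
  \<open>P\<close> in the new bases; this avoids the inverse of 2 modulo the level and costs a
  factor \<open>\<sigma>\<close>, so that the operator is \<open>\<sigma>\<close> times the classical one.
\<close>

definition hecke2 where
  "hecke2 d \<Psi> x y \<tau> = 2 ^ (d - 1) * \<Psi> x (2 * y) (2 * \<tau>)
     + (\<Psi> (2 * x) y (\<tau> / 2) + \<Psi> (2 * x) (y - x) ((\<tau> + 1) / 2)) / (2 :: complex)"
  for \<Psi> :: "int \<Rightarrow> int \<Rightarrow> complex \<Rightarrow> complex"

text \<open>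
  The translation exchanges the second and third summand, the inversion exchanges
  the first and second; each fixes the remaining one.
\<close>

lemma modular_family_hecke2:
  assumes "modular_family d \<sigma> \<Psi>" and d: "d > 0"
  shows "modular_family d \<sigma> (hecke2 d \<Psi>)"
proof -
  interpret modular_family d \<sigma> \<Psi> by fact
  show ?thesis
  proof
    fix x y :: int
    have "(\<lambda>\<tau>. \<Psi> u v (of_real a * \<tau> + of_real b)) holomorphic_on upper_half" if "a > 0" for u v a b
    proof -
      have "(\<Psi> u v \<circ> (\<lambda>\<tau>. of_real a * \<tau> + of_real b)) holomorphic_on upper_half"
        by (rule holomorphic_on_compose_gen[OF _ hol]) (use that in \<open>auto intro!: holomorphic_intros\<close>)
      then show ?thesis by (simp add: o_def)
    qed
    from this[of 2 x "2 * y" 0] this[of "1/2" "2 * x" y 0] this[of "1/2" "2 * x" "y - x" "1/2"]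
    show "hecke2 d \<Psi> x y holomorphic_on upper_half"
      unfolding hecke2_def by (auto intro!: holomorphic_intros simp: add_divide_distrib)
    from cusp_bounded_affine[OF bdd, of 2 x "2 * y" 0] cusp_bounded_affine[OF bdd, of "1/2" "2 * x" y 0]
      cusp_bounded_affine[OF bdd, of "1/2" "2 * x" "y - x" "1/2"]
    have "cusp_bounded (\<lambda>\<tau>. 2 ^ (d - 1) * \<Psi> x (2 * y) (2 * \<tau>)
      + (1/2) * (\<Psi> (2 * x) y (\<tau> / 2) + \<Psi> (2 * x) (y - x) ((\<tau> + 1) / 2)))"
      by (intro cusp_bounded_add cusp_bounded_mult cusp_bounded_const) (auto simp: add_divide_distrib)
    then show "cusp_bounded (hecke2 d \<Psi> x y)"
      by (simp add: hecke2_def [abs_def])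
  next
    fix x y :: int and \<tau> :: complex assume \<tau>: "Im \<tau> > 0"
    show "hecke2 d \<Psi> (2 * x) (2 * y) \<tau> = \<sigma> * hecke2 d \<Psi> x y \<tau>"
      using twice[of "2 * \<tau>" x "2 * y"] twice[of "\<tau> / 2" "2 * x" y]
        twice[of "(\<tau> + 1) / 2" "2 * x" "y - x"] \<tau>
      by (simp add: hecke2_def algebra_simps)
    show "hecke2 d \<Psi> (x + (2 * int d + 1) * m) (y + (2 * int d + 1) * n) \<tau> = hecke2 d \<Psi> x y \<tau>" for m n
    proof -
      let ?L = "2 * int d + 1"
      have *: "2 * (x + ?L * m) = 2 * x + ?L * (2 * m)" "2 * (y + ?L * n) = 2 * y + ?L * (2 * n)"
        "y + ?L * n - (x + ?L * m) = (y - x) + ?L * (n - m)"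
        by (simp_all add: algebra_simps)
      show ?thesis
        unfolding hecke2_def *
        using level[of "2 * \<tau>" x m "2 * y" "2 * n"] level[of "\<tau> / 2" "2 * x" "2 * m" y n]
          level[of "(\<tau> + 1) / 2" "2 * x" "2 * m" "y - x" "n - m"] \<tau>
        by simp
    qed
    show "hecke2 d \<Psi> x y (\<tau> + 1) = hecke2 d \<Psi> x (x + y) \<tau>"
    proof -
      have *: "2 * (\<tau> + 1) = 2 * \<tau> + of_int 2" "(\<tau> + 1 + 1) / 2 = \<tau> / 2 + of_int 1"
        by (simp_all add: field_simps)
      have "Im (2 * \<tau>) > 0" "Im (\<tau> / 2) > 0"
        using \<tau> by simp_all
      then show ?thesis
        unfolding hecke2_def * by (simp only: T_int) (simp add: algebra_simps)
    qed
    show "hecke2 d \<Psi> x y (- 1 / \<tau>) = \<tau> ^ d * hecke2 d \<Psi> y (- x) \<tau>"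
    proof -
      have 1: "\<Psi> x (2 * y) (2 * (- 1 / \<tau>)) = (\<tau> / 2) ^ d * \<Psi> (2 * y) (- x) (\<tau> / 2)"
        using S[of "\<tau> / 2" x "2 * y"] \<tau> by simp
      have 2: "\<Psi> (2 * x) y (- 1 / \<tau> / 2) = (2 * \<tau>) ^ d * \<Psi> y (- 2 * x) (2 * \<tau>)"
        using S[of "2 * \<tau>" "2 * x" y] \<tau> by (simp add: mult.commute)
      have 3: "\<Psi> (2 * x) (y - x) ((- 1 / \<tau> + 1) / 2) = \<tau> ^ d * \<Psi> (2 * y) (- x - y) ((\<tau> + 1) / 2)"
      proof -
        \<comment> \<open>The inversion acts on \<open>w\<close> by the matrix with rows \<open>(1, -1)\<close> and \<open>(2, -1)\<close>.\<close>
        define w where "w = (\<tau> + 1) / 2"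
        have w: "Im w > 0" using \<tau> by (simp add: w_def)
        have m: "of_int 2 * w + of_int (- 1) = \<tau>"
          by (simp add: w_def field_simps)
        have "\<tau> \<noteq> 0" using \<tau> by auto
        then have eq: "(of_int 1 * w + of_int (- 1)) / \<tau> = (- 1 / \<tau> + 1) / 2"
          by (simp add: w_def field_simps)
        have args: "2 * x * 1 + (y - x) * 2 = 2 * y" "2 * x * (- 1) + (y - x) * (- 1) = - x - y"
          by simp_all
        have "\<Psi> (2 * x) (y - x) ((of_int 1 * w + of_int (- 1)) / (of_int 2 * w + of_int (- 1)))
          = (of_int 2 * w + of_int (- 1)) ^ d * \<Psi> (2 * x * 1 + (y - x) * 2) (2 * x * (- 1) + (y - x) * (- 1)) w"
          by (rule modular[THEN conjunct2]) (use w in simp_all)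
        then show ?thesis
          unfolding m eq args by (simp only: w_def)
      qed
      have "(2 :: complex) ^ d = 2 * 2 ^ (d - 1)"
        using d by (metis power_minus_mult mult.commute)
      then show ?thesis
        unfolding hecke2_def 1 2 3 by (simp add: power_divide power_mult_distrib field_simps)
    qed
  qed
qed

lemma modular_family_add:
  assumes "modular_family d \<sigma> \<Psi>" "modular_family d \<sigma> \<Psi>'"
  shows "modular_family d \<sigma> (\<lambda>x y \<tau>. \<Psi> x y \<tau> + \<Psi>' x y \<tau>)"
proof -
  interpret A: modular_family d \<sigma> \<Psi> by fact
  interpret B: modular_family d \<sigma> \<Psi>' by fact
  show ?thesis
  proof
    fix x y :: int
    show "(\<lambda>\<tau>. \<Psi> x y \<tau> + \<Psi>' x y \<tau>) holomorphic_on upper_half"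
      by (intro holomorphic_intros A.hol B.hol)
    show "cusp_bounded (\<lambda>\<tau>. \<Psi> x y \<tau> + \<Psi>' x y \<tau>)"
      by (intro cusp_bounded_add A.bdd B.bdd)
  next
    fix \<tau> :: complex assume \<tau>: "Im \<tau> > 0"
    fix x y m n :: int
    show "\<Psi> x y (\<tau> + 1) + \<Psi>' x y (\<tau> + 1) = \<Psi> x (x + y) \<tau> + \<Psi>' x (x + y) \<tau>"
      unfolding A.T[OF \<tau>] B.T[OF \<tau>] ..
    show "\<Psi> x y (- 1 / \<tau>) + \<Psi>' x y (- 1 / \<tau>) = \<tau> ^ d * (\<Psi> y (- x) \<tau> + \<Psi>' y (- x) \<tau>)"
      unfolding A.S[OF \<tau>] B.S[OF \<tau>] by (simp add: algebra_simps)
    show "\<Psi> (x + (2 * int d + 1) * m) (y + (2 * int d + 1) * n) \<tau>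
        + \<Psi>' (x + (2 * int d + 1) * m) (y + (2 * int d + 1) * n) \<tau> = \<Psi> x y \<tau> + \<Psi>' x y \<tau>"
      unfolding A.level[OF \<tau>] B.level[OF \<tau>] ..
    show "\<Psi> (2 * x) (2 * y) \<tau> + \<Psi>' (2 * x) (2 * y) \<tau> = \<sigma> * (\<Psi> x y \<tau> + \<Psi>' x y \<tau>)"
      unfolding A.twice[OF \<tau>] B.twice[OF \<tau>] by (simp add: algebra_simps)
  qed
qed

lemma modular_family_cmult:
  assumes "modular_family d \<sigma> \<Psi>"
  shows "modular_family d \<sigma> (\<lambda>x y \<tau>. c * \<Psi> x y \<tau>)"
proof -
  interpret A: modular_family d \<sigma> \<Psi> by fact
  show ?thesis
  proof
    fix x y :: int
    show "(\<lambda>\<tau>. c * \<Psi> x y \<tau>) holomorphic_on upper_half"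
      by (intro holomorphic_intros A.hol)
    show "cusp_bounded (\<lambda>\<tau>. c * \<Psi> x y \<tau>)"
      by (intro cusp_bounded_mult cusp_bounded_const A.bdd)
  next
    fix \<tau> :: complex assume \<tau>: "Im \<tau> > 0"
    fix x y m n :: int
    show "c * \<Psi> x y (\<tau> + 1) = c * \<Psi> x (x + y) \<tau>"
      unfolding A.T[OF \<tau>] ..
    show "c * \<Psi> x y (- 1 / \<tau>) = \<tau> ^ d * (c * \<Psi> y (- x) \<tau>)"
      unfolding A.S[OF \<tau>] by (simp add: algebra_simps)
    show "c * \<Psi> (x + (2 * int d + 1) * m) (y + (2 * int d + 1) * n) \<tau> = c * \<Psi> x y \<tau>"
      unfolding A.level[OF \<tau>] ..
    show "c * \<Psi> (2 * x) (2 * y) \<tau> = \<sigma> * (c * \<Psi> x y \<tau>)"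
      unfolding A.twice[OF \<tau>] by (simp add: algebra_simps)
  qed
qed

section \<open>The family of the core generating function\<close>

text \<open>
  The factor 2 turns a change of \<open>x\<close> or \<open>y\<close> by a multiple of the level into an even
  shift of the characteristic, to which \<open>klein_shift\<close> applies.
\<close>

definition klein_div :: "nat \<Rightarrow> int \<Rightarrow> int \<Rightarrow> int \<Rightarrow> complex \<Rightarrow> complex" where
  "klein_div d a x y = klein (2 * of_int (a * x) / of_int (2 * int d + 1)) (2 * of_int (a * y) / of_int (2 * int d + 1))"

text \<open>
  Up to sign, the member at \<open>(1, 0)\<close> is \<open>\<eta>(\<tau>)\<^sup>L / \<eta>(\<tau> / L)\<close> with \<open>L = 2 * d + 1\<close>,
  that is, the generating function of the \<open>L\<close>-cores in \<open>q\<^bsup>1/L\<^esup>\<close> times a power of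
  \<open>q\<^bsup>1/L\<^esup>\<close>; see \<open>core_family_eq_core_fun\<close>. If \<open>x\<close> and \<open>y\<close> are both multiples of the
  level, the Klein forms vanish identically and the member is 0 because
  \<open>inverse 0 = 0\<close>, so the transformation laws need no exception.
\<close>

definition core_family :: "nat \<Rightarrow> int \<Rightarrow> int \<Rightarrow> complex \<Rightarrow> complex" where
  "core_family d x y \<tau> = (\<Prod>a=1..int d. inverse (klein_div d a x y \<tau>))"

lemma level_real_pos: "real_of_int (2 * int d + 1) > 0"
  by simp

lemma klein_div_level:
  assumes \<tau>: "Im \<tau> > 0"
  shows "klein_div d a (x + (2 * int d + 1) * m) (y + (2 * int d + 1) * n) \<tau>
    = ee (of_real (2 * of_int (a\<^sup>2 * (x * n - y * m)) / of_int (2 * int d + 1))) * klein_div d a x y \<tau>"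
proof -
  define L where "L = real_of_int (2 * int d + 1)"
  have L: "L \<noteq> 0" using level_real_pos[of d] by (simp add: L_def)
  have 1: "2 * of_int (a * (x + (2 * int d + 1) * m)) / L = 2 * of_int (a * x) / L + 2 * of_int (a * m)"
    and 2: "2 * of_int (a * (y + (2 * int d + 1) * n)) / L = 2 * of_int (a * y) / L + 2 * of_int (a * n)"
    using L by (simp_all add: field_simps L_def)
  have 3: "2 * of_int (a * x) / L * of_int (a * n) - 2 * of_int (a * y) / L * of_int (a * m)
      = 2 * of_int (a\<^sup>2 * (x * n - y * m)) / L"
    by (simp add: algebra_simps power2_eq_square diff_divide_distrib)
  show ?thesis
    unfolding klein_div_def L_def [symmetric] 1 2 3 [symmetric] klein_shift[OF \<tau>] by simp
qed

lemma klein_div_reflect: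
  assumes \<tau>: "Im \<tau> > 0"
  shows "klein_div d (2 * int d + 1 - a) x y \<tau> = - klein_div d a x y \<tau>"
proof -
  define L where "L = real_of_int (2 * int d + 1)"
  have L: "L \<noteq> 0" using level_real_pos[of d] by (simp add: L_def)
  have 1: "2 * of_int ((2 * int d + 1 - a) * x) / L = - (2 * of_int (a * x) / L) + 2 * of_int x" for x
    using L by (simp add: field_simps L_def)
  have 2: "- (2 * of_int (a * x) / L) * of_int y - - (2 * of_int (a * y) / L) * of_int x = 0"
    by simp
  have "complex_of_real (- (2 * of_int (a * x) / L)) * of_int y - complex_of_real (- (2 * of_int (a * y) / L)) * of_int x = 0"
    by simp
  then show ?thesis
    unfolding klein_div_def L_def [symmetric] 1 klein_shift[OF \<tau>] using klein_minus by simp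
qed

text \<open>
  As in Gauss's lemma for the quadratic residue symbol of 2: doubling permutes 1,
  ..., \<open>d\<close> up to reflection, and the reflected numbers are those whose image is odd.
\<close>

lemma prod_double_reflect:
  fixes h :: "int \<Rightarrow> complex"
  assumes "\<And>a. h (2 * int d + 1 - a) = - h a"
  shows "(\<Prod>a=1..int d. h (2 * a)) = (- 1) ^ ((d + 1) div 2) * (\<Prod>a=1..int d. h a)"
proof -
  let ?A = "{1..int d}"
  have fin: "finite {a\<in>?A. P a}" for P
    by (rule finite_subset[of _ ?A]) auto
  have "(\<Prod>a=1..int d. h (2 * a)) = (\<Prod>a\<in>{a\<in>?A. 2 * a \<le> int d}. h (2 * a)) * (\<Prod>a\<in>{a\<in>?A. \<not> 2 * a \<le> int d}. h (2 * a))"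
    by (subst prod.union_disjoint [OF fin fin, symmetric]) (auto intro!: prod.cong)
  also have "(\<Prod>a\<in>{a\<in>?A. 2 * a \<le> int d}. h (2 * a)) = (\<Prod>a\<in>{a\<in>?A. even a}. h a)"
    by (rule prod.reindex_bij_witness[of _ "\<lambda>a. a div 2" "\<lambda>a. 2 * a"]) auto
  also have "(\<Prod>a\<in>{a\<in>?A. \<not> 2 * a \<le> int d}. h (2 * a)) = (\<Prod>a\<in>{a\<in>?A. odd a}. - h a)"
  proof (rule prod.reindex_bij_witness[of _ "\<lambda>b. (2 * int d + 1 - b) div 2" "\<lambda>a. 2 * int d + 1 - 2 * a"])
    show "- h (2 * int d + 1 - 2 * a) = h (2 * a)" for a
      by (simp add: assms)
  qed (auto elim!: oddE)
  also have "\<dots> = (- 1) ^ card {a\<in>?A. odd a} * (\<Prod>a\<in>{a\<in>?A. odd a}. h a)"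
    by (subst prod_uminus) simp
  also have "card {a\<in>?A. odd a} = (d + 1) div 2"
  proof -
    have "bij_betw (\<lambda>i. 2 * int i + 1) {..<(d + 1) div 2} {a\<in>?A. odd a}"
      by (rule bij_betwI[of _ _ _ "\<lambda>a. nat (a div 2)"]) (auto elim!: oddE)
    then show ?thesis using bij_betw_same_card by fastforce
  qed
  also have "(\<Prod>a\<in>{a\<in>?A. even a}. h a) * ((- 1) ^ ((d + 1) div 2) * (\<Prod>a\<in>{a\<in>?A. odd a}. h a))
    = (- 1) ^ ((d + 1) div 2) * ((\<Prod>a\<in>{a\<in>?A. even a}. h a) * (\<Prod>a\<in>{a\<in>?A. odd a}. h a))"
    by simp
  also have "(\<Prod>a\<in>{a\<in>?A. even a}. h a) * (\<Prod>a\<in>{a\<in>?A. odd a}. h a) = (\<Prod>a=1..int d. h a)"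
    by (subst prod.union_disjoint [OF fin fin, symmetric]) (auto intro!: prod.cong)
  finally show ?thesis .
qed

lemma sum_squares_int: "6 * (\<Sum>a=1..int d. a\<^sup>2) = int d * (int d + 1) * (2 * int d + 1)"
proof (induction d)
  case (Suc d)
  have "{1..int (Suc d)} = insert (int (Suc d)) {1..int d}" by auto
  then have "6 * (\<Sum>a=1..int (Suc d). a\<^sup>2) = 6 * (int (Suc d))\<^sup>2 + 6 * (\<Sum>a=1..int d. a\<^sup>2)"
    by simp
  then show ?case unfolding Suc by (simp add: algebra_simps power2_eq_square)
qed simp

text \<open>
  The exponential factors from \<open>klein_div_level\<close> multiply to 1 because twice the sum of the
  squares up to \<open>d\<close> is \<open>d (d + 1) / 3\<close> times the level, and this is where 3 must not
  divide the level.
\<close>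

lemma modular_family_core_family:
  assumes d3: "\<not> 3 dvd 2 * d + 1"
  shows "modular_family d ((- 1) ^ ((d + 1) div 2)) (core_family d)"
proof
  fix x y :: int
  show "core_family d x y holomorphic_on upper_half"
    unfolding core_family_def [abs_def]
  proof (rule holomorphic_on_prod)
    fix a
    show "(\<lambda>\<tau>. inverse (klein_div d a x y \<tau>)) holomorphic_on upper_half"
    proof (cases "\<forall>\<tau>\<in>upper_half. klein_div d a x y \<tau> \<noteq> 0")
      case True
      then show ?thesis
        unfolding klein_div_def by (intro holomorphic_intros holomorphic_klein_comp open_upper_half) auto
    next
      case False
      then have "klein_div d a x y \<tau> = 0" if "\<tau> \<in> upper_half" for \<tau>
        using that by (auto simp: klein_div_def klein_eq_0_iff)
      then show ?thesis
        by (intro holomorphic_transform[OF holomorphic_on_const[of 0]]) auto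
    qed
  qed
  show "cusp_bounded (core_family d x y)"
    unfolding core_family_def [abs_def] klein_div_def
  proof (intro cusp_bounded_prod cusp_bounded_inverse_klein notI)
    fix a m :: int
    assume "2 * real_of_int (a * x) / real_of_int (2 * int d + 1) = 2 * real_of_int m + 1"
    then have "real_of_int (2 * (a * x)) = real_of_int ((2 * m + 1) * (2 * int d + 1))"
      using level_real_pos[of d] by (simp add: field_simps)
    then have "2 * (a * x) = (2 * m + 1) * (2 * int d + 1)"
      by (simp only: of_int_eq_iff)
    moreover have "even (2 * (a * x))" "odd ((2 * m + 1) * (2 * int d + 1))" by auto
    ultimately show False by metis
  qed
next
  fix x y :: int and \<tau> :: complex assume \<tau>: "Im \<tau> > 0"
  show "core_family d x y (\<tau> + 1) = core_family d x (x + y) \<tau>"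
    unfolding core_family_def klein_div_def klein_T
    by (simp add: add_divide_distrib distrib_left del: of_int_mult of_int_add) (simp add: add_divide_distrib distrib_left)
  show "core_family d x y (- 1 / \<tau>) = \<tau> ^ d * core_family d y (- x) \<tau>"
    unfolding core_family_def klein_div_def klein_S[OF \<tau>]
    by (simp add: divide_inverse prod.distrib)
  show "core_family d (2 * x) (2 * y) \<tau> = (- 1) ^ ((d + 1) div 2) * core_family d x y \<tau>"
  proof -
    have "klein_div d a (2 * x) (2 * y) \<tau> = klein_div d (2 * a) x y \<tau>" for a
      by (simp add: klein_div_def mult_ac)
    then have "core_family d (2 * x) (2 * y) \<tau> = (\<Prod>a=1..int d. inverse (klein_div d (2 * a) x y \<tau>))"
      by (simp add: core_family_def)
    also have "\<dots> = (- 1) ^ ((d + 1) div 2) * (\<Prod>a=1..int d. inverse (klein_div d a x y \<tau>))"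
      by (rule prod_double_reflect) (simp add: klein_div_reflect[OF \<tau>])
    finally show ?thesis by (simp add: core_family_def)
  qed
  fix m n :: int
  show "core_family d (x + (2 * int d + 1) * m) (y + (2 * int d + 1) * n) \<tau> = core_family d x y \<tau>"
  proof -
    define L where "L = 2 * int d + 1"
    have "(\<Prod>a=1..int d. ee (of_real (2 * of_int (a\<^sup>2 * (x * n - y * m)) / of_int L))) = 1"
    proof -
      have "\<not> 3 dvd 2 * int d + 1"
        using d3 by presburger
      then have "3 dvd int d \<or> 3 dvd int d + 1"
        by presburger
      then have "3 dvd int d * (int d + 1)"
        by (auto intro: dvd_mult dvd_mult2)
      then obtain k where k: "int d * (int d + 1) = 3 * k" ..
      have s: "2 * (\<Sum>a=1..int d. a\<^sup>2) = k * L"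
        using sum_squares_int[of d] unfolding k L_def by simp
      have "(\<Prod>a=1..int d. ee (of_real (2 * of_int (a\<^sup>2 * (x * n - y * m)) / of_int L)))
        = ee (\<Sum>a=1..int d. of_real (2 * of_int (a\<^sup>2 * (x * n - y * m)) / of_int L))"
        by (simp add: ee_def exp_sum sum_distrib_left)
      also have "(\<Sum>a=1..int d. complex_of_real (2 * of_int (a\<^sup>2 * (x * n - y * m)) / of_int L))
        = of_int (2 * (\<Sum>a=1..int d. a\<^sup>2)) * of_int (x * n - y * m) / of_int L"
        by (simp add: sum_distrib_left sum_distrib_right sum_divide_distrib mult_ac)
      also have "\<dots> = of_int (k * (x * n - y * m))"
      proof -
        have "L \<noteq> 0" by (simp add: L_def)
        then have "complex_of_int L \<noteq> 0" by simp
        then show ?thesis unfolding s by (simp del: of_int_eq_0_iff)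
      qed
      finally show ?thesis by simp
    qed
    then have "(\<Prod>a=1..int d. klein_div d a (x + L * m) (y + L * n) \<tau>) = (\<Prod>a=1..int d. klein_div d a x y \<tau>)"
      unfolding L_def klein_div_level[OF \<tau>] prod.distrib by simp
    then show ?thesis
      unfolding core_family_def L_def [symmetric]
      by (simp only: prod_inversef[unfolded comp_def])
  qed
qed

section \<open>Holomorphic functions of level one\<close>

text \<open>
  If \<open>|Re \<tau>| \<le> 1/2\<close> and \<open>Im \<tau> < 1/2\<close>, then \<open>|\<tau>|\<^sup>2 \<le> 1/2\<close> and inversion at least
  doubles the imaginary part. So the reduction ends after a number of steps that
  \<open>Im \<tau>\<close> controls.
\<close>

lemma reduce_to_strip:
  assumes T: "\<And>\<tau>. Im \<tau> > 0 \<Longrightarrow> f (\<tau> + 1) = f \<tau>" and S: "\<And>\<tau>. Im \<tau> > 0 \<Longrightarrow> f (- 1 / \<tau>) = f \<tau>"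
    and \<tau>: "Im \<tau> > 0"
  shows "\<exists>\<tau>'. \<bar>Re \<tau>'\<bar> \<le> 1/2 \<and> Im \<tau>' \<ge> 1/2 \<and> f \<tau>' = (f \<tau> :: complex)"
proof -
  have shift: "\<exists>\<tau>'. \<bar>Re \<tau>'\<bar> \<le> 1/2 \<and> Im \<tau>' = Im \<tau> \<and> f \<tau>' = f \<tau>" if \<tau>: "Im \<tau> > 0" for \<tau>
  proof -
    have nat: "f (\<tau> + of_nat k) = f \<tau>" if "Im \<tau> > 0" for k \<tau>
    proof (induction k)
      case (Suc k)
      then show ?case using T[of "\<tau> + of_nat k"] that by (simp add: algebra_simps)
    qed simp
    have int: "f (\<tau> + of_int k) = f \<tau>" for k
      using nat[OF \<tau>, of "nat k"] nat[of "\<tau> + of_int k" "nat (- k)"] \<tau> by (cases "k \<ge> 0") simp_all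
    have "\<bar>Re (\<tau> + of_int (- round (Re \<tau>)))\<bar> \<le> 1/2"
      using of_int_round_abs_le[of "Re \<tau>"] by (simp add: abs_minus_commute)
    then show ?thesis using int[of "- round (Re \<tau>)"] by (intro exI[of _ "\<tau> + of_int (- round (Re \<tau>))"]) simp
  qed
  have "\<exists>\<tau>'. \<bar>Re \<tau>'\<bar> \<le> 1/2 \<and> Im \<tau>' \<ge> 1/2 \<and> f \<tau>' = f \<tau>" if "Im \<tau> > 0" "Im \<tau> * 2 ^ n \<ge> 1/2" for n \<tau>
    using that
  proof (induction n arbitrary: \<tau>)
    case 0
    then show ?case using shift[of \<tau>] by auto
  next
    case (Suc n)
    obtain \<tau>' where \<tau>': "\<bar>Re \<tau>'\<bar> \<le> 1/2" "Im \<tau>' = Im \<tau>" "f \<tau>' = f \<tau>"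
      using shift Suc.prems by blast
    show ?case
    proof (cases "Im \<tau>' \<ge> 1/2")
      case True
      then show ?thesis using \<tau>' by blast
    next
      case False
      have pos: "Im \<tau>' > 0" using \<tau>' Suc.prems by simp
      have "(Re \<tau>')\<^sup>2 \<le> (1/2)\<^sup>2"
        using \<tau>'(1) by (metis abs_ge_zero power2_abs power_mono)
      moreover have "(Im \<tau>')\<^sup>2 \<le> (1/2)\<^sup>2"
        using False pos by (intro power_mono) auto
      ultimately have n: "(cmod \<tau>')\<^sup>2 \<le> 1/2"
        unfolding cmod_power2 by (simp add: power2_eq_square)
      have n0: "(cmod \<tau>')\<^sup>2 > 0" using pos by auto
      have "Im (- 1 / \<tau>') = Im \<tau>' / (cmod \<tau>')\<^sup>2"
        by (simp add: Im_divide cmod_power2)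
      also have "\<dots> \<ge> Im \<tau>' * 2"
        using mult_left_mono[OF n, of "2 * Im \<tau>'"] n0 pos by (simp add: field_simps)
      finally have im: "Im (- 1 / \<tau>') \<ge> 2 * Im \<tau>'" by simp
      then have "Im (- 1 / \<tau>') * 2 ^ n \<ge> (2 * Im \<tau>') * 2 ^ n"
        by (intro mult_right_mono) auto
      then have "Im (- 1 / \<tau>') * 2 ^ n \<ge> 1/2"
        using Suc.prems \<tau>'(2) by (simp add: mult_ac)
      with Suc.IH[of "- 1 / \<tau>'"] im pos S[OF pos] \<tau>'(3) show ?thesis by simp
    qed
  qed
  moreover obtain n where "1 / (2 * Im \<tau>) < 2 ^ n"
    using real_arch_pow[of 2 "1 / (2 * Im \<tau>)"] by auto
  then have "Im \<tau> * 2 ^ n \<ge> 1/2"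
    using \<tau> by (simp add: field_simps)
  ultimately show ?thesis using \<tau> by blast
qed

text \<open>
  By the reduction to a strip and the decay at infinity, a nonzero \<open>f\<close> would attain
  its maximal absolute value on a compact set, hence be constant by the maximum
  principle, contradicting the decay.
\<close>

lemma level_one_vanishing:
  assumes hol: "f holomorphic_on upper_half"
    and T: "\<And>\<tau>. Im \<tau> > 0 \<Longrightarrow> f (\<tau> + 1) = f \<tau>" and S: "\<And>\<tau>. Im \<tau> > 0 \<Longrightarrow> f (- 1 / \<tau>) = f \<tau>"
    and lim: "\<And>e. e > 0 \<Longrightarrow> \<exists>Y. \<forall>\<tau>. Im \<tau> \<ge> Y \<longrightarrow> norm (f \<tau>) < e"
    and \<tau>: "Im \<tau> > 0"
  shows "f \<tau> = 0"
proof (rule ccontr)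
  assume nz: "f \<tau> \<noteq> 0"
  then obtain Y where Y: "\<And>w. Im w \<ge> Y \<Longrightarrow> norm (f w) < norm (f \<tau>)"
    using lim[of "norm (f \<tau>)"] by auto
  define K where "K = cbox (Complex (-1/2) (1/2)) (Complex (1/2) (max Y 1))"
  have K: "w \<in> K \<longleftrightarrow> \<bar>Re w\<bar> \<le> 1/2 \<and> Im w \<ge> 1/2 \<and> Im w \<le> max Y 1" for w
    by (auto simp: K_def in_cbox_complex_iff)
  have sub: "K \<subseteq> upper_half" using K by auto
  have "Complex 0 1 \<in> K" using K by simp
  moreover have "continuous_on K (\<lambda>w. norm (f w))"
    by (intro continuous_intros holomorphic_on_imp_continuous_on holomorphic_on_subset[OF hol] sub)
  ultimately obtain w0 where w0: "w0 \<in> K" "\<And>w. w \<in> K \<Longrightarrow> norm (f w) \<le> norm (f w0)"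
    using continuous_attains_sup[of K "\<lambda>w. norm (f w)"] by (auto simp: K_def)
  have rep: "norm (f w) < norm (f \<tau>) \<or> norm (f w) \<le> norm (f w0)" if w: "Im w > 0" for w
  proof -
    obtain w' where w': "\<bar>Re w'\<bar> \<le> 1/2" "Im w' \<ge> 1/2" "f w' = f w"
      using reduce_to_strip[OF T S w] by auto
    show ?thesis
    proof (cases "Im w' \<ge> Y")
      case True
      then show ?thesis using Y[of w'] w' by simp
    next
      case False
      then have "w' \<in> K" using w' K by simp
      then show ?thesis using w0(2)[of w'] w' by simp
    qed
  qed
  have max: "norm (f w) \<le> norm (f w0)" if "Im w > 0" for w
    using rep[OF that] rep[OF \<tau>] by auto
  have "f constant_on upper_half"
    using max w0(1) sub
    by (intro maximum_modulus_principle[OF hol, of upper_half w0])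
       (auto intro!: convex_connected convex_halfspace_Im_gt)
  then obtain c where c: "\<And>w. Im w > 0 \<Longrightarrow> f w = c"
    unfolding constant_on_def by auto
  define w where "w = Complex 0 (max Y 1)"
  have "norm (f w) < norm (f \<tau>)" by (rule Y) (simp add: w_def)
  moreover have "f w = f \<tau>" using c[of w] c[OF \<tau>] by (simp add: w_def)
  ultimately show False by simp
qed

lemma prod_eq_0_holomorphic:
  assumes A: "open A" "connected A" and "finite I"
    and "\<And>i. i \<in> I \<Longrightarrow> f i holomorphic_on A" "\<And>z. z \<in> A \<Longrightarrow> (\<Prod>i\<in>I. f i z) = (0 :: complex)"
    and ne: "A \<noteq> {}"
  shows "\<exists>i\<in>I. \<forall>z\<in>A. f i z = 0"
  using assms(3-5)
proof (induction I)
  case empty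
  then show ?case using ne by auto
next
  case (insert j I)
  show ?case
  proof (cases "\<forall>z\<in>A. f j z = 0")
    case False
    then obtain z0 where z0: "z0 \<in> A" "f j z0 \<noteq> 0" by blast
    define g where "g z = (\<Prod>i\<in>I. f i z)" for z
    have g: "g holomorphic_on A"
      unfolding g_def using insert.prems by (intro holomorphic_intros) auto
    have j: "f j holomorphic_on A" using insert.prems by simp
    then have "continuous_on A (f j)" by (rule holomorphic_on_imp_continuous_on)
    then have "open {z \<in> A. f j z \<noteq> 0}"
      using continuous_open_preimage[of A "f j" "- {0}"] A(1)
      by (simp add: vimage_def Collect_conj_eq Int_commute open_Compl)
    moreover have "g z = 0" if "z \<in> {z \<in> A. f j z \<noteq> 0}" for z
      using insert.prems(2)[of z] insert.hyps that by (simp add: g_def)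
    ultimately have "g z = 0" if "z \<in> A" for z
      using analytic_continuation_open[of "{z \<in> A. f j z \<noteq> 0}" A g "\<lambda>_. 0" z] z0 A g that by auto
    then show ?thesis
      using insert.IH insert.prems(1) unfolding g_def by auto
  qed auto
qed

section \<open>Functions invariant under a congruence subgroup\<close>

text \<open>
  Here the upper right entry of the matrix is divisible by the level. This conjugate
  of the usual \<open>\<Gamma>\<^sub>0(L)\<close> fits forms with expansions in \<open>q\<^bsup>1/L\<^esup>\<close>.
\<close>

definition Gamma0_upper_invariant :: "int \<Rightarrow> (complex \<Rightarrow> complex) \<Rightarrow> bool" where
  "Gamma0_upper_invariant L R \<longleftrightarrow> (\<forall>a b c e \<tau>. a * e - b * c = 1 \<longrightarrow> L dvd b \<longrightarrow> Im \<tau> > 0 \<longrightarrow>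
     R ((of_int a * \<tau> + of_int b) / (of_int c * \<tau> + of_int e)) = R \<tau>)"

text \<open>
  The product of the conjugates of \<open>R\<close> over the \<open>p + 1\<close> cosets is of level one and
  tends to 0, so it vanishes and one of its factors does. The cosets are represented
  by the translations by 0, ..., \<open>p - 1\<close> and by the inversion. Translation permutes
  these cyclically and fixes the last; inversion exchanges the last with the
  translation by 0, and the translation by \<open>j\<close> with the translation by \<open>- 1 / j\<close>
  modulo \<open>p\<close>.
\<close>

lemma Gamma0_upper_vanishing:
  fixes p :: nat
  assumes p: "prime p" and inv: "Gamma0_upper_invariant (int p) R"
    and hol: "R holomorphic_on upper_half"
    and lim: "\<And>e. e > 0 \<Longrightarrow> \<exists>Y. \<forall>\<tau>. Im \<tau> \<ge> Y \<longrightarrow> norm (R \<tau>) < e"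
    and bdd: "cusp_bounded (\<lambda>\<tau>. R (- 1 / \<tau>))"
    and \<tau>: "Im \<tau> > 0"
  shows "R \<tau> = 0"
proof -
  define P where "P j = (if j = p then (\<lambda>\<tau>. R (- 1 / \<tau>)) else (\<lambda>\<tau>. R (\<tau> + of_nat j)))" for j
  define N where "N \<tau> = (\<Prod>j\<le>p. P j \<tau>)" for \<tau>
  have p1: "p > 1" using p prime_gt_1_nat by blast
  have N_alt: "N \<tau> = (\<Prod>j<p. R (\<tau> + of_nat j)) * R (- 1 / \<tau>)" for \<tau>
    by (simp add: N_def P_def lessThan_Suc_atMost [symmetric])
  have inv': "R w = R \<tau>" if "a * e - b * c = 1" "int p dvd b" "Im \<tau> > 0"
    "w = (of_int a * \<tau> + of_int b) / (of_int c * \<tau> + of_int e)" for a b c e w \<tau>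
    using inv that unfolding Gamma0_upper_invariant_def by blast
  have hol_P: "P j holomorphic_on upper_half" for j
  proof (cases "j = p")
    case True
    have "(R \<circ> (\<lambda>\<tau>. - 1 / \<tau>)) holomorphic_on upper_half"
    proof (rule holomorphic_on_compose_gen[OF _ hol])
      show "(\<lambda>\<tau>. - 1 / \<tau>) holomorphic_on upper_half"
        by (intro holomorphic_intros) auto
    qed (use Im_neg_inverse_pos in auto)
    then show ?thesis using True by (simp add: P_def o_def)
  next
    case False
    have "(R \<circ> (\<lambda>\<tau>. \<tau> + of_nat j)) holomorphic_on upper_half"
      by (rule holomorphic_on_compose_gen[OF _ hol]) (auto intro!: holomorphic_intros)
    then show ?thesis using False by (simp add: P_def o_def)
  qed
  have "N \<tau> = 0" if "Im \<tau> > 0" for \<tau>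
  proof (rule level_one_vanishing[OF _ _ _ _ that])
    show "N holomorphic_on upper_half"
      unfolding N_def by (intro holomorphic_intros hol_P)
  next
    fix \<tau> :: complex assume \<tau>: "Im \<tau> > 0"
    have 1: "R (- 1 / (\<tau> + 1)) = R (- 1 / \<tau>)"
    proof (rule inv'[of 1 1 0 "-1"])
      have "\<tau> \<noteq> 0" "\<tau> + 1 \<noteq> 0" using \<tau> by (auto simp: complex_eq_iff)
      then show "- 1 / (\<tau> + 1) = (of_int 1 * (- 1 / \<tau>) + of_int 0) / (of_int (- 1) * (- 1 / \<tau>) + of_int 1)"
        by (simp add: divide_simps add.commute)
    qed (use Im_neg_inverse_pos[OF \<tau>] in auto)
    have 2: "R (\<tau> + of_nat p) = R \<tau>"
      by (rule inv'[of 1 1 "int p" 0]) (use \<tau> in auto)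
    have "(\<Prod>j<p. R (\<tau> + 1 + of_nat j)) = (\<Prod>j<p. R (\<tau> + of_nat (Suc j)))"
      by (simp add: add_ac)
    also have "\<dots> = (\<Prod>j<p. R (\<tau> + of_nat j))"
    proof -
      have a: "R \<tau> * (\<Prod>j<p. R (\<tau> + of_nat (Suc j))) = (\<Prod>j<p. R (\<tau> + of_nat j)) * R (\<tau> + of_nat p)"
        using prod.lessThan_Suc_shift[of "\<lambda>j. R (\<tau> + of_nat j)" p] prod.lessThan_Suc[of "\<lambda>j. R (\<tau> + of_nat j)" p]
        by simp
      have b: "(\<Prod>j<p. R (\<tau> + of_nat j)) = 0" if "R \<tau> = 0"
        using that p1 by (intro prod_zero) (auto intro!: bexI[of _ 0])
      have c: "(\<Prod>j<p. R (\<tau> + of_nat (Suc j))) = 0" if "R \<tau> = 0"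
        using that p1 2 by (intro prod_zero) (auto intro!: bexI[of _ "p - 1"] simp: of_nat_diff)
      show ?thesis
      proof (cases "R \<tau> = 0")
        case True
        show ?thesis unfolding b[OF True] c[OF True] ..
      next
        case False
        then show ?thesis using a unfolding 2 by simp
      qed
    qed
    finally show "N (\<tau> + 1) = N \<tau>"
      unfolding N_alt using 1 by simp
    have "\<exists>k\<in>{1..<p}. [int j * int k = - 1] (mod int p)" if j: "j \<in> {1..<p}" for j
    proof -
      have "coprime (int j) (int p)"
        using j p by (metis atLeastLessThan_iff coprime_commute coprime_int_iff less_le_not_le not_less prime_imp_coprime nat_dvd_not_less zero_less_one less_le_trans le_numeral_extra(4))
      then obtain u where u: "[int j * u = 1] (mod int p)"
        using cong_solve_coprime_int by blast
      define k where "k = nat ((- u) mod int p)"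
      have k: "int k = (- u) mod int p" using p1 by (simp add: k_def)
      have ck: "[int j * int k = - 1] (mod int p)"
      proof -
        have "[int j * int k = int j * (- u)] (mod int p)"
          unfolding k by (intro cong_scalar_left) (simp add: cong_def)
        also have "int j * (- u) = - (int j * u)" by simp
        also have "[\<dots> = - 1] (mod int p)" using u by (simp add: cong_minus_minus_iff)
        finally show ?thesis .
      qed
      have "k < p" using k p1 by (metis of_nat_less_iff pos_mod_bound of_nat_0_less_iff less_trans zero_less_one)
      moreover have "k \<noteq> 0"
      proof
        assume "k = 0"
        then have "int p dvd 1" using ck by (simp add: cong_iff_dvd_diff)
        then show False using p1 by simp
      qed
      ultimately show ?thesis using ck by auto
    qed
    then obtain \<pi> where \<pi>: "\<And>j. j \<in> {1..<p} \<Longrightarrow> \<pi> j \<in> {1..<p}"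
      "\<And>j. j \<in> {1..<p} \<Longrightarrow> [int j * int (\<pi> j) = - 1] (mod int p)"
      by metis
    have invol: "\<pi> (\<pi> j) = j" if j: "j \<in> {1..<p}" for j
    proof -
      have "[int j * int (\<pi> j) = int (\<pi> (\<pi> j)) * int (\<pi> j)] (mod int p)"
        using \<pi>(2)[OF j] \<pi>(2)[OF \<pi>(1)[OF j]] by (metis cong_sym cong_trans mult.commute)
      moreover have "coprime (int (\<pi> j)) (int p)"
        using \<pi>(1)[OF j] p by (metis atLeastLessThan_iff coprime_commute coprime_int_iff less_le_not_le not_less prime_imp_coprime nat_dvd_not_less zero_less_one less_le_trans le_numeral_extra(4))
      ultimately have "[int j = int (\<pi> (\<pi> j))] (mod int p)"
        by (simp add: cong_mult_rcancel)
      then have "[j = \<pi> (\<pi> j)] (mod p)"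
        by (simp add: cong_int_iff)
      moreover have "j < p" "\<pi> (\<pi> j) < p"
        using j \<pi>(1)[OF \<pi>(1)[OF j]] by auto
      ultimately show ?thesis
        using cong_less_modulus_unique_nat by metis
    qed
    have tau0: "\<tau> \<noteq> 0" using \<tau> by auto
    have 3: "R (- 1 / \<tau> + of_nat (\<pi> j)) = R (\<tau> + of_nat j)" if j: "j \<in> {1..<p}" for j
    proof (rule inv'[of "int (\<pi> j)" "- int j" "- (1 + int j * int (\<pi> j))" 1])
      have "[int j * int (\<pi> j) = - 1] (mod int p)" using \<pi>(2)[OF j] .
      then have "int p dvd 1 + int j * int (\<pi> j)"
        by (simp add: cong_iff_dvd_diff add.commute)
      then show "int p dvd - (1 + int j * int (\<pi> j))"
        unfolding dvd_minus_iff .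
      show "- 1 / \<tau> + of_nat (\<pi> j) = (of_int (int (\<pi> j)) * (\<tau> + of_nat j) + of_int (- (1 + int j * int (\<pi> j)))) /
          (of_int 1 * (\<tau> + of_nat j) + of_int (- int j))"
        using tau0 by (simp add: field_simps)
    qed (use \<tau> in \<open>auto simp: algebra_simps\<close>)
    have "(\<Prod>j\<in>{1..<p}. R (- 1 / \<tau> + of_nat j)) = (\<Prod>j\<in>{1..<p}. R (\<tau> + of_nat j))"
      by (rule prod.reindex_bij_witness[of _ \<pi> \<pi>]) (use \<pi>(1) invol 3[OF \<pi>(1)] in auto)
    moreover have "{..<p} = insert 0 {1..<p}" using p1 by auto
    ultimately show "N (- 1 / \<tau>) = N \<tau>"
      unfolding N_alt using tau0 by (simp add: mult_ac)
  next
    fix e :: real assume e: "e > 0"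
    obtain B Y0 where B: "\<And>\<tau>. Im \<tau> \<ge> Y0 \<Longrightarrow> norm (R (- 1 / \<tau>)) \<le> B"
      using bdd unfolding cusp_bounded_def by blast
    define e' where "e' = min 1 (e / (\<bar>B\<bar> + 1))"
    have e': "e' > 0" "e' \<le> 1" "e' \<le> e / (\<bar>B\<bar> + 1)"
      using e by (auto simp: e'_def)
    then have e'3: "e' * (\<bar>B\<bar> + 1) \<le> e"
      by (simp add: pos_le_divide_eq)
    obtain Y1 where Y1: "\<And>\<tau>. Im \<tau> \<ge> Y1 \<Longrightarrow> norm (R \<tau>) < e'"
      using lim[OF e'(1)] by blast
    have "norm (N \<tau>) < e" if "Im \<tau> \<ge> max Y0 Y1" for \<tau>
    proof -
      have "(\<Prod>j<p. norm (R (\<tau> + of_nat j))) \<le> (\<Prod>j<p. e')"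
        using Y1 that by (intro prod_mono) (auto intro!: less_imp_le)
      also have "\<dots> = e' * e' ^ (p - 1)" using p1 by (simp flip: power_Suc)
      also have "\<dots> \<le> e' * 1" using e' by (intro mult_left_mono power_le_one) auto
      finally have "norm (N \<tau>) \<le> e' * \<bar>B\<bar>"
        unfolding N_alt norm_mult prod_norm [symmetric] using B[of \<tau>] that e'
        by (intro mult_mono) auto
      also have "\<dots> < e' * (\<bar>B\<bar> + 1)" using e' by simp
      finally show ?thesis using e'3 by simp
    qed
    then show "\<exists>Y. \<forall>\<tau>. Im \<tau> \<ge> Y \<longrightarrow> norm (N \<tau>) < e" by blast
  qed
  then obtain j where j: "j \<in> {..p}" "\<And>z. z \<in> upper_half \<Longrightarrow> P j z = 0"
    using prod_eq_0_holomorphic[of upper_half "{..p}" P] hol_P \<tau> unfolding N_def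
    by (auto intro!: convex_connected convex_halfspace_Im_gt)
  have tau0: "\<tau> \<noteq> 0" using \<tau> by auto
  show ?thesis
  proof (cases "j = p")
    case True
    then show ?thesis using j(2)[of "- 1 / \<tau>"] Im_neg_inverse_pos[OF \<tau>] tau0 by (simp add: P_def)
  next
    case False
    then show ?thesis using j(2)[of "\<tau> - of_nat j"] \<tau> by (simp add: P_def)
  qed
qed

section \<open>The generating function as an analytic function\<close>

definition cfps :: "rat fps \<Rightarrow> complex fps" where
  "cfps f = Abs_fps (\<lambda>n. of_rat (fps_nth f n))"

lemma cfps_nth [simp]: "fps_nth (cfps f) n = of_rat (fps_nth f n)"
  by (simp add: cfps_def)

lemma cfps_mult: "cfps (f * g) = cfps f * cfps g"
  by (rule fps_ext) (simp add: fps_mult_nth of_rat_sum of_rat_mult)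

lemma cfps_diff: "cfps (f - g) = cfps f - cfps g"
  by (rule fps_ext) (simp add: of_rat_diff)

lemma cfps_1 [simp]: "cfps 1 = 1"
  by (rule fps_ext) simp

lemma cfps_X_power [simp]: "cfps (fps_X ^ n) = fps_X ^ n"
  by (rule fps_ext) (simp add: fps_X_power_nth)

lemma cfps_X [simp]: "cfps fps_X = fps_X"
  using cfps_X_power[of 1] by simp

lemma cfps_power: "cfps (f ^ n) = cfps f ^ n"
  by (induction n) (simp_all add: cfps_mult)

lemma cfps_prod: "cfps (\<Prod>i\<in>A. f i) = (\<Prod>i\<in>A. cfps (f i))"
  by (induction A rule: infinite_finite_induct) (simp_all add: cfps_mult)

lemma cfps_core_factor:
  "cfps (core_factor l n) = (1 - fps_X ^ (l * Suc n)) ^ l / (1 - fps_X ^ Suc n)"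
proof -
  let ?a = "(1 - fps_X ^ (l * Suc n)) ^ l :: rat fps" and ?b = "1 - fps_X ^ Suc n :: rat fps"
  have b0: "fps_nth ?b 0 \<noteq> 0" by simp
  have "cfps ?b * cfps (inverse ?b) = 1"
    unfolding cfps_mult [symmetric] inverse_mult_eq_1'[OF b0] by simp
  then have "inverse (cfps ?b) = cfps (inverse ?b)"
    by (rule fps_inverse_unique)
  moreover have "cfps ?a = (1 - fps_X ^ (l * Suc n)) ^ l" "cfps ?b = 1 - fps_X ^ Suc n"
    by (simp_all only: cfps_diff cfps_1 cfps_X cfps_power)
  moreover have cb0: "fps_nth (1 - fps_X ^ Suc n :: complex fps) 0 \<noteq> 0" by simp
  ultimately show ?thesis
    by (simp only: fps_divide_unit[OF b0] cfps_mult fps_divide_unit[OF cb0])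
qed

text \<open>
  Subtracting 1 suits the lemmas on products with factors \<open>1 + f n\<close>.
\<close>

definition core_term :: "nat \<Rightarrow> nat \<Rightarrow> complex \<Rightarrow> complex" where
  "core_term l n x = (1 - x ^ (l * Suc n)) ^ l / (1 - x ^ Suc n) - 1"

lemma power_Suc_neq_1: "norm x < 1 \<Longrightarrow> x ^ Suc n \<noteq> (1 :: complex)"
  using power_Suc_less_one[of "norm x" n]
  by (metis norm_ge_zero norm_one norm_power order_less_irrefl power_0_Suc zero_less_norm_iff norm_zero power_zero_numeral zero_neq_one less_le)

lemma norm_core_term_le:
  assumes l: "l > 0" and t: "norm x \<le> t" "t < 1"
  shows "norm (core_term l n x) \<le> (real l * 2 ^ l + 1) / (1 - t) * t ^ Suc n"
proof -
  define u where "u = x ^ Suc n"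
  have t0: "t \<ge> 0" using t(1) norm_ge_zero order.trans by blast
  have u: "norm u \<le> t ^ Suc n"
    unfolding u_def norm_power using t by (intro power_mono) auto
  have "t ^ Suc n \<le> t"
    using t t0 by (simp add: mult_left_le power_le_one)
  then have ut: "norm u \<le> t" using u by simp
  then have u1: "norm u < 1" using t by simp
  have "u \<noteq> 1" using u1 by auto
  have ul: "x ^ (l * Suc n) = u ^ l"
    unfolding u_def power_mult [symmetric] by (simp only: mult.commute)
  have "A / (1 - u) - 1 = (A - 1 + u) / (1 - u)" for A
    using \<open>u \<noteq> 1\<close> by (simp add: field_simps)
  then have "core_term l n x = ((1 - u ^ l) ^ l - 1 + u) / (1 - u)"
    unfolding core_term_def ul u_def [symmetric] .
  also have "norm \<dots> = norm ((1 - u ^ l) ^ l - 1 + u) / norm (1 - u)"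
    by (rule norm_divide)
  also have "\<dots> \<le> (real l * 2 ^ l + 1) * norm u / (1 - t)"
  proof (rule frac_le)
    have ul: "norm (u ^ l) \<le> norm u"
      using u1 l by (cases l) (auto simp: norm_power norm_mult mult_left_le power_le_one)
    have "norm (1 - u ^ l) \<le> 2"
      using norm_triangle_ineq4[of 1 "u ^ l"] ul u1 by simp
    then have "norm (\<Sum>i<l. (1 - u ^ l) ^ i) \<le> (\<Sum>i<l. 2 ^ l)"
    proof (intro order.trans[OF norm_sum] sum_mono)
      fix i assume "norm (1 - u ^ l) \<le> 2" "i \<in> {..<l}"
      then have "norm ((1 - u ^ l) ^ i) \<le> 2 ^ i"
        by (simp add: norm_power power_mono)
      also have "(2::real) ^ i \<le> 2 ^ l"
        using \<open>i \<in> {..<l}\<close> by (intro power_increasing) auto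
      finally show "norm ((1 - u ^ l) ^ i) \<le> 2 ^ l" .
    qed
    then have "norm ((1 - u ^ l) - 1) * norm (\<Sum>i<l. (1 - u ^ l) ^ i) \<le> norm u * (real l * 2 ^ l)"
      using ul by (intro mult_mono) auto
    then have "norm ((1 - u ^ l) ^ l - 1) \<le> norm u * (real l * 2 ^ l)"
      unfolding power_diff_1_eq norm_mult .
    then show "norm ((1 - u ^ l) ^ l - 1 + u) \<le> (real l * 2 ^ l + 1) * norm u"
      using norm_triangle_ineq[of "(1 - u ^ l) ^ l - 1" u] by (simp add: algebra_simps)
    show "1 - t \<le> norm (1 - u)"
      using norm_triangle_ineq2[of 1 u] ut by simp
  qed (use t in auto)
  also have "\<dots> = (real l * 2 ^ l + 1) / (1 - t) * norm u" by simp
  also have "\<dots> \<le> (real l * 2 ^ l + 1) / (1 - t) * t ^ Suc n"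
    using u t by (intro mult_left_mono) auto
  finally show ?thesis .
qed

lemma core_term_majorant:
  assumes l: "l > 0" and K: "compact K" "K \<subseteq> ball 0 1"
  shows "\<exists>M. summable M \<and> (\<forall>n. \<forall>x\<in>K. norm (core_term l n x) \<le> M n)"
proof (cases "K = {}")
  case False
  obtain x0 where x0: "x0 \<in> K" "\<And>x. x \<in> K \<Longrightarrow> norm x \<le> norm x0"
    using continuous_attains_sup[OF K(1) False, of norm] by (auto intro: continuous_intros)
  define t where "t = norm x0"
  have t: "t \<ge> 0" "t < 1" using x0(1) K(2) by (auto simp: t_def)
  have "summable (\<lambda>n. (real l * 2 ^ l + 1) / (1 - t) * t ^ Suc n)"
    using t by (intro summable_mult summable_Suc_iff[THEN iffD2] summable_geometric) auto
  then show ?thesis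
    using norm_core_term_le[OF l _ t(2)] x0(2) unfolding t_def by blast
qed (auto intro: exI[of _ "\<lambda>_. 0"])

lemma holomorphic_core_term: "core_term l n holomorphic_on ball 0 1"
  unfolding core_term_def using power_Suc_neq_1
  by (intro holomorphic_intros) (auto simp del: power_Suc)

definition core_fun :: "nat \<Rightarrow> complex \<Rightarrow> complex" where
  "core_fun l x = (\<Prod>n. 1 + core_term l n x)"

lemma holomorphic_core_fun:
  assumes "l > 0" shows "core_fun l holomorphic_on ball 0 1"
  unfolding core_fun_def [abs_def]
  by (intro holomorphic_on_prodinf_one_plus holomorphic_core_term core_term_majorant assms) auto

text \<open>
  The partial products converge uniformly near 0, so their Taylor coefficients
  converge to those of \<open>core_fun\<close>; they also agree with those of the formal partial
  products, which stabilise at the core counts. Since \<open>core_fun\<close> is holomorphic on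
  the unit disc, its Taylor series represents it there.
\<close>

lemma core_fun_sums:
  assumes l: "l > 0" and x: "norm x < 1"
  shows "(\<lambda>n. of_int (core_count l (int n)) * x ^ n) sums core_fun l x"
proof -
  define P where "P N x = (\<Prod>n<N. 1 + core_term l n x)" for N x
  have exp: "P N has_fps_expansion cfps (\<Prod>n<N. core_factor l n)" for N
    unfolding P_def [abs_def] cfps_prod cfps_core_factor
  proof (rule has_fps_expansion_prod)
    fix n
    show "(\<lambda>x. 1 + core_term l n x) has_fps_expansion (1 - fps_X ^ (l * Suc n)) ^ l / (1 - fps_X ^ Suc n)"
      unfolding core_term_def
      by (simp del: power_Suc mult_Suc_right, intro fps_expansion_intros) (simp del: power_Suc mult_Suc_right)
  qed
  have sub: "cball (0 :: complex) (1/2) \<subseteq> ball 0 1" "ball (0 :: complex) (1/2) \<subseteq> ball 0 1"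
    by auto
  have coeff: "(deriv ^^ k) (core_fun l) 0 / fact k = of_int (core_count l (int k))" for k
  proof -
    have "uniform_limit (ball 0 (1/2)) P (core_fun l) sequentially"
    proof (rule uniform_limit_on_subset)
      obtain M where M: "summable M" "\<forall>n. \<forall>x\<in>cball 0 (1/2). norm (core_term l n x) \<le> M n"
        using core_term_majorant[OF l compact_cball sub(1)] by blast
      show "uniform_limit (cball 0 (1/2)) P (core_fun l) sequentially"
        unfolding P_def [abs_def] core_fun_def [abs_def] using M
        by (intro uniform_limit_prodinf_one_plus holomorphic_on_imp_continuous_on
            holomorphic_on_subset[OF holomorphic_core_term] sub compact_cball) auto
    qed (rule ball_subset_cball)
    moreover have "P N holomorphic_on ball 0 (1/2)" for N
      unfolding P_def [abs_def]
      by (intro holomorphic_intros holomorphic_on_subset[OF holomorphic_core_term] sub)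
    ultimately have "(\<lambda>N. (deriv ^^ k) (P N) 0) \<longlonglongrightarrow> (deriv ^^ k) (core_fun l) 0"
      by (intro higher_deriv_complex_uniform_limit) auto
    then have 1: "(\<lambda>N. (deriv ^^ k) (P N) 0 / fact k) \<longlonglongrightarrow> (deriv ^^ k) (core_fun l) 0 / fact k"
      by (intro tendsto_intros) auto
    have "(\<lambda>N. \<Prod>n<N. core_factor l n) \<longlonglongrightarrow> core_gf l"
      using core_gf_has_prod[OF l] by (rule has_prod_imp_tendsto')
    then have "eventually (\<lambda>N. fps_nth (\<Prod>n<N. core_factor l n) k = fps_nth (core_gf l) k) sequentially"
      by (simp only: tendsto_fps_iff)
    then have "eventually (\<lambda>N. (deriv ^^ k) (P N) 0 / fact k = of_int (core_count l (int k))) sequentially"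
    proof eventually_elim
      case (elim N)
      have "(deriv ^^ k) (P N) 0 / fact k = of_rat (fps_nth (\<Prod>n<N. core_factor l n) k)"
        unfolding fps_nth_fps_expansion[OF exp, symmetric] by (rule cfps_nth)
      also have "\<dots> = of_rat (of_int (core_count l (int k)))"
        unfolding elim of_int_core_count[OF l] ..
      finally show ?case by simp
    qed
    then have "(\<lambda>N. (deriv ^^ k) (P N) 0 / fact k) \<longlonglongrightarrow> of_int (core_count l (int k))"
      by (rule tendsto_eventually)
    with 1 show ?thesis by (rule LIMSEQ_unique)
  qed
  show ?thesis
    using holomorphic_power_series[OF holomorphic_core_fun[OF l], of x] x by (simp add: coeff)
qed

section \<open>Product formula for the family\<close>

definition euler_fun :: "complex \<Rightarrow> complex" where
  "euler_fun x = (\<Prod>n. 1 + - (x ^ Suc n))"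

lemma summable_norm_power_Suc:
  assumes "norm (x :: complex) < 1" shows "summable (\<lambda>n. norm (- (x ^ Suc n)))"
  using assms by (simp add: norm_power norm_mult summable_mult summable_geometric)

lemma euler_fun_tendsto:
  assumes "norm x < 1"
  shows "(\<lambda>N. \<Prod>n<N. 1 - x ^ Suc n) \<longlonglongrightarrow> euler_fun x"
  using tendsto_prodinf_one_plus[OF summable_norm_power_Suc[OF assms]] by (simp add: euler_fun_def)

lemma euler_fun_nonzero:
  assumes "norm x < 1"
  shows "euler_fun x \<noteq> 0"
proof
  assume "euler_fun x = 0"
  then have "(\<lambda>n. 1 + - (x ^ Suc n)) has_prod 0"
    using has_prod_one_plus[OF summable_norm_power_Suc[OF assms]] by (simp only: euler_fun_def)
  then obtain n where "1 + - (x ^ Suc n) = 0"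
    by (auto dest!: has_prod_0D simp del: power_Suc)
  then show False using power_Suc_neq_1[OF assms, of n] by (simp del: power_Suc)
qed

lemma core_fun_euler:
  assumes l: "l > 0" and x: "norm x < 1"
  shows "core_fun l x = euler_fun (x ^ l) ^ l / euler_fun x"
proof -
  have xl: "norm (x ^ l) < 1"
    using l x by (simp add: norm_power power_less_one_iff)
  have "summable (\<lambda>n. norm (core_term l n x))"
  proof -
    obtain M where M: "summable M" "\<forall>n. \<forall>y\<in>{x}. norm (core_term l n y) \<le> M n"
      using core_term_majorant[OF l, of "{x}"] x by auto
    show ?thesis
      by (rule summable_comparison_test'[OF M(1), of 0]) (use M(2) in simp)
  qed
  from tendsto_prodinf_one_plus[OF this]
  have 1: "(\<lambda>N. \<Prod>n<N. 1 + core_term l n x) \<longlonglongrightarrow> core_fun l x"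
    by (simp add: core_fun_def)
  have "(\<lambda>N. (\<Prod>n<N. 1 - (x ^ l) ^ Suc n) ^ l / (\<Prod>n<N. 1 - x ^ Suc n)) \<longlonglongrightarrow> euler_fun (x ^ l) ^ l / euler_fun x"
    by (intro tendsto_intros euler_fun_tendsto x xl euler_fun_nonzero)
  also have "(\<lambda>N. (\<Prod>n<N. 1 - (x ^ l) ^ Suc n) ^ l / (\<Prod>n<N. 1 - x ^ Suc n)) = (\<lambda>N. \<Prod>n<N. 1 + core_term l n x)"
    by (simp add: core_term_def prod_dividef prod_power_distrib power_mult [symmetric] del: power_Suc mult_Suc_right)
  finally show ?thesis
    using 1 LIMSEQ_unique by blast
qed

lemma prod_blocks:
  fixes f :: "nat \<Rightarrow> complex"
  shows "(\<Prod>n<N. \<Prod>b<L. f (L * n + b)) = (\<Prod>m<L * N. f m)"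
proof (induction N)
  case (Suc N)
  have "(\<Prod>m<L * N + k. f m) = (\<Prod>m<L * N. f m) * (\<Prod>b<k. f (L * N + b))" for k
    by (induction k) (simp_all add: mult.assoc)
  from this[of L] show ?case using Suc by (simp add: add.commute)
qed simp

lemma prod_even_residues:
  fixes h :: "nat \<Rightarrow> complex"
  shows "(\<Prod>a=1..d. h (2 * a) * h (2 * d + 1 - 2 * a)) = (\<Prod>b=1..2 * d. h b)"
proof -
  have "(\<Prod>a=1..d. h (2 * a)) = (\<Prod>b\<in>{b\<in>{1..2 * d}. even b}. h b)"
    by (rule prod.reindex_bij_witness[of _ "\<lambda>b. b div 2" "\<lambda>a. 2 * a"]) auto
  moreover have "(\<Prod>a=1..d. h (2 * d + 1 - 2 * a)) = (\<Prod>b\<in>{b\<in>{1..2 * d}. odd b}. h b)"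
    by (rule prod.reindex_bij_witness[of _ "\<lambda>b. (2 * d + 1 - b) div 2" "\<lambda>a. 2 * d + 1 - 2 * a"])
       (auto elim!: oddE, presburger)
  moreover have "(\<Prod>b\<in>{b\<in>{1..2 * d}. even b}. h b) * (\<Prod>b\<in>{b\<in>{1..2 * d}. odd b}. h b) = (\<Prod>b=1..2 * d. h b)"
    by (subst prod.union_disjoint [symmetric]) (auto intro!: prod.cong finite_subset[of "{b. Suc 0 \<le> b \<and> b \<le> 2 * d \<and> P b}" "{1..2*d}" for P])
  ultimately show ?thesis by (simp add: prod.distrib)
qed

text \<open>
  In terms of \<open>x = e(\<tau> / L)\<close> the factors of the \<open>a\<close>-th theta function are \<open>1 - x\<^sup>m\<close>
  with \<open>m\<close> congruent to \<open>2 a\<close> or \<open>- 2 a\<close> modulo \<open>L\<close>. Over all \<open>a\<close> these exhaust the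
  \<open>m\<close> that are not multiples of \<open>L\<close>, and the denominators supply the factors with
  exponents divisible by \<open>L\<close>.
\<close>

lemma prod_theta_core:
  fixes d :: nat
  defines "L \<equiv> 2 * d + 1"
  assumes \<tau>: "Im \<tau> > 0"
  defines "x \<equiv> ee (\<tau> / of_nat L)"
  shows "(\<Prod>a=1..d. theta (of_nat (2 * a) * (\<tau> / of_nat L)) \<tau>)
    = (- 1) ^ d * (\<Prod>a=1..d. ee (- (of_nat (2 * a) * (\<tau> / of_nat L)) / 2)) / core_fun L x"
proof -
  define z where "z a = of_nat (2 * a) * (\<tau> / of_nat L)" for a
  have L: "L > 0" by (simp add: L_def)
  have x: "norm x < 1"
    unfolding x_def using \<tau> L by (intro norm_ee_less_1) (simp add: Im_divide_of_nat)
  have xL: "norm (x ^ L) < 1"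
    using L x by (simp add: norm_power power_less_one_iff)
  have q: "ee \<tau> = x ^ L"
    unfolding x_def ee_of_nat_mult [symmetric] using L by simp
  have X: "ee (z a) = x ^ (2 * a)" for a
    unfolding x_def z_def ee_of_nat_mult ..
  define T where "T N a = sn (z a) * (\<Prod>n<N. 1 + theta_term (z a) \<tau> n)" for N a
  have fact: "T N a = - ee (- z a / 2) * ((\<Prod>n<N. (1 - x ^ (L * n + 2 * a)) * (1 - x ^ (L * n + (L - 2 * a)))) /
      (\<Prod>n<N. 1 - (x ^ L) ^ Suc n)\<^sup>2 * (1 - x ^ (L * N + 2 * a)))" if a: "a \<in> {1..d}" for N a
  proof (induction N)
    case 0
    show ?case by (simp add: T_def sn_eq_ee X algebra_simps)
  next
    case (Suc N)
    have "x ^ (L * N + (L - 2 * a)) * x ^ (2 * a) = x ^ (L * Suc N)"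
      using a unfolding power_add [symmetric] by (intro arg_cong[of _ _ "power x"]) (auto simp: L_def)
    then have e: "(x ^ L) ^ Suc N * ee (- z a) = x ^ (L * N + (L - 2 * a))"
      by (simp add: ee_minus X power_mult [symmetric] field_simps x_def del: power_Suc mult_Suc_right)
    have e': "(x ^ L) ^ Suc N * ee (z a) = x ^ (L * Suc N + 2 * a)"
      by (simp add: X power_add power_mult [symmetric] del: power_Suc mult_Suc_right)
    have "T (Suc N) a = T N a * (1 + theta_term (z a) \<tau> N)"
      by (simp add: T_def)
    also have "\<dots> = T N a * ((1 - x ^ (L * Suc N + 2 * a)) * (1 - x ^ (L * N + (L - 2 * a))) / (1 - (x ^ L) ^ Suc N)\<^sup>2)"
      unfolding one_plus_theta_term[OF \<tau>] q e e' ..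
    finally show ?case
      unfolding Suc prod.lessThan_Suc power_mult_distrib by (simp del: power_Suc mult_Suc_right)
  qed
  \<comment> \<open>The last product collects the boundary factors, which tend to 1.\<close>
  define S where "S N = (\<Prod>m<L * N. 1 - x ^ Suc m) / (\<Prod>n<N. 1 - (x ^ L) ^ Suc n) ^ L * (\<Prod>a=1..d. 1 - x ^ (L * N + 2 * a))" for N
  have prodT: "(\<Prod>a=1..d. T N a) = ((- 1) ^ d * (\<Prod>a=1..d. ee (- z a / 2))) * S N" for N
  proof -
    have nz: "(\<Prod>n<N. 1 - (x ^ L) ^ Suc n) \<noteq> 0"
      using power_Suc_neq_1[OF xL] by (simp del: power_Suc)
    have "(\<Prod>a=1..d. \<Prod>n<N. (1 - x ^ (L * n + 2 * a)) * (1 - x ^ (L * n + (L - 2 * a))))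
       = (\<Prod>n<N. \<Prod>a=1..d. (1 - x ^ (L * n + 2 * a)) * (1 - x ^ (L * n + (L - 2 * a))))"
      by (rule prod.swap)
    also have "\<dots> = (\<Prod>n<N. \<Prod>b=1..2 * d. 1 - x ^ (L * n + b))"
      using prod_even_residues[of "\<lambda>b. 1 - x ^ (L * n + b)" d for n] by (simp only: L_def)
    finally have 1: "(\<Prod>a=1..d. \<Prod>n<N. (1 - x ^ (L * n + 2 * a)) * (1 - x ^ (L * n + (L - 2 * a))))
       = (\<Prod>n<N. \<Prod>b=1..2 * d. 1 - x ^ (L * n + b))" .
    have "(\<Prod>m<L * N. 1 - x ^ Suc m) = (\<Prod>n<N. \<Prod>b<L. 1 - x ^ Suc (L * n + b))"
      by (rule prod_blocks [symmetric])
    also have "\<dots> = (\<Prod>n<N. (\<Prod>b=1..2 * d. 1 - x ^ (L * n + b)) * (1 - (x ^ L) ^ Suc n))"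
    proof (rule prod.cong)
      fix n
      have "(\<Prod>b<L. 1 - x ^ Suc (L * n + b)) = (\<Prod>b=1..L. 1 - x ^ (L * n + b))"
        by (rule prod.reindex_bij_witness[of _ "\<lambda>b. b - 1" Suc]) auto
      also have "\<dots> = (\<Prod>b=1..2 * d. 1 - x ^ (L * n + b)) * (1 - x ^ (L * n + L))"
        by (simp add: L_def)
      also have "x ^ (L * n + L) = (x ^ L) ^ Suc n"
        by (simp add: power_add power_mult mult.commute)
      finally show "(\<Prod>b<L. 1 - x ^ Suc (L * n + b)) = (\<Prod>b=1..2 * d. 1 - x ^ (L * n + b)) * (1 - (x ^ L) ^ Suc n)" .
    qed simp
    finally have 2: "(\<Prod>m<L * N. 1 - x ^ Suc m) = (\<Prod>n<N. \<Prod>b=1..2 * d. 1 - x ^ (L * n + b)) * (\<Prod>n<N. 1 - (x ^ L) ^ Suc n)"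
      by (simp only: prod.distrib)
    have "(\<Prod>a=1..d. T N a) = (\<Prod>a=1..d. - ee (- z a / 2) * ((\<Prod>n<N. (1 - x ^ (L * n + 2 * a)) * (1 - x ^ (L * n + (L - 2 * a)))) /
      (\<Prod>n<N. 1 - (x ^ L) ^ Suc n)\<^sup>2 * (1 - x ^ (L * N + 2 * a))))"
      by (intro prod.cong refl fact)
    also have "\<dots> = ((- 1) ^ d * (\<Prod>a=1..d. ee (- z a / 2))) * ((\<Prod>n<N. \<Prod>b=1..2 * d. 1 - x ^ (L * n + b)) / (\<Prod>n<N. 1 - (x ^ L) ^ Suc n) ^ (2 * d) * (\<Prod>a=1..d. 1 - x ^ (L * N + 2 * a)))"
    proof -
      have "(\<Prod>a=1..d. - e a * (U a / W\<^sup>2 * V a))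
        = ((- 1) ^ d * (\<Prod>a=1..d. e a)) * ((\<Prod>a=1..d. U a) / W ^ (2 * d) * (\<Prod>a=1..d. V a))"
        for e U V :: "nat \<Rightarrow> complex" and W
        by (simp add: prod.distrib prod_dividef prod_uminus power_mult)
      then show ?thesis unfolding 1 [symmetric] .
    qed
    also have "(\<Prod>n<N. \<Prod>b=1..2 * d. 1 - x ^ (L * n + b)) / (\<Prod>n<N. 1 - (x ^ L) ^ Suc n) ^ (2 * d) =
        (\<Prod>m<L * N. 1 - x ^ Suc m) / (\<Prod>n<N. 1 - (x ^ L) ^ Suc n) ^ L"
      unfolding 2 using nz by (simp add: L_def)
    finally show ?thesis by (simp only: S_def)
  qed
  have "(\<lambda>N. \<Prod>a=1..d. T N a) \<longlonglongrightarrow> (\<Prod>a=1..d. theta (z a) \<tau>)"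
    unfolding T_def by (intro tendsto_prod theta_tendsto \<tau>)
  moreover have "(\<lambda>N. \<Prod>a=1..d. T N a) \<longlonglongrightarrow> ((- 1) ^ d * (\<Prod>a=1..d. ee (- z a / 2))) * (euler_fun x / euler_fun (x ^ L) ^ L * (\<Prod>a=1..d. 1 - 0))"
    unfolding prodT S_def
  proof (intro tendsto_intros)
    have sub: "filterlim (\<lambda>N. L * N) sequentially sequentially"
      using L by (intro filterlim_subseq strict_monoI) auto
    show "(\<lambda>N. \<Prod>m<L * N. 1 - x ^ Suc m) \<longlonglongrightarrow> euler_fun x"
      by (rule filterlim_compose[OF euler_fun_tendsto[OF x] sub])
    show "(\<lambda>N. \<Prod>n<N. 1 - (x ^ L) ^ Suc n) \<longlonglongrightarrow> euler_fun (x ^ L)"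
      by (rule euler_fun_tendsto[OF xL])
    show "euler_fun (x ^ L) ^ L \<noteq> 0"
      using euler_fun_nonzero[OF xL] by simp
    show "(\<lambda>N. x ^ (L * N + 2 * a)) \<longlonglongrightarrow> 0" for a
    proof (rule filterlim_compose[of "\<lambda>n. x ^ n"])
      show "(\<lambda>n. x ^ n) \<longlonglongrightarrow> 0" using x by (rule LIMSEQ_power_zero)
      show "filterlim (\<lambda>N. L * N + 2 * a) sequentially sequentially"
        using L by (intro filterlim_subseq strict_monoI) auto
    qed
  qed
  ultimately have "(\<Prod>a=1..d. theta (z a) \<tau>) = ((- 1) ^ d * (\<Prod>a=1..d. ee (- z a / 2))) * (euler_fun x / euler_fun (x ^ L) ^ L * (\<Prod>a=1..d. 1 - 0))"
    by (rule LIMSEQ_unique)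
  also have "\<dots> = (- 1) ^ d * (\<Prod>a=1..d. ee (- z a / 2)) / core_fun L x"
    unfolding core_fun_euler[OF L x] by simp
  finally show ?thesis by (simp only: z_def)
qed

lemma core_fun_nonzero:
  assumes "l > 0" "norm x < 1"
  shows "core_fun l x \<noteq> 0"
  using assms by (simp add: core_fun_euler euler_fun_nonzero norm_power power_less_one_iff)

text \<open>
  The exponent of \<open>e(\<tau> / L)\<close> is a sum of \<open>a - 2 a\<^sup>2 / L\<close> over \<open>a\<close> from 1 to \<open>d\<close>: the
  linear part comes from \<open>sn\<close> and the quadratic part from the exponential in the
  Klein form.
\<close>

lemma core_family_eq_core_fun:
  assumes \<tau>: "Im \<tau> > 0" and \<delta>: "6 * \<delta> = d * (d + 1)"
  shows "core_family d 1 0 \<tau> = (- 1) ^ d *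
    (ee (\<tau> / of_nat (2 * d + 1)) ^ \<delta> * core_fun (2 * d + 1) (ee (\<tau> / of_nat (2 * d + 1))))"
proof -
  define L where "L = 2 * d + 1"
  have L: "(of_nat L :: complex) \<noteq> 0" "L > 0"
    unfolding of_nat_eq_0_iff by (simp_all add: L_def)
  define w where "w = \<tau> / of_nat L"
  have \<tau>w: "\<tau> = of_nat L * w" using L by (simp add: w_def)
  have kl: "klein_div d (int a) 1 0 \<tau> = ee (2 * of_nat (a\<^sup>2) / of_nat L * w) * theta (of_nat (2 * a) * w) \<tau>" for a
  proof -
    have cr: "complex_of_real (2 * of_int (int a * 1) / of_int (2 * int d + 1)) = 2 * of_nat a / of_nat L"
      by (simp add: L_def)
    have r: "2 * of_nat a / of_nat L * \<tau> = of_nat (2 * a) * w"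
      unfolding w_def by simp
    have s0: "complex_of_real (2 * of_int (int a * 0) / of_int (2 * int d + 1)) = 0"
      by simp
    have sq: "2 * of_nat a / of_nat L * (of_nat (2 * a) * w) / 2 = 2 * of_nat (a\<^sup>2) / of_nat L * w"
      by (simp add: power2_eq_square)
    show ?thesis
      unfolding klein_div_def klein_def cr s0 add_0_right r sq ..
  qed
  have "core_family d 1 0 \<tau> = inverse (\<Prod>a=1..int d. klein_div d a 1 0 \<tau>)"
    unfolding core_family_def by (rule prod_inversef[unfolded comp_def])
  also have "(\<Prod>a=1..int d. klein_div d a 1 0 \<tau>) = (\<Prod>a=1..d. klein_div d (int a) 1 0 \<tau>)"
    by (rule prod.reindex_bij_witness[of _ int nat]) auto
  also have "\<dots> = (\<Prod>a=1..d. ee (2 * of_nat (a\<^sup>2) / of_nat L * w)) * (\<Prod>a=1..d. theta (of_nat (2 * a) * w) \<tau>)"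
    unfolding kl by (rule prod.distrib)
  also have "(\<Prod>a=1..d. theta (of_nat (2 * a) * w) \<tau>) = (- 1) ^ d * (\<Prod>a=1..d. ee (- (of_nat (2 * a) * w) / 2)) / core_fun L (ee w)"
    using prod_theta_core[OF \<tau>, of d] by (simp only: L_def w_def)
  also have "(\<Prod>a=1..d. ee (2 * of_nat (a\<^sup>2) / of_nat L * w)) * ((- 1) ^ d * (\<Prod>a=1..d. ee (- (of_nat (2 * a) * w) / 2)) / core_fun L (ee w))
    = (\<Prod>a=1..d. ee (2 * of_nat (a\<^sup>2) / of_nat L * w) * ee (- (of_nat (2 * a) * w) / 2)) * (- 1) ^ d / core_fun L (ee w)"
    by (simp add: prod.distrib)
  also have "(\<Prod>a=1..d. ee (2 * of_nat (a\<^sup>2) / of_nat L * w) * ee (- (of_nat (2 * a) * w) / 2)) = ee (- (of_nat \<delta> * w))"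
  proof -
    have "(\<Prod>a=1..d. ee (2 * of_nat (a\<^sup>2) / of_nat L * w) * ee (- (of_nat (2 * a) * w) / 2))
      = ee (\<Sum>a=1..d. 2 * of_nat (a\<^sup>2) / of_nat L * w + - (of_nat (2 * a) * w) / 2)"
      by (simp only: ee_sum ee_add)
    also have "(\<Sum>a=1..d. 2 * of_nat (a\<^sup>2) / of_nat L * w + - (of_nat (2 * a) * w) / 2)
      = (2 * of_nat (\<Sum>a=1..d. a\<^sup>2) / of_nat L - of_nat (\<Sum>a=1..d. a)) * w"
      by (simp add: sum.distrib sum_subtractf sum_negf sum_distrib_left sum_distrib_right sum_divide_distrib algebra_simps)
    also have "(2 * of_nat (\<Sum>a=1..d. a\<^sup>2) / of_nat L - of_nat (\<Sum>a=1..d. a) :: complex) = - of_nat \<delta>"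
    proof -
      have "6 * (\<Sum>a=1..d. a\<^sup>2) = d * (d + 1) * L" "2 * (\<Sum>a=1..d. a) = d * (d + 1)"
        unfolding L_def by (induction d) (auto simp: power2_eq_square algebra_simps)
      then have "6 * (\<Sum>a=1..d. a\<^sup>2) = (6 * \<delta>) * L" "2 * (\<Sum>a=1..d. a) = 6 * \<delta>"
        unfolding \<delta> by simp_all
      then have "2 * (\<Sum>a=1..d. a\<^sup>2) = 2 * \<delta> * L" "(\<Sum>a=1..d. a) = 3 * \<delta>"
        by simp_all
      then have "2 * of_nat (\<Sum>a=1..d. a\<^sup>2) = (2 * of_nat \<delta> * of_nat L :: complex)" "of_nat (\<Sum>a=1..d. a) = (3 * of_nat \<delta> :: complex)"
        by (metis of_nat_mult of_nat_numeral)+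
      then show ?thesis using L by simp
    qed
    finally show ?thesis by simp
  qed
  also have "inverse (ee (- (of_nat \<delta> * w)) * (- 1) ^ d / core_fun L (ee w)) = (- 1) ^ d * (ee w ^ \<delta> * core_fun L (ee w))"
    unfolding ee_minus ee_of_nat_mult by (simp add: divide_inverse mult_ac flip: power_inverse)
  finally show ?thesis by (simp only: w_def L_def)
qed

section \<open>Expansions in fractional powers of q\<close>

definition has_qexp :: "nat \<Rightarrow> (complex \<Rightarrow> complex) \<Rightarrow> (nat \<Rightarrow> int) \<Rightarrow> bool" where
  "has_qexp L f c \<longleftrightarrow> (\<forall>\<tau>. Im \<tau> > 0 \<longrightarrow> (\<lambda>n. of_int (c n) * ee (\<tau> / of_nat L) ^ n) sums f \<tau>)"

lemma has_qexpD:
  "has_qexp L f c \<Longrightarrow> Im \<tau> > 0 \<Longrightarrow> (\<lambda>n. of_int (c n) * ee (\<tau> / of_nat L) ^ n) sums f \<tau>"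
  by (simp add: has_qexp_def)

lemma has_qexp_add:
  assumes f: "has_qexp L f c" and g: "has_qexp L g e"
  shows "has_qexp L (\<lambda>\<tau>. f \<tau> + g \<tau>) (\<lambda>n. c n + e n)"
  unfolding has_qexp_def
proof (intro allI impI)
  fix \<tau> :: complex assume \<tau>: "Im \<tau> > 0"
  from sums_add[OF has_qexpD[OF f \<tau>] has_qexpD[OF g \<tau>]]
  show "(\<lambda>n. of_int (c n + e n) * ee (\<tau> / of_nat L) ^ n) sums (f \<tau> + g \<tau>)"
    by (simp add: ring_distribs)
qed

lemma has_qexp_cmult:
  assumes f: "has_qexp L f c"
  shows "has_qexp L (\<lambda>\<tau>. of_int k * f \<tau>) (\<lambda>n. k * c n)"
  unfolding has_qexp_def
proof (intro allI impI)
  fix \<tau> :: complex assume \<tau>: "Im \<tau> > 0"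
  from sums_mult[OF has_qexpD[OF f \<tau>], of "of_int k"]
  show "(\<lambda>n. of_int (k * c n) * ee (\<tau> / of_nat L) ^ n) sums (of_int k * f \<tau>)"
    by (simp add: mult.assoc)
qed

lemma ee_surj:
  assumes "L > 0" "x \<noteq> 0" "norm x < 1"
  obtains \<tau> where "Im \<tau> > 0" "ee (\<tau> / of_nat L) = x"
proof
  define w where "w = Ln x / (2 * of_real pi * \<i>)"
  have w: "ee w = x"
    using assms by (simp add: ee_def w_def)
  show "ee (of_nat L * w / of_nat L) = x"
    using assms w by simp
  have "norm (ee w) < 1"
    using w assms by simp
  then show "Im (of_nat L * w) > 0"
    using assms(1) by (simp add: norm_ee zero_less_mult_iff)
qed

lemma qexp_sums_shift:
  assumes f: "has_qexp L f c" and L: "L > 0" and c: "\<And>n. n < m \<Longrightarrow> c n = 0" and \<tau>: "Im \<tau> > 0"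
  shows "(\<lambda>n. of_int (c (n + m)) * ee (\<tau> / of_nat L) ^ n) sums (f \<tau> / ee (\<tau> / of_nat L) ^ m)"
proof -
  let ?x = "ee (\<tau> / of_nat L)"
  have "(\<lambda>n. of_int (c n) * ?x ^ n) sums f \<tau>"
    using f \<tau> by (rule has_qexpD)
  then have "(\<lambda>n. of_int (c (n + m)) * ?x ^ (n + m)) sums (f \<tau> - (\<Sum>n<m. of_int (c n) * ?x ^ n))"
    by (rule sums_split_initial_segment)
  also have "(\<Sum>n<m. of_int (c n) * ?x ^ n) = 0"
    using c by simp
  finally have "(\<lambda>n. of_int (c (n + m)) * ?x ^ (n + m) / ?x ^ m) sums ((f \<tau> - 0) / ?x ^ m)"
    by (rule sums_divide)
  then show ?thesis by (simp add: power_add)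
qed

text \<open>
  As \<open>e(\<tau> / L)\<close> runs through the whole punctured unit disc, an expansion is an
  ordinary power series there, and dividing by the leading power leaves a function
  with the leading coefficient as its limit at 0.
\<close>

lemma qexp_leading_coeff:
  assumes f: "has_qexp L f c" and L: "L > 0" and c: "\<And>n. n < m \<Longrightarrow> c n = 0"
  obtains g where "\<And>\<tau>. Im \<tau> > 0 \<Longrightarrow> f \<tau> = ee (\<tau> / of_nat L) ^ m * g (ee (\<tau> / of_nat L))"
    "(g \<longlongrightarrow> of_int (c m)) (at 0)"
proof
  define g where "g x = (\<Sum>n. of_int (c (n + m)) * x ^ n)" for x :: complex
  show "f \<tau> = ee (\<tau> / of_nat L) ^ m * g (ee (\<tau> / of_nat L))" if "Im \<tau> > 0" for \<tau>
  proof -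
    have "(\<lambda>n. of_int (c (n + m)) * ee (\<tau> / of_nat L) ^ n) sums (f \<tau> / ee (\<tau> / of_nat L) ^ m)"
      by (rule qexp_sums_shift[OF f L c that])
    then show ?thesis by (simp add: g_def sums_iff)
  qed
  have "(g \<longlongrightarrow> of_int (c (0 + m))) (at 0)"
  proof (rule powser_limit_0_strong[of 1])
    fix x :: complex assume x: "x \<noteq> 0" "norm x < 1"
    obtain \<tau> where \<tau>: "Im \<tau> > 0" "ee (\<tau> / of_nat L) = x"
      using ee_surj[OF L x] .
    have "(\<lambda>n. of_int (c (n + m)) * ee (\<tau> / of_nat L) ^ n) sums (f \<tau> / ee (\<tau> / of_nat L) ^ m)"
      by (rule qexp_sums_shift[OF f L c \<tau>(1)])
    then show "(\<lambda>n. of_int (c (n + m)) * x ^ n) sums g x"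
      unfolding \<tau>(2) g_def by (simp add: sums_iff)
  qed simp
  then show "(g \<longlongrightarrow> of_int (c m)) (at 0)" by simp
qed

lemma qexp_ee_tendsto_0:
  assumes "L > 0" "eventually P (at 0)"
  shows "\<exists>Y. \<forall>\<tau>. Im \<tau> \<ge> Y \<longrightarrow> P (ee (\<tau> / of_nat L))"
proof -
  obtain r where r: "r > 0" "\<And>x. x \<noteq> 0 \<Longrightarrow> norm x < r \<Longrightarrow> P x"
    using assms(2) unfolding eventually_at by (auto simp: dist_norm)
  have "((\<lambda>y. exp (- 2 * pi * (y / L))) \<longlongrightarrow> 0) at_top"
    using assms(1) by real_asymp
  then have "eventually (\<lambda>y. exp (- 2 * pi * (y / L)) < r) at_top"
    by (rule order_tendstoD) (use r in simp)
  then obtain Y where Y: "\<And>y. y \<ge> Y \<Longrightarrow> exp (- 2 * pi * (y / L)) < r"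
    unfolding eventually_at_top_linorder by auto
  have "P (ee (\<tau> / of_nat L))" if "Im \<tau> \<ge> Y" for \<tau>
    using Y[OF that] by (intro r) (simp_all add: norm_ee Im_divide_of_nat)
  then show ?thesis by blast
qed

lemma has_qexp_zero_imp:
  assumes "has_qexp L f c" "L > 0" and f: "\<And>\<tau>. Im \<tau> > 0 \<Longrightarrow> f \<tau> = 0"
  shows "c n = 0"
proof (induction n rule: less_induct)
  case (less n)
  obtain g where g: "\<And>\<tau>. Im \<tau> > 0 \<Longrightarrow> f \<tau> = ee (\<tau> / of_nat L) ^ n * g (ee (\<tau> / of_nat L))"
    "(g \<longlongrightarrow> of_int (c n)) (at 0)"
    using qexp_leading_coeff[OF assms(1,2) less] by blast
  have "g x = 0" if x: "x \<noteq> 0" "norm x < 1" for x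
  proof -
    obtain \<tau> where "Im \<tau> > 0" "ee (\<tau> / of_nat L) = x"
      using ee_surj[OF assms(2) x] .
    then show ?thesis using g(1)[of \<tau>] f[of \<tau>] x by simp
  qed
  then have "eventually (\<lambda>x. 0 = g x) (at 0)"
    unfolding eventually_at by (intro exI[of _ 1]) (auto simp: dist_norm)
  then have "(g \<longlongrightarrow> 0) (at 0)"
    using tendsto_cong[of "\<lambda>_. 0" g "at 0" 0] by simp
  with g(2) have "of_int (c n) = (0 :: complex)"
    by (rule LIM_unique)
  then show ?case by simp
qed

text \<open>
  For \<open>s = 1\<close> this is the classical action of the Hecke operator at 2 in weight \<open>d\<close>
  with trivial character value at 2; in general it is \<open>s\<close> times the operator whose
  character value at 2 is \<open>s\<close>, provided \<open>s\<close> is 1 or -1.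
\<close>

definition hecke2_seq :: "nat \<Rightarrow> int \<Rightarrow> (nat \<Rightarrow> int) \<Rightarrow> nat \<Rightarrow> int" where
  "hecke2_seq d s c n = s * c (2 * n) + (if even n then 2 ^ (d - 1) * c (n div 2) else 0)"

text \<open>
  The first summand of \<open>hecke2\<close> replaces \<open>q\<close> by \<open>q\<^sup>2\<close>. The other two are the same
  function at \<open>\<tau> / 2\<close> and, after a translation by \<open>d\<close>, at \<open>(\<tau> + L) / 2\<close>; there
  \<open>q\<^bsup>1/L\<^esup>\<close> becomes \<open>y\<close> and \<open>- y\<close> with \<open>y\<close> a square root of \<open>q\<^bsup>1/L\<^esup>\<close>, so their mean
  selects the even exponents.
\<close>

lemma has_qexp_hecke2:
  assumes fam: "modular_family d (of_int s) \<Psi>" and q: "has_qexp (2 * d + 1) (\<Psi> 1 0) c"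
  shows "has_qexp (2 * d + 1) (hecke2 d \<Psi> 1 0) (hecke2_seq d s c)"
  unfolding has_qexp_def
proof (intro allI impI)
  fix \<tau> :: complex assume \<tau>: "Im \<tau> > 0"
  interpret modular_family d "of_int s" \<Psi> by fact
  define L where "L = 2 * d + 1"
  have L: "L > 0" "(of_nat L :: complex) \<noteq> 0" unfolding of_nat_eq_0_iff by (simp_all add: L_def)
  define x where "x = ee (\<tau> / of_nat L)"
  define y where "y = ee (\<tau> / 2 / of_nat L)"
  have yx: "y\<^sup>2 = x"
    unfolding x_def y_def power2_eq_square ee_add [symmetric] by (rule arg_cong[of _ _ ee]) (simp add: field_simps)
  have x2: "ee (2 * \<tau> / of_nat L) = x\<^sup>2"
    unfolding x_def power2_eq_square ee_add [symmetric] by (rule arg_cong[of _ _ ee]) (simp add: field_simps)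
  have "(\<lambda>n. of_int (c n) * (x\<^sup>2) ^ n) sums \<Psi> 1 0 (2 * \<tau>)"
    using has_qexpD[OF q, of "2 * \<tau>"] \<tau> unfolding L_def [symmetric] x2 by simp
  then have "(\<lambda>n. (\<lambda>n. (if even n then of_int (c (n div 2)) else 0) * x ^ n) (2 * n)) sums \<Psi> 1 0 (2 * \<tau>)"
    by (simp add: power_mult)
  then have "(\<lambda>n. (if even n then of_int (c (n div 2)) else 0) * x ^ n) sums \<Psi> 1 0 (2 * \<tau>)"
    by (subst (asm) sums_mono_reindex) (auto simp: strict_mono_def image_def elim!: evenE)
  then have 1: "(\<lambda>n. 2 ^ (d - 1) * ((if even n then of_int (c (n div 2)) else 0) * x ^ n)) sums (2 ^ (d - 1) * \<Psi> 1 0 (2 * \<tau>))"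
    by (rule sums_mult)
  have \<Psi>2: "\<Psi> 2 0 (\<tau> / 2) = of_int s * \<Psi> 1 0 (\<tau> / 2)"
    using twice[of "\<tau> / 2" 1 0] \<tau> by simp
  have "\<Psi> 2 (- 1) ((\<tau> + 1) / 2) = \<Psi> (2 * 1) (2 * int d) ((\<tau> + 1) / 2)"
  proof (rule cong_level)
    show "[- 1 = 2 * int d] (mod 2 * int d + 1)"
      by (rule cong_sym) (simp add: cong_iff_dvd_diff)
  qed (use \<tau> in auto)
  also have "\<dots> = of_int s * \<Psi> 1 (int d) ((\<tau> + 1) / 2)"
    using \<tau> by (intro twice) simp
  also have "\<Psi> 1 (int d) ((\<tau> + 1) / 2) = \<Psi> 1 0 ((\<tau> + 1) / 2 + of_int (int d))"
    using T_int[of "(\<tau> + 1) / 2" 1 0 "int d"] \<tau> by simp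
  finally have \<Psi>3: "\<Psi> 2 (- 1) ((\<tau> + 1) / 2) = of_int s * \<Psi> 1 0 ((\<tau> + 1) / 2 + of_int (int d))" .
  have y2: "ee (((\<tau> + 1) / 2 + of_int (int d)) / of_nat L) = - y"
  proof -
    have "(\<tau> + 1) / 2 + of_int (int d) = (\<tau> + of_nat L) / 2"
      by (simp add: L_def field_simps)
    then have "((\<tau> + 1) / 2 + of_int (int d)) / of_nat L = (\<tau> + of_nat L) / 2 / of_nat L"
      by (simp only:)
    also have "\<dots> = \<tau> / 2 / of_nat L + 1/2"
      using L by (simp add: add_divide_distrib)
    finally have "((\<tau> + 1) / 2 + of_int (int d)) / of_nat L = \<tau> / 2 / of_nat L + 1/2" .
    then show ?thesis by (simp add: ee_add y_def)
  qed
  have s1: "(\<lambda>n. of_int (c n) * y ^ n) sums \<Psi> 1 0 (\<tau> / 2)"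
    using has_qexpD[OF q, of "\<tau> / 2"] \<tau> unfolding y_def L_def by simp
  have s2: "(\<lambda>n. of_int (c n) * (- y) ^ n) sums \<Psi> 1 0 ((\<tau> + 1) / 2 + of_int (int d))"
    using has_qexpD[OF q, of "(\<tau> + 1) / 2 + of_int (int d)"] \<tau> unfolding L_def [symmetric] y2 by simp
  have "(\<lambda>n. of_int (c n) * y ^ n + of_int (c n) * (- y) ^ n) sums
      (\<Psi> 1 0 (\<tau> / 2) + \<Psi> 1 0 ((\<tau> + 1) / 2 + of_int (int d)))" (is "?f sums ?S")
    by (rule sums_add[OF s1 s2])
  moreover have "?f n = 0" if "n \<notin> range ((*) 2)" for n
  proof -
    have "odd n" using that by (auto elim!: evenE)
    then show ?thesis by (simp add: power_minus_odd)
  qed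
  ultimately have "(\<lambda>n. ?f (2 * n)) sums ?S"
    using sums_mono_reindex[of "(*) 2" ?f ?S] by (simp add: strict_mono_def)
  moreover have "?f (2 * n) = 2 * (of_int (c (2 * n)) * x ^ n)" for n
    by (simp add: power_mult yx)
  ultimately have "(\<lambda>n. 2 * (of_int (c (2 * n)) * x ^ n)) sums ?S"
    by (simp only:)
  then have 2: "(\<lambda>n. of_int s / 2 * (2 * (of_int (c (2 * n)) * x ^ n))) sums (of_int s / 2 * ?S)"
    by (rule sums_mult)
  have "hecke2 d \<Psi> 1 0 \<tau> = 2 ^ (d - 1) * \<Psi> 1 0 (2 * \<tau>) + of_int s / 2 * ?S"
    unfolding hecke2_def using \<Psi>2 \<Psi>3 by (simp add: algebra_simps)
  moreover have "(\<lambda>n. of_int (hecke2_seq d s c n) * x ^ n) = (\<lambda>n. 2 ^ (d - 1) * ((if even n then of_int (c (n div 2)) else 0) * x ^ n)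
      + of_int s / 2 * (2 * (of_int (c (2 * n)) * x ^ n)))"
    by (rule ext) (simp add: hecke2_seq_def algebra_simps)
  ultimately show "(\<lambda>n. of_int (hecke2_seq d s c n) * ee (\<tau> / of_nat (2 * d + 1)) ^ n) sums hecke2 d \<Psi> 1 0 \<tau>"
    using sums_add[OF 1 2] unfolding x_def L_def by simp
qed

text \<open>
  The mean of the translates \<open>\<Psi> 1 0 (\<tau> / L + j)\<close>; on expansions it selects every
  \<open>L\<close>-th coefficient.
\<close>

definition atkin_U :: "nat \<Rightarrow> (int \<Rightarrow> int \<Rightarrow> complex \<Rightarrow> complex) \<Rightarrow> complex \<Rightarrow> complex" where
  "atkin_U L \<Psi> \<tau> = (\<Sum>j<L. \<Psi> 1 (int j) (\<tau> / of_nat L)) / of_nat L"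

lemma has_qexp_atkin_U:
  assumes fam: "modular_family d \<sigma> \<Psi>" and q: "has_qexp (2 * d + 1) (\<Psi> 1 0) c"
  shows "has_qexp (2 * d + 1) (atkin_U (2 * d + 1) \<Psi>) (\<lambda>n. c ((2 * d + 1) * n))"
  unfolding has_qexp_def
proof (intro allI impI)
  fix \<tau> :: complex assume \<tau>: "Im \<tau> > 0"
  interpret modular_family d \<sigma> \<Psi> by fact
  define L where "L = 2 * d + 1"
  have L: "L > 0" "(of_nat L :: complex) \<noteq> 0" unfolding of_nat_eq_0_iff by (simp_all add: L_def)
  define x where "x = ee (\<tau> / of_nat L)"
  define y where "y = ee (\<tau> / of_nat L / of_nat L)"
  define \<omega> where "\<omega> = ee (1 / of_nat L)"
  have yL: "y ^ L = x"
    unfolding y_def x_def ee_of_nat_mult [symmetric] using L by simp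
  have tm: "(\<lambda>n. of_int (c n) * (y * \<omega> ^ j) ^ n) sums \<Psi> 1 (int j) (\<tau> / of_nat L)" for j
  proof -
    have \<tau>L: "Im (\<tau> / of_nat L) > 0" using \<tau> L by (simp add: Im_divide_of_nat)
    have "\<Psi> 1 (int j) (\<tau> / of_nat L) = \<Psi> 1 0 (\<tau> / of_nat L + of_int (int j))"
      using T_int[OF \<tau>L, of 1 0 "int j"] by simp
    moreover have "ee ((\<tau> / of_nat L + of_int (int j)) / of_nat L) = y * \<omega> ^ j"
      unfolding y_def \<omega>_def ee_of_nat_mult [symmetric] ee_add [symmetric] by (simp add: add_divide_distrib)
    ultimately show ?thesis
      using has_qexpD[OF q, of "\<tau> / of_nat L + of_int (int j)"] \<tau>L unfolding L_def [symmetric] by simp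
  qed
  have "(\<lambda>n. \<Sum>j<L. of_int (c n) * (y * \<omega> ^ j) ^ n) sums (\<Sum>j<L. \<Psi> 1 (int j) (\<tau> / of_nat L))"
    by (intro sums_sum tm)
  moreover have "(\<Sum>j<L. of_int (c n) * (y * \<omega> ^ j) ^ n) = (if L dvd n then of_nat L * of_int (c n) * y ^ n else 0)" for n
  proof -
    have "(\<Sum>j<L. of_int (c n) * (y * \<omega> ^ j) ^ n) = of_int (c n) * y ^ n * (\<Sum>j<L. (\<omega> ^ n) ^ j)"
      by (simp add: sum_distrib_left power_mult_distrib mult_ac flip: power_mult)
    moreover have "(\<Sum>j<L. (\<omega> ^ n) ^ j) = (if L dvd n then of_nat L else 0)"
    proof (cases "L dvd n")
      case True
      then obtain k where "n = L * k" ..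
      then have "\<omega> ^ n = 1"
        unfolding \<omega>_def ee_of_nat_mult [symmetric] using L by simp
      then show ?thesis using True by simp
    next
      case False
      have "\<omega> ^ n \<noteq> 1"
      proof
        assume "\<omega> ^ n = 1"
        then have "of_nat n * (1 / of_nat L) \<in> (\<int> :: complex set)"
          unfolding \<omega>_def ee_of_nat_mult [symmetric] ee_eq_1_iff .
        then obtain k where "of_nat n * (1 / of_nat L) = (of_int k :: complex)"
          by (rule Ints_cases)
        then have "(of_nat n :: complex) = of_int k * of_nat L"
          using L by (simp add: field_simps)
        then have "(of_int (int n) :: complex) = of_int (k * int L)"
          by simp
        then have "int n = k * int L"
          by (simp only: of_int_eq_iff)
        then have "int L dvd int n" by simp
        then show False using False by simp
      qed
      moreover have "(\<omega> ^ n) ^ L = 1"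
      proof -
        have "\<omega> ^ L = 1" unfolding \<omega>_def ee_of_nat_mult [symmetric] using L by simp
        then show ?thesis by (metis power_mult power_one mult.commute)
      qed
      ultimately show ?thesis
        using False by (simp add: sum_gp_strict geometric_sum)
    qed
    ultimately show ?thesis by simp
  qed
  ultimately have "(\<lambda>n. if L dvd n then of_nat L * of_int (c n) * y ^ n else 0) sums (\<Sum>j<L. \<Psi> 1 (int j) (\<tau> / of_nat L))" (is "?f sums ?S")
    by simp
  then have "(\<lambda>n. ?f (L * n)) sums ?S"
    by (subst sums_mono_reindex) (use L in \<open>auto simp: strict_mono_def image_def dvd_def\<close>)
  moreover have "?f (L * n) = of_nat L * of_int (c (L * n)) * x ^ n" for n
    by (simp add: power_mult yL)
  ultimately have "(\<lambda>n. of_nat L * of_int (c (L * n)) * x ^ n) sums ?S"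
    by (simp only:)
  then have "(\<lambda>n. of_nat L * of_int (c (L * n)) * x ^ n / of_nat L) sums (?S / of_nat L)"
    by (rule sums_divide)
  then show "(\<lambda>n. of_int (c ((2 * d + 1) * n)) * ee (\<tau> / of_nat (2 * d + 1)) ^ n) sums atkin_U (2 * d + 1) \<Psi> \<tau>"
    using L unfolding atkin_U_def L_def [symmetric] x_def by simp
qed

text \<open>
  The coefficients of the form that \<open>core_family\<close> represents: the core counts,
  delayed by its order at infinity.
\<close>

definition core_seq :: "nat \<Rightarrow> nat \<Rightarrow> nat \<Rightarrow> int" where
  "core_seq l \<delta> n = core_count l (int n - int \<delta>)"

lemma has_qexp_core_family:
  assumes \<delta>: "6 * \<delta> = d * (d + 1)"
  shows "has_qexp (2 * d + 1) (\<lambda>\<tau>. (- 1) ^ d * core_family d 1 0 \<tau>) (core_seq (2 * d + 1) \<delta>)"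
  unfolding has_qexp_def
proof (intro allI impI)
  fix \<tau> :: complex assume \<tau>: "Im \<tau> > 0"
  define x where "x = ee (\<tau> / of_nat (2 * d + 1))"
  have x: "norm x < 1"
    unfolding x_def using \<tau> by (intro norm_ee_less_1) (simp add: Im_divide_of_nat del: of_nat_add of_nat_Suc)
  have "(\<lambda>n. x ^ \<delta> * (of_int (core_count (2 * d + 1) (int n)) * x ^ n)) sums (x ^ \<delta> * core_fun (2 * d + 1) x)"
    by (intro sums_mult core_fun_sums x) simp
  moreover have "(\<lambda>n. x ^ \<delta> * (of_int (core_count (2 * d + 1) (int n)) * x ^ n))
    = (\<lambda>n. of_int (core_seq (2 * d + 1) \<delta> (n + \<delta>)) * x ^ (n + \<delta>))"
    by (rule ext) (simp add: core_seq_def power_add)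
  moreover have "(\<Sum>n<\<delta>. of_int (core_seq (2 * d + 1) \<delta> n) * x ^ n) = 0"
    by (intro sum.neutral) (auto simp: core_seq_def core_count_def)
  ultimately have "(\<lambda>n. of_int (core_seq (2 * d + 1) \<delta> n) * x ^ n) sums (x ^ \<delta> * core_fun (2 * d + 1) x)"
    using sums_iff_shift[of "\<lambda>n. of_int (core_seq (2 * d + 1) \<delta> n) * x ^ n" \<delta> "x ^ \<delta> * core_fun (2 * d + 1) x"]
    by simp
  also have "x ^ \<delta> * core_fun (2 * d + 1) x = (- 1) ^ d * core_family d 1 0 \<tau>"
    unfolding core_family_eq_core_fun[OF \<tau> \<delta>] x_def by (simp flip: power_mult_distrib mult.assoc)
  finally show "(\<lambda>n. of_int (core_seq (2 * d + 1) \<delta> n) * ee (\<tau> / of_nat (2 * d + 1)) ^ n) sums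
      ((- 1) ^ d * core_family d 1 0 \<tau>)"
    by (simp only: x_def)
qed

section \<open>Computation of the first core counts\<close>

definition list_represents :: "int list \<Rightarrow> rat fps \<Rightarrow> bool" where
  "list_represents xs F \<longleftrightarrow> (\<forall>i<length xs. fps_nth F i = of_int (xs ! i))"

text \<open>
  With a queue \<open>q\<close> of \<open>k\<close> zeros, \<open>list_mult\<close> multiplies by \<open>1 - X\<^sup>k\<close> and \<open>list_div\<close>
  divides by it. The queue holds the last \<open>k\<close> input or output coefficients,
  respectively, so that evaluation needs no indexing.
\<close>

fun list_mult :: "int list \<Rightarrow> int list \<Rightarrow> int list" where
  "list_mult q [] = []"
| "list_mult q (x # xs) = (x - hd q) # list_mult (tl q @ [x]) xs"

fun list_div :: "int list \<Rightarrow> int list \<Rightarrow> int list" where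
  "list_div q [] = []"
| "list_div q (x # xs) = (x + hd q) # list_div (tl q @ [x + hd q]) xs"

text \<open>
  Factors of the numerator that do not change the first \<open>N + 1\<close> coefficients are
  skipped.
\<close>

definition core_list :: "nat \<Rightarrow> nat \<Rightarrow> int list" where
  "core_list l N = fold (\<lambda>n xs. list_div (replicate (Suc n) 0)
     (if l * Suc n \<le> N then (list_mult (replicate (l * Suc n) 0) ^^ l) xs else xs)) [0..<N] (1 # replicate N 0)"

lemma length_list_div [simp]: "length (list_div q xs) = length xs"
  by (induction q xs rule: list_div.induct) auto

lemma length_list_mult [simp]: "length (list_mult q xs) = length xs"
  by (induction q xs rule: list_mult.induct) auto

lemma list_mult_nth:
  assumes "length q = k" "k > 0" "i < length xs"
  shows "list_mult q xs ! i = xs ! i - (if i < k then q ! i else xs ! (i - k))"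
  using assms
proof (induction q xs arbitrary: i rule: list_mult.induct)
  case (2 q x xs)
  show ?case
  proof (cases i)
    case 0
    then show ?thesis using 2 by (cases q) auto
  next
    case (Suc j)
    let ?q = "tl q @ [x]"
    have "list_mult ?q xs ! j = xs ! j - (if j < k then ?q ! j else xs ! (j - k))"
      using 2 Suc by (intro "2.IH") auto
    moreover have "j < k \<Longrightarrow> ?q ! j = (if Suc j < k then q ! Suc j else x)"
      using 2 by (auto simp: nth_append nth_tl)
    ultimately show ?thesis
      using Suc 2 by (auto simp: Suc_diff_le nth_Cons')
  qed
qed simp

lemma list_represents_mult:
  assumes "list_represents xs F" "k > 0"
  shows "list_represents (list_mult (replicate k 0) xs) (F * (1 - fps_X ^ k))"
  using assms
  by (auto simp: list_represents_def right_diff_distrib fps_X_power_mult_right_nth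
      list_mult_nth[OF length_replicate])

lemma list_represents_mult_power:
  assumes "list_represents xs F" "k > 0"
  shows "list_represents ((list_mult (replicate k 0) ^^ j) xs) (F * (1 - fps_X ^ k) ^ j)"
proof (induction j)
  case (Suc j)
  then have "list_represents ((list_mult (replicate k 0) ^^ Suc j) xs) (F * (1 - fps_X ^ k) ^ j * (1 - fps_X ^ k))"
    using assms(2) by (simp add: list_represents_mult)
  then show ?case by (simp add: mult_ac)
qed (use assms in simp)

lemma list_div_nth:
  assumes "length q = k" "k > 0" "i < length xs"
  shows "list_div q xs ! i = xs ! i + (if i < k then q ! i else list_div q xs ! (i - k))"
  using assms
proof (induction q xs arbitrary: i rule: list_div.induct)
  case (2 q x xs)
  show ?case
  proof (cases i)
    case 0
    then show ?thesis using 2 by (cases q) auto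
  next
    case (Suc j)
    let ?q = "tl q @ [x + hd q]"
    have "list_div ?q xs ! j = xs ! j + (if j < k then ?q ! j else list_div ?q xs ! (j - k))"
      using 2 Suc by (intro "2.IH") auto
    moreover have "j < k \<Longrightarrow> ?q ! j = (if Suc j < k then q ! Suc j else x + hd q)"
      using 2 by (auto simp: nth_append nth_tl)
    ultimately show ?thesis
      using Suc 2 by (auto simp: Suc_diff_le nth_Cons')
  qed
qed simp

lemma list_represents_div:
  assumes "list_represents xs F" "k > 0"
  shows "list_represents (list_div (replicate k 0) xs) (F / (1 - fps_X ^ k))"
proof -
  let ?G = "F / (1 - fps_X ^ k)"
  have "?G * (1 - fps_X ^ k) = F * (inverse (1 - fps_X ^ k) * (1 - fps_X ^ k))"
    using assms(2) by (simp add: fps_divide_unit mult_ac)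
  also have "inverse (1 - fps_X ^ k) * (1 - fps_X ^ k) = (1 :: rat fps)"
    using assms(2) by (intro inverse_mult_eq_1) simp
  finally have G: "F = ?G - ?G * fps_X ^ k"
    by (simp add: algebra_simps)
  have rec: "fps_nth ?G i = fps_nth F i + (if i < k then 0 else fps_nth ?G (i - k))" for i
    by (subst (2) G) (simp add: fps_X_power_mult_right_nth)
  have "fps_nth ?G i = of_int (list_div (replicate k 0) xs ! i)" if "i < length xs" for i
    using that
  proof (induction i rule: less_induct)
    case (less i)
    show ?case
      unfolding rec[of i] list_div_nth[OF length_replicate assms(2) less.prems]
      using assms less by (auto simp: list_represents_def)
  qed
  then show ?thesis by (simp add: list_represents_def)
qed

lemma list_mult_idle: "length xs \<le> k \<Longrightarrow> k > 0 \<Longrightarrow> list_mult (replicate k 0) xs = xs"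
  by (rule nth_equalityI) (auto simp: list_mult_nth[OF length_replicate])

lemma list_represents_core_list:
  assumes l: "l > 0"
  shows "list_represents (core_list l N) (\<Prod>n<N. core_factor l n) \<and> length (core_list l N) = Suc N"
proof -
  define f where "f n xs = list_div (replicate (Suc n) 0)
     (if l * Suc n \<le> N then (list_mult (replicate (l * Suc n) 0) ^^ l) xs else xs)" for n xs
  define z :: "int list" where "z = 1 # replicate N 0"
  have len: "length ((list_mult q ^^ j) xs) = length xs" for q j xs
    by (induction j) auto
  have "list_represents (fold f [0..<M] z) (\<Prod>n<M. core_factor l n) \<and> length (fold f [0..<M] z) = Suc N" for M
  proof (induction M)
    case 0
    show ?case by (auto simp: list_represents_def nth_Cons' z_def)
  next
    case (Suc M)
    let ?F = "\<Prod>n<M. core_factor l n" and ?xs = "fold f [0..<M] z"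
    have pos: "l * Suc M > 0" using l by simp
    have skip: "(list_mult (replicate (l * Suc M) 0) ^^ j) ?xs = ?xs" if "\<not> l * Suc M \<le> N" for j
      using that Suc pos by (induction j) (simp_all add: list_mult_idle del: mult_Suc_right)
    have "f M ?xs = list_div (replicate (Suc M) 0) ((list_mult (replicate (l * Suc M) 0) ^^ l) ?xs)"
      using skip by (auto simp: f_def)
    then have fold: "fold f [0..<Suc M] z = list_div (replicate (Suc M) 0) ((list_mult (replicate (l * Suc M) 0) ^^ l) ?xs)"
      by simp
    have "list_represents (fold f [0..<Suc M] z) (?F * (1 - fps_X ^ (l * Suc M)) ^ l / (1 - fps_X ^ Suc M))"
      unfolding fold using Suc pos by (intro list_represents_div list_represents_mult_power) auto
    moreover have "?F * (1 - fps_X ^ (l * Suc M)) ^ l / (1 - fps_X ^ Suc M) = (\<Prod>n<Suc M. core_factor l n)"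
      by (simp add: fps_divide_unit mult.assoc del: power_Suc mult_Suc_right)
    moreover have "length (fold f [0..<Suc M] z) = Suc N"
      unfolding fold using Suc len by simp
    ultimately show ?case by simp
  qed
  then show ?thesis unfolding core_list_def f_def z_def by blast
qed

text \<open>
  The factor with index \<open>n\<close> is 1 up to terms of degree at least \<open>n + 1\<close>.
\<close>

lemma core_gf_nth_partial:
  assumes l: "l > 0" and k: "k \<le> N"
  shows "fps_nth (core_gf l) k = fps_nth (\<Prod>n<N. core_factor l n) k"
proof -
  define P where "P N = (\<Prod>n<N. core_factor l n)" for N
  have step: "fps_nth (P (Suc M)) k = fps_nth (P M) k" if "k \<le> M" for M
  proof -
    have "fps_X ^ Suc M dvd P M * (core_factor l M - 1)"
      by (intro dvd_mult core_factor_dvd l)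
    then obtain H where H: "P M * (core_factor l M - 1) = fps_X ^ Suc M * H" ..
    have "P (Suc M) - P M = P M * (core_factor l M - 1)"
      by (simp only: P_def prod.lessThan_Suc right_diff_distrib mult_1_right)
    then have "fps_nth (P (Suc M) - P M) k = 0"
      using that unfolding H by (simp add: fps_X_power_mult_nth del: power_Suc)
    then show ?thesis by simp
  qed
  have const: "fps_nth (P M) k = fps_nth (P N) k" if "N \<le> M" for M
    using that by (induction rule: dec_induct) (use step k in auto)
  have "P \<longlonglongrightarrow> core_gf l"
    unfolding P_def using core_gf_has_prod[OF l] by (rule has_prod_imp_tendsto')
  then have "eventually (\<lambda>M. fps_nth (P M) k = fps_nth (core_gf l) k) sequentially"
    by (simp only: tendsto_fps_iff)
  then obtain M where "\<And>M'. M' \<ge> M \<Longrightarrow> fps_nth (P M') k = fps_nth (core_gf l) k"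
    unfolding eventually_sequentially by auto
  from this[of "max M N"] const[of "max M N"] show ?thesis
    by (simp add: P_def)
qed

lemma core_count_list:
  assumes "l > 0" "k \<le> N"
  shows "core_count l (int k) = core_list l N ! k"
proof -
  have "(of_int (core_count l (int k)) :: rat) = of_int (core_list l N ! k)"
    using list_represents_core_list[OF assms(1), of N] core_gf_nth_partial[OF assms] assms
    by (simp add: of_int_core_count list_represents_def)
  then show ?thesis by simp
qed

lemma core_list_5: "core_list 5 4 =
  [1, 1, 2, 3, 5]"
  by code_simp

lemma core_list_7: "core_list 7 12 =
  [1, 1, 2, 3, 5, 7, 11, 8, 15, 16, 21, 21, 28]"
  by code_simp

lemma core_list_11: "core_list 11 50 =
  [1, 1, 2, 3, 5, 7, 11, 15, 22, 30, 42, 45, 66, 79, 102, 121, 154, 176, 220, 248, 297,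
   330, 430, 452, 552, 605, 720, 777, 935, 990, 1182, 1265, 1485, 1530, 1838, 1892, 2214,
   2310, 2684, 2750, 3238, 3289, 3850, 3960, 4500, 4599, 5370, 5404, 6220, 6325, 7238]"
  by code_simp

section \<open>Comparison of finitely many coefficients\<close>

lemma sum_reindex_affine_mod:
  fixes g :: "int \<Rightarrow> complex"
  assumes L: "L > 0" and per: "\<And>y y'. [y = y'] (mod int L) \<Longrightarrow> g y = g y'" and \<beta>: "coprime \<beta> (int L)"
  shows "(\<Sum>j<L. g (\<alpha> + \<beta> * int j)) = (\<Sum>j<L. g (int j))"
proof -
  define h where "h j = nat ((\<alpha> + \<beta> * int j) mod int L)" for j
  have h: "int (h j) = (\<alpha> + \<beta> * int j) mod int L" for j
    using L by (simp add: h_def)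
  have "inj_on h {..<L}"
  proof
    fix i j assume ij: "i \<in> {..<L}" "j \<in> {..<L}" "h i = h j"
    then have "[\<alpha> + \<beta> * int i = \<alpha> + \<beta> * int j] (mod int L)"
      unfolding cong_iff_dvd_diff mod_eq_dvd_iff [symmetric] h [symmetric] by simp
    then have "[int i = int j] (mod int L)"
      using \<beta> by (simp add: cong_add_lcancel cong_mult_lcancel)
    then show "i = j"
      using ij by (simp add: cong_int_iff cong_less_modulus_unique_nat)
  qed
  moreover have "h ` {..<L} \<subseteq> {..<L}"
  proof safe
    fix j
    have "int (h j) < int L" unfolding h using L by simp
    then show "h j < L" by simp
  qed
  ultimately have "bij_betw h {..<L} {..<L}"
    by (simp add: bij_betw_def endo_inj_surj)
  then have "(\<Sum>j<L. g (int (h j))) = (\<Sum>j<L. g (int j))"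
    by (rule sum.reindex_bij_betw)
  moreover have "g (int (h j)) = g (\<alpha> + \<beta> * int j)" for j
    by (rule per) (simp add: h cong_def)
  ultimately show ?thesis by simp
qed

context modular_family
begin

text \<open>
  A matrix of the subgroup sends \<open>(1, 0)\<close> to \<open>(a, 0)\<close>, and \<open>a\<close> is up to sign a power
  of 2 modulo the level. So the multiplier is a product of powers of the scalars
  attached to -1 and 2, the same for all families with the same \<open>\<sigma>\<close>.
\<close>

lemma Gamma0_upper:
  assumes det: "a * e - b * c = 1" and b: "(2 * int d + 1) dvd b" and a: "[a = (- 1) ^ j * 2 ^ i] (mod 2 * int d + 1)"
    and \<tau>: "Im \<tau> > 0"
  shows "\<Psi> 1 0 ((of_int a * \<tau> + of_int b) / (of_int c * \<tau> + of_int e))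
    = (of_int c * \<tau> + of_int e) ^ d * (((- 1) ^ d) ^ j * \<sigma> ^ i) * \<Psi> 1 0 \<tau>"
proof -
  have "\<Psi> 1 0 ((of_int a * \<tau> + of_int b) / (of_int c * \<tau> + of_int e))
    = (of_int c * \<tau> + of_int e) ^ d * \<Psi> (1 * a + 0 * c) (1 * b + 0 * e) \<tau>"
    using modular[OF det \<tau>] by blast
  also have "\<Psi> (1 * a + 0 * c) (1 * b + 0 * e) \<tau> = \<Psi> ((- 1) ^ j * 2 ^ i * 1) ((- 1) ^ j * 2 ^ i * 0) \<tau>"
    using a b by (intro cong_level \<tau>) (auto simp: cong_0_iff)
  also have "\<dots> = ((- 1) ^ d) ^ j * \<sigma> ^ i * \<Psi> 1 0 \<tau>"
    by (rule scale[OF \<tau>])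
  finally show ?thesis by (simp only: mult.assoc)
qed

text \<open>
  Dividing the argument by the level turns the matrix into another one of
  determinant 1, with \<open>b / L\<close> and \<open>L c\<close> off the diagonal. It sends \<open>(1, j)\<close> to \<open>a\<close>
  times \<open>(1, u)\<close>, where \<open>u\<close> is an affine function of \<open>j\<close> modulo \<open>L\<close>, hence permutes
  the summands up to the multiplier of \<open>Gamma0_upper\<close>.
\<close>

lemma Gamma0_upper_atkin_U:
  assumes det: "a * e - b * c = 1" and b: "(2 * int d + 1) dvd b" and a: "[a = (- 1) ^ j * 2 ^ i] (mod 2 * int d + 1)"
    and \<tau>: "Im \<tau> > 0"
  shows "atkin_U (2 * d + 1) \<Psi> ((of_int a * \<tau> + of_int b) / (of_int c * \<tau> + of_int e))
    = (of_int c * \<tau> + of_int e) ^ d * (((- 1) ^ d) ^ j * \<sigma> ^ i) * atkin_U (2 * d + 1) \<Psi> \<tau>"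
proof -
  define L where "L = 2 * d + 1"
  have intL: "int L = 2 * int d + 1" by (simp add: L_def)
  have L: "L > 0" "(of_nat L :: complex) \<noteq> 0" unfolding of_nat_eq_0_iff by (simp_all add: L_def)
  obtain b' where b': "b = int L * b'" using b unfolding intL ..
  define w where "w = \<tau> / of_nat L"
  have \<tau>w: "\<tau> = of_nat L * w" using L by (simp add: w_def)
  have w: "Im w > 0" using \<tau> L by (simp add: w_def Im_divide_of_nat)
  let ?s = "((- 1) ^ d) ^ j * \<sigma> ^ i" and ?D = "of_int c * \<tau> + of_int e"
  have det': "a * e - b' * (int L * c) = 1" using det by (simp add: b' mult_ac)
  have ae: "[a * e = 1] (mod int L)"
    using det unfolding b' cong_iff_dvd_diff by (auto simp: algebra_simps intro: dvdI[of _ _ "b' * c"])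
  have D: "of_int (int L * c) * w + of_int e = ?D"
    unfolding \<tau>w by simp
  have num: "of_int a * \<tau> + of_int b = of_nat L * (of_int a * w + of_int b')"
    unfolding \<tau>w b' by (simp add: algebra_simps)
  have eq: "(of_int a * \<tau> + of_int b) / ?D / of_nat L = (of_int a * w + of_int b') / (of_int (int L * c) * w + of_int e)"
    unfolding num D using L by simp
  have each: "\<Psi> 1 y ((of_int a * \<tau> + of_int b) / ?D / of_nat L) = ?D ^ d * ?s * \<Psi> 1 (e * b' + e * e * y) w" for y
  proof -
    have "\<Psi> 1 y ((of_int a * \<tau> + of_int b) / ?D / of_nat L)
      = ?D ^ d * \<Psi> (1 * a + y * (int L * c)) (1 * b' + y * e) w"
      unfolding eq using modular[OF det' w, THEN conjunct2, of 1 y] by (simp only: D)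
    also have "\<Psi> (1 * a + y * (int L * c)) (1 * b' + y * e) w
      = \<Psi> ((- 1) ^ j * 2 ^ i * 1) ((- 1) ^ j * 2 ^ i * (e * b' + e * e * y)) w"
    proof (rule cong_level[OF w])
      have "[1 * a + y * (int L * c) = a] (mod int L)"
        by (simp add: cong_iff_dvd_diff)
      then show "[1 * a + y * (int L * c) = (- 1) ^ j * 2 ^ i * 1] (mod 2 * int d + 1)"
        using a cong_trans unfolding intL by fastforce
      have "[(- 1) ^ j * 2 ^ i * (e * b' + e * e * y) = a * (e * b' + e * e * y)] (mod int L)"
        using a unfolding intL by (intro cong_scalar_right) (rule cong_sym)
      also have "a * (e * b' + e * e * y) = a * e * (b' + y * e)" by (simp add: algebra_simps)
      also have "[\<dots> = 1 * (b' + y * e)] (mod int L)"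
        by (intro cong_scalar_right ae)
      finally show "[1 * b' + y * e = (- 1) ^ j * 2 ^ i * (e * b' + e * e * y)] (mod 2 * int d + 1)"
        unfolding intL by (simp add: cong_sym_eq)
    qed
    also have "\<dots> = ?s * \<Psi> 1 (e * b' + e * e * y) w"
      by (rule scale[OF w])
    finally show ?thesis by (simp only: mult.assoc)
  qed
  have "coprime (e * e) (int L)"
  proof -
    have "coprime (a * e) (int L)"
      using ae by (metis cong_imp_coprime cong_sym coprime_1_left)
    then show ?thesis by simp
  qed
  then have "(\<Sum>j<L. \<Psi> 1 (e * b' + e * e * int j) w) = (\<Sum>j<L. \<Psi> 1 (int j) w)"
    by (intro sum_reindex_affine_mod[of L "\<lambda>y. \<Psi> 1 y w"] cong_level w L) (auto simp: intL)
  then show ?thesis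
    unfolding atkin_U_def L_def [symmetric] each w_def [symmetric]
    by (simp flip: sum_distrib_left)
qed

lemma holomorphic_atkin_U: "atkin_U (2 * d + 1) \<Psi> holomorphic_on upper_half"
proof -
  have "(\<Psi> 1 (int j) \<circ> (\<lambda>\<tau>. \<tau> / of_nat (2 * d + 1))) holomorphic_on upper_half" for j
    by (rule holomorphic_on_compose_gen[OF _ hol])
       (auto intro!: holomorphic_intros simp: Im_divide_of_nat simp del: of_nat_add of_nat_Suc)
  then show ?thesis
    unfolding atkin_U_def [abs_def] by (intro holomorphic_intros) (auto simp: o_def)
qed

lemma atkin_U_S:
  assumes \<tau>: "Im \<tau> > 0"
  shows "atkin_U (2 * d + 1) \<Psi> (- 1 / \<tau>) = \<tau> ^ d *
    (of_nat (2 * d + 1) ^ d / of_nat (2 * d + 1) * (\<Sum>j<2 * d + 1. \<Psi> (int j) (- 1) (of_nat (2 * d + 1) * \<tau>)))"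
proof -
  define L where "L = 2 * d + 1"
  have L: "L > 0" by (simp add: L_def)
  have "\<Psi> 1 (int j) (- 1 / \<tau> / of_nat L) = \<tau> ^ d * (of_nat L ^ d * \<Psi> (int j) (- 1) (of_nat L * \<tau>))" for j
    using S[of "of_nat L * \<tau>" 1 "int j"] \<tau> L by (simp add: mult_ac power_mult_distrib)
  then show ?thesis
    unfolding atkin_U_def L_def [symmetric] by (simp add: sum_distrib_left sum_divide_distrib mult_ac)
qed

end

text \<open>
  A bound of Sturm type. Write \<open>H\<close> for the form with the coefficients in question
  and \<open>R\<close> for its quotient by the form \<open>\<Phi> 1 0\<close> of the core counts, which is nonzero
  on the upper half plane. Both have the same multiplier, so \<open>R\<close> is invariant. At
  infinity \<open>\<Phi> 1 0\<close> has order exactly \<open>\<delta>\<close> and \<open>H\<close> has larger order; at the other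
  cusp, that is after inversion, both are bounded up to the weight factor and
  \<open>\<Phi> 1 0\<close> stays away from 0.
\<close>

theorem core_family_sturm:
  fixes d \<delta> :: nat and k :: int
  defines "L \<equiv> 2 * d + 1" and "\<sigma> \<equiv> (- 1) ^ ((d + 1) div 2) :: complex"
  assumes prime: "prime L" and \<delta>: "6 * \<delta> = d * (d + 1)"
    and gen: "\<And>a. \<not> int L dvd a \<Longrightarrow> \<exists>i j. [a = (- 1) ^ j * 2 ^ i] (mod int L)"
    and fam: "modular_family d \<sigma> \<Psi>" and q: "has_qexp L (\<Psi> 1 0) e"
    and small: "\<And>n. n \<le> \<delta> \<Longrightarrow> k * core_seq L \<delta> (L * n) + e n = 0"
  shows "k * core_seq L \<delta> (L * n) + e n = 0"
proof -
  have intL: "int L = 2 * int d + 1" by (simp add: L_def)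
  have L: "L > 0" "(of_nat L :: complex) \<noteq> 0" unfolding of_nat_eq_0_iff by (simp_all add: L_def)
  define \<Phi> where "\<Phi> x y \<tau> = (- 1) ^ d * core_family d x y \<tau>" for x y \<tau>
  have d3: "\<not> 3 dvd 2 * d + 1"
  proof -
    have "3 dvd d * (d + 1)"
      unfolding \<delta> [symmetric] by simp
    then have "3 dvd d \<or> 3 dvd d + 1"
      by (rule prime_dvd_multD [rotated]) simp
    then show ?thesis by presburger
  qed
  have \<Phi>: "modular_family d \<sigma> \<Phi>"
    unfolding \<Phi>_def [abs_def] \<sigma>_def by (intro modular_family_cmult modular_family_core_family d3)
  interpret \<Phi>: modular_family d \<sigma> \<Phi> by (rule \<Phi>)
  interpret \<Psi>: modular_family d \<sigma> \<Psi> by (rule fam)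
  have q\<Phi>: "has_qexp L (\<Phi> 1 0) (core_seq L \<delta>)"
    unfolding \<Phi>_def [abs_def] L_def by (rule has_qexp_core_family[OF \<delta>])
  define H where "H \<tau> = of_int k * atkin_U L \<Phi> \<tau> + \<Psi> 1 0 \<tau>" for \<tau>
  have qH: "has_qexp L H (\<lambda>n. k * core_seq L \<delta> (L * n) + e n)"
    unfolding H_def [abs_def] using q q\<Phi> \<Phi> unfolding L_def
    by (intro has_qexp_add has_qexp_cmult has_qexp_atkin_U)
  have \<Phi>_eq: "\<Phi> 1 0 \<tau> = ee (\<tau> / of_nat L) ^ \<delta> * core_fun L (ee (\<tau> / of_nat L))" if "Im \<tau> > 0" for \<tau>
    unfolding \<Phi>_def core_family_eq_core_fun[OF that \<delta>] L_def by (simp flip: power_mult_distrib mult.assoc)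
  have ee_lt: "norm (ee (\<tau> / of_nat L)) < 1" if "Im \<tau> > 0" for \<tau>
    using that L by (intro norm_ee_less_1) (simp add: Im_divide_of_nat)
  have \<Phi>_nz: "\<Phi> 1 0 \<tau> \<noteq> 0" if "Im \<tau> > 0" for \<tau>
    using \<Phi>_eq[OF that] core_fun_nonzero[OF L(1) ee_lt[OF that]] by simp
  define R where "R \<tau> = H \<tau> / \<Phi> 1 0 \<tau>" for \<tau>
  have hol_H: "H holomorphic_on upper_half"
    unfolding H_def [abs_def] L_def by (intro holomorphic_intros \<Phi>.holomorphic_atkin_U \<Psi>.hol)
  have R0: "R \<tau> = 0" if \<tau>: "Im \<tau> > 0" for \<tau>
  proof (rule Gamma0_upper_vanishing[OF prime _ _ _ _ \<tau>])
    show "R holomorphic_on upper_half"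
      unfolding R_def [abs_def] by (intro holomorphic_intros hol_H \<Phi>.hol) (use \<Phi>_nz in auto)
    show "Gamma0_upper_invariant (int L) R"
      unfolding Gamma0_upper_invariant_def
    proof (intro allI impI)
      fix a b c f :: int and \<tau> :: complex
      assume det: "a * f - b * c = 1" and b: "int L dvd b" and \<tau>: "Im \<tau> > 0"
      let ?\<gamma> = "(of_int a * \<tau> + of_int b) / (of_int c * \<tau> + of_int f)"
      have "\<not> int L dvd a"
      proof
        assume "int L dvd a"
        then have "int L dvd a * f - b * c" using b by simp
        then show False using det prime prime_gt_1_nat[OF prime] by simp
      qed
      then obtain i j where a: "[a = (- 1) ^ j * 2 ^ i] (mod int L)" using gen by blast
      let ?J = "(of_int c * \<tau> + of_int f) ^ d * (((- 1) ^ d) ^ j * \<sigma> ^ i)"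
      have 1: "\<Phi> 1 0 ?\<gamma> = ?J * \<Phi> 1 0 \<tau>"
        using \<Phi>.Gamma0_upper[OF det _ _ \<tau>] a b unfolding intL by blast
      have "H ?\<gamma> = ?J * H \<tau>"
        unfolding H_def L_def using \<Phi>.Gamma0_upper_atkin_U[OF det _ _ \<tau>, of j i] \<Psi>.Gamma0_upper[OF det _ _ \<tau>, of j i] a b
        unfolding intL by (simp add: algebra_simps)
      moreover have J: "?J \<noteq> 0"
        using \<Phi>_nz[OF \<Phi>.modular[OF det \<tau>, THEN conjunct1]] 1 by auto
      ultimately show "R ?\<gamma> = R \<tau>"
        unfolding R_def 1 by (simp only: mult_divide_mult_cancel_left[OF J])
    qed
    show "\<exists>Y. \<forall>\<tau>. Im \<tau> \<ge> Y \<longrightarrow> norm (R \<tau>) < \<epsilon>" if \<epsilon>: "\<epsilon> > 0" for \<epsilon>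
    proof -
      have "\<And>n. n < Suc \<delta> \<Longrightarrow> k * core_seq L \<delta> (L * n) + e n = 0"
        using small by simp
      from qexp_leading_coeff[OF qH L(1) this] obtain g where
        g: "\<And>\<tau>. Im \<tau> > 0 \<Longrightarrow> H \<tau> = ee (\<tau> / of_nat L) ^ Suc \<delta> * g (ee (\<tau> / of_nat L))"
        "(g \<longlongrightarrow> of_int (k * core_seq L \<delta> (L * Suc \<delta>) + e (Suc \<delta>))) (at 0)" by blast
      have "isCont (core_fun L) 0"
        using holomorphic_core_fun[OF L(1)] by (metis analytic_at_imp_isCont analytic_on_open centre_in_ball open_ball zero_less_one analytic_on_analytic_at)
      then have lim: "((\<lambda>x. x * g x / core_fun L x) \<longlongrightarrow> 0 * of_int (k * core_seq L \<delta> (L * Suc \<delta>) + e (Suc \<delta>)) / core_fun L 0) (at 0)"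
        using core_fun_nonzero[OF L(1), of 0] by (intro tendsto_intros g(2)) (auto simp: isCont_def)
      then have "eventually (\<lambda>x. norm (x * g x / core_fun L x) < \<epsilon>) (at 0)"
        using \<epsilon> by (auto simp: tendsto_iff dist_norm)
      from qexp_ee_tendsto_0[OF L(1) this] obtain Y where
        Y: "\<And>\<tau>. Im \<tau> \<ge> Y \<Longrightarrow> norm (ee (\<tau> / of_nat L) * g (ee (\<tau> / of_nat L)) / core_fun L (ee (\<tau> / of_nat L))) < \<epsilon>"
        by blast
      have "norm (R \<tau>) < \<epsilon>" if "Im \<tau> \<ge> max Y 1" for \<tau>
      proof -
        have "Im \<tau> > 0" "Im \<tau> \<ge> Y" using that by auto
        then show ?thesis using Y[of \<tau>] by (simp add: R_def g(1) \<Phi>_eq mult_ac)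
      qed
      then show ?thesis by blast
    qed
    show "cusp_bounded (\<lambda>\<tau>. R (- 1 / \<tau>))"
    proof (rule cusp_bounded_cong)
      define N where "N \<tau> = of_int k * (of_nat L ^ d / of_nat L * (\<Sum>j<L. \<Phi> (int j) (- 1) (of_nat L * \<tau>))) + \<Psi> 0 (- 1) \<tau>" for \<tau>
      show "cusp_bounded (\<lambda>\<tau>. N \<tau> * ((- 1) ^ d * (\<Prod>a=1..int d. klein_div d a 0 (- 1) \<tau>)))"
      proof (intro cusp_bounded_mult cusp_bounded_const cusp_bounded_prod)
        have "cusp_bounded (\<lambda>\<tau>. \<Phi> (int j) (- 1) (of_nat L * \<tau>))" for j
          using cusp_bounded_affine[OF \<Phi>.bdd, of "real L" "int j" "- 1" 0] L by simp
        then show "cusp_bounded N"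
          unfolding N_def [abs_def]
          by (intro cusp_bounded_add cusp_bounded_mult cusp_bounded_const cusp_bounded_sum \<Psi>.bdd)
        show "cusp_bounded (klein_div d a 0 (- 1))" for a
          unfolding klein_div_def using cusp_bounded_klein_0 by simp
      qed
      fix \<tau> :: complex assume \<tau>: "Im \<tau> > 0"
      have \<tau>0: "\<tau> \<noteq> 0" using \<tau> by auto
      have H_S: "H (- 1 / \<tau>) = \<tau> ^ d * N \<tau>"
        unfolding H_def N_def using \<Phi>.atkin_U_S[OF \<tau>] \<Psi>.S[OF \<tau>, of 1 0] unfolding L_def by (simp add: algebra_simps)
      have \<Phi>_S: "\<Phi> 1 0 (- 1 / \<tau>) = \<tau> ^ d * \<Phi> 0 (- 1) \<tau>"
        using \<Phi>.S[OF \<tau>, of 1 0] by simp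
      have inv: "inverse (\<Phi> 0 (- 1) \<tau>) = (- 1) ^ d * (\<Prod>a=1..int d. klein_div d a 0 (- 1) \<tau>)"
        unfolding \<Phi>_def core_family_def by (simp add: prod_inversef[unfolded comp_def] flip: power_inverse)
      have "R (- 1 / \<tau>) = N \<tau> / \<Phi> 0 (- 1) \<tau>"
        unfolding R_def H_S \<Phi>_S using \<tau>0 by simp
      then show "norm (R (- 1 / \<tau>)) = norm (N \<tau> * ((- 1) ^ d * (\<Prod>a=1..int d. klein_div d a 0 (- 1) \<tau>)))"
        unfolding divide_inverse inv by simp
    qed
  qed
  have "H \<tau> = 0" if "Im \<tau> > 0" for \<tau>
    using R0[OF that] \<Phi>_nz[OF that] by (simp add: R_def)
  then show ?thesis
    by (rule has_qexp_zero_imp[OF qH L(1)])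
qed

section \<open>Divisibility by powers of the level\<close>

lemma hecke2_seq_dilate:
  assumes "odd L"
  shows "hecke2_seq d s (\<lambda>n. c (L * n)) n = hecke2_seq d s c (L * n)"
proof -
  have "L * (n div 2) = L * n div 2" if "even n"
    using that by (auto elim!: evenE)
  moreover have "even (L * n) \<longleftrightarrow> even n" using assms by simp
  ultimately show ?thesis by (simp add: hecke2_seq_def mult.left_commute)
qed

lemma hecke2_seq_power_dilate:
  assumes "odd L"
  shows "(hecke2_seq d s ^^ i) (\<lambda>n. c (L * n)) = (\<lambda>n. (hecke2_seq d s ^^ i) c (L * n))"
  by (induction i) (auto simp: hecke2_seq_dilate[OF assms])

lemma hecke2_seq_power_cmult:
  "(hecke2_seq d s ^^ i) (\<lambda>n. a * c n) = (\<lambda>n. a * (hecke2_seq d s ^^ i) c n)"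
  by (induction i) (auto simp: hecke2_seq_def algebra_simps)

text \<open>
  In operator notation: \<open>k U c = l P c\<close> with commuting \<open>U\<close> and \<open>P\<close>, both compatible
  with scalars, implies \<open>k\<^sup>r U\<^sup>r c = l\<^sup>r P\<^sup>r c\<close>.
\<close>

lemma dilation_power_identity:
  fixes P :: "(nat \<Rightarrow> int) \<Rightarrow> nat \<Rightarrow> int" and k l :: int
  assumes dilate: "\<And>c n. P (\<lambda>n. c (L * n)) n = P c (L * n)"
    and cmult: "\<And>a c n. P (\<lambda>n. a * c n) n = a * P c n"
    and eq: "\<And>n. k * c (L * n) = l * P c n"
  shows "k ^ r * c (L ^ r * n) = l ^ r * (P ^^ r) c n"
proof -
  have step: "k * (P ^^ r) c (L * n) = l * (P ^^ Suc r) c n" for r n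
  proof (induction r arbitrary: n)
    case 0
    show ?case using eq by simp
  next
    case (Suc r)
    have "k * (P ^^ Suc r) c (L * n) = P (\<lambda>n. k * (P ^^ r) c (L * n)) n"
      by (simp add: cmult dilate)
    also have "\<dots> = l * (P ^^ Suc (Suc r)) c n"
      unfolding Suc by (simp add: cmult)
    finally show ?case .
  qed
  show ?thesis
  proof (induction r arbitrary: n)
    case (Suc r)
    have "k ^ Suc r * c (L ^ Suc r * n) = k * (k ^ r * c (L ^ r * (L * n)))"
      by (simp add: mult_ac)
    also have "\<dots> = l ^ r * (k * (P ^^ r) c (L * n))"
      unfolding Suc by simp
    also have "\<dots> = l ^ Suc r * (P ^^ Suc r) c n"
      unfolding step by simp
    finally show ?case .
  qed simp
qed

lemma hecke_polynomial_family:
  assumes fam: "modular_family d (of_int s) \<Phi>" and q: "has_qexp (2 * d + 1) (\<Phi> 1 0) c" and d: "d > 0"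
  shows "\<exists>\<Psi>. modular_family d (of_int s) \<Psi> \<and>
    has_qexp (2 * d + 1) (\<Psi> 1 0) (\<lambda>n. \<Sum>i<N. a i * (hecke2_seq d s ^^ i) c n)"
proof (induction N)
  case 0
  show ?case
    using modular_family_cmult[OF fam, of 0] by (intro exI[of _ "\<lambda>x y \<tau>. 0 * \<Phi> x y \<tau>"]) (auto simp: has_qexp_def)
next
  case (Suc N)
  have pow: "modular_family d (of_int s) ((hecke2 d ^^ i) \<Phi>) \<and>
    has_qexp (2 * d + 1) ((hecke2 d ^^ i) \<Phi> 1 0) ((hecke2_seq d s ^^ i) c)" for i
  proof (induction i)
    case (Suc i)
    then show ?case
      using modular_family_hecke2[OF _ d] has_qexp_hecke2 unfolding funpow.simps o_def by blast
  qed (use fam q in simp)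
  from Suc obtain \<Psi> where \<Psi>: "modular_family d (of_int s) \<Psi>"
    "has_qexp (2 * d + 1) (\<Psi> 1 0) (\<lambda>n. \<Sum>i<N. a i * (hecke2_seq d s ^^ i) c n)" by blast
  show ?case
    unfolding sum.lessThan_Suc
    by (intro exI[of _ "\<lambda>x y \<tau>. \<Psi> x y \<tau> + of_int (a N) * (hecke2 d ^^ N) \<Phi> x y \<tau>"] conjI
        modular_family_add modular_family_cmult has_qexp_add has_qexp_cmult \<Psi> pow[THEN conjunct1] pow[THEN conjunct2])
qed

text \<open>
  By \<open>core_family_sturm\<close>, the identity between \<open>U\<close> and the polynomial with
  coefficients \<open>b\<close> in the Hecke operator extends from the first \<open>\<delta> + 1\<close> coefficients
  to all; \<open>dilation_power_identity\<close> then iterates it.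
\<close>

theorem core_count_power_divisible:
  fixes d \<delta> N r n :: nat and k :: int and b :: "nat \<Rightarrow> int"
  defines "L \<equiv> 2 * d + 1" and "s \<equiv> (- 1) ^ ((d + 1) div 2)"
  assumes prime: "prime L" and \<delta>: "6 * \<delta> = d * (d + 1)"
    and gen: "\<And>a. \<not> int L dvd a \<Longrightarrow> \<exists>i j. [a = (- 1) ^ j * 2 ^ i] (mod int L)"
    and k: "coprime k (int L)"
    and small: "\<And>n. n \<le> \<delta> \<Longrightarrow> k * core_seq L \<delta> (L * n)
      = int L * (\<Sum>i<N. b i * (hecke2_seq d s ^^ i) (core_seq L \<delta>) n)"
  shows "int L ^ r dvd core_count L (int (L ^ r * n) - int \<delta>)"
proof -
  let ?c = "core_seq L \<delta>"
  define P where "P c n = (\<Sum>i<N. b i * (hecke2_seq d s ^^ i) c n)" for c n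
  have "d \<noteq> 0"
  proof
    assume "d = 0"
    then show False using prime by (simp add: L_def)
  qed
  then have d: "d > 0" by simp
  have d3: "\<not> 3 dvd 2 * d + 1"
  proof -
    have "3 dvd d * (d + 1)"
      unfolding \<delta> [symmetric] by simp
    then have "3 dvd d \<or> 3 dvd d + 1"
      by (rule prime_dvd_multD [rotated]) simp
    then show ?thesis by presburger
  qed
  have s: "(- 1) ^ ((d + 1) div 2) = (of_int s :: complex)"
    by (simp add: s_def)
  have \<Phi>: "modular_family d (of_int s) (\<lambda>x y \<tau>. (- 1) ^ d * core_family d x y \<tau>)"
    using modular_family_cmult[OF modular_family_core_family[OF d3]] unfolding s by blast
  obtain \<Psi> where \<Psi>: "modular_family d (of_int s) \<Psi>" and
    q: "has_qexp L (\<Psi> 1 0) (\<lambda>n. \<Sum>i<N. (- int L * b i) * (hecke2_seq d s ^^ i) ?c n)"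
    using hecke_polynomial_family[OF \<Phi> has_qexp_core_family[OF \<delta>] d, where N = N and a = "\<lambda>i. - int L * b i"]
    unfolding L_def by blast
  have e: "(\<Sum>i<N. (- int L * b i) * (hecke2_seq d s ^^ i) ?c n) = - (int L * P ?c n)" for n
    unfolding P_def by (simp add: sum_distrib_left sum_negf mult.assoc)
  have sum0: "k * ?c (L * n) + - (int L * P ?c n) = 0" for n
    using core_family_sturm[where d = d and \<delta> = \<delta> and k = k and \<Psi> = \<Psi> and e = "\<lambda>n. - (int L * P ?c n)" and n = n,
        folded L_def, unfolded s, OF prime \<delta> gen \<Psi>] q small unfolding e by (simp add: P_def)
  have eq: "k * ?c (L * n) = int L * P ?c n" for n
    using sum0[of n] by linarith
  have "odd L" by (simp add: L_def)
  then have "k ^ r * ?c (L ^ r * n) = int L ^ r * (P ^^ r) ?c n"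
    by (intro dilation_power_identity eq)
       (simp_all add: P_def hecke2_seq_power_dilate hecke2_seq_power_cmult sum_distrib_left mult.left_commute)
  then have "int L ^ r dvd k ^ r * ?c (L ^ r * n)" by simp
  moreover have "coprime (int L ^ r) (k ^ r)" using k by (simp add: coprime_commute)
  ultimately have "int L ^ r dvd ?c (L ^ r * n)"
    by (simp add: coprime_dvd_mult_right_iff)
  then show ?thesis by (simp add: core_seq_def)
qed

text \<open>
  The finite condition is meant for evaluation; ten exponents suffice for the levels
  5, 7 and 11.
\<close>

lemma signed_powers_of_2:
  fixes L :: int
  assumes "L > 0" and "\<forall>x\<in>set [1..L - 1]. \<exists>i\<in>set [0..<10]. \<exists>j\<in>set [0..<2]. ((- 1) ^ j * 2 ^ i) mod L = x"
    and "\<not> L dvd a"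
  shows "\<exists>i j. [a = (- 1) ^ j * 2 ^ i] (mod L)"
proof -
  have "a mod L \<noteq> 0" using assms(3) by (simp add: dvd_eq_mod_eq_0)
  then have "a mod L \<in> set [1..L - 1]"
    using pos_mod_bound[OF assms(1), of a] pos_mod_sign[OF assms(1), of a] by auto
  then obtain i j where "((- 1) ^ j * 2 ^ i) mod L = a mod L" using assms(2) by blast
  then show ?thesis
    unfolding cong_iff_dvd_diff mod_eq_dvd_iff [symmetric] by metis
qed

lemma core_seq_nth:
  assumes "l > 0" "n \<le> N + \<delta>"
  shows "core_seq l \<delta> n = (if n < \<delta> then 0 else core_list l N ! (n - \<delta>))"
  using core_count_list[OF assms(1), of "n - \<delta>" N] assms(2)
  by (auto simp: core_seq_def core_count_def[of _ "int n - int \<delta>"] of_nat_diff)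

theorem core_count_5: "5 ^ r dvd core_count 5 (int (5 ^ r * n) - 1)"
proof -
  have c: "core_seq 5 1 n = (if n < 1 then 0 else [1, 1, 2, 3, 5] ! (n - 1))" if "n \<le> 5" for n
    using core_seq_nth[of 5 n 4 1] that by (simp add: core_list_5)
  have "int (2 * 2 + 1) ^ r dvd core_count (2 * 2 + 1) (int ((2 * 2 + 1) ^ r * n) - int 1)"
  proof (rule core_count_power_divisible[where k = 1 and N = 1 and b = "\<lambda>_. 1"])
    show "\<exists>i j. [a = (- 1) ^ j * 2 ^ i] (mod int (2 * 2 + 1))" if "\<not> int (2 * 2 + 1) dvd a" for a
      by (rule signed_powers_of_2[OF _ _ that]) (simp, code_simp)
    fix n :: nat assume "n \<le> 1"
    then have "n = 0 \<or> n = 1" by linarith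
    then show "1 * core_seq (2 * 2 + 1) 1 ((2 * 2 + 1) * n) = int (2 * 2 + 1) *
        (\<Sum>i<1. 1 * (hecke2_seq 2 ((- 1) ^ ((2 + 1) div 2)) ^^ i) (core_seq (2 * 2 + 1) 1) n)"
      by (auto simp: c simp del: One_nat_def)
  qed simp_all
  then show ?thesis by simp
qed

text \<open>
  The coefficients 2 and 1 are forced by the first two Fourier coefficients: the
  forms vanishing at infinity have dimension 2 in this case.
\<close>

theorem core_count_7: "7 ^ r dvd core_count 7 (int (7 ^ r * n) - 2)"
proof -
  have c: "core_seq 7 2 n = (if n < 2 then 0 else [1, 1, 2, 3, 5, 7, 11, 8, 15, 16, 21, 21, 28] ! (n - 2))"
    if "n \<le> 14" for n
    using core_seq_nth[of 7 n 12 2] that by (simp add: core_list_7)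
  have "int (2 * 3 + 1) ^ r dvd core_count (2 * 3 + 1) (int ((2 * 3 + 1) ^ r * n) - int 2)"
  proof (rule core_count_power_divisible[where k = 1 and N = 2 and b = "\<lambda>i. [2, 1] ! i"])
    show "\<exists>i j. [a = (- 1) ^ j * 2 ^ i] (mod int (2 * 3 + 1))" if "\<not> int (2 * 3 + 1) dvd a" for a
      by (rule signed_powers_of_2[OF _ _ that]) (simp, code_simp)
    fix n :: nat assume "n \<le> 2"
    then consider "n = 0" | "n = 1" | "n = 2" by linarith
    then show "1 * core_seq (2 * 3 + 1) 2 ((2 * 3 + 1) * n) = int (2 * 3 + 1) *
        (\<Sum>i<2. [2, 1] ! i * (hecke2_seq 3 ((- 1) ^ ((3 + 1) div 2)) ^^ i) (core_seq (2 * 3 + 1) 2) n)"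
      by cases (simp_all add: c hecke2_seq_def lessThan_nat_numeral)
  qed simp_all
  then show ?thesis by simp
qed

text \<open>
  In weight 5 and level 11 the forms in question that vanish at infinity have
  dimension 4, so that a cubic polynomial in the Hecke operator is needed. Its
  coefficients are found by solving the linear equations given by the first Fourier
  coefficients; the factor 3 clears their denominators.
\<close>

theorem core_count_11: "11 ^ r dvd core_count 11 (int (11 ^ r * n) - 5)"
proof -
  have c: "core_seq 11 5 n = (if n < 5 then 0 else
    [1, 1, 2, 3, 5, 7, 11, 15, 22, 30, 42, 45, 66, 79, 102, 121, 154, 176, 220, 248, 297,
     330, 430, 452, 552, 605, 720, 777, 935, 990, 1182, 1265, 1485, 1530, 1838, 1892, 2214,
     2310, 2684, 2750, 3238, 3289, 3850, 3960, 4500, 4599, 5370, 5404, 6220, 6325, 7238] ! (n - 5))"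
    if "n \<le> 55" for n
    using core_seq_nth[of 11 n 50 5] that by (simp add: core_list_11)
  have "int (2 * 5 + 1) ^ r dvd core_count (2 * 5 + 1) (int ((2 * 5 + 1) ^ r * n) - int 5)"
  proof (rule core_count_power_divisible[where k = 3 and N = 4 and b = "\<lambda>i. [33, - 24, 1, - 1] ! i"])
    show "\<exists>i j. [a = (- 1) ^ j * 2 ^ i] (mod int (2 * 5 + 1))" if "\<not> int (2 * 5 + 1) dvd a" for a
      by (rule signed_powers_of_2[OF _ _ that]) (simp, code_simp)
    have "coprime 3 (11 :: int)" by code_simp
    then show "coprime 3 (int (2 * 5 + 1))" by simp
    fix n :: nat assume "n \<le> 5"
    then consider "n = 0" | "n = 1" | "n = 2" | "n = 3" | "n = 4" | "n = 5" by linarith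
    then have "3 * core_seq 11 5 (11 * n) = 11 *
        (33 * core_seq 11 5 n - 24 * hecke2_seq 5 (- 1) (core_seq 11 5) n
          + hecke2_seq 5 (- 1) (hecke2_seq 5 (- 1) (core_seq 11 5)) n
          - hecke2_seq 5 (- 1) (hecke2_seq 5 (- 1) (hecke2_seq 5 (- 1) (core_seq 11 5))) n)"
      by cases (simp_all add: c hecke2_seq_def)
    moreover have "(\<Sum>i<4. [33, - 24, 1, - 1] ! i * (t ^^ i) f n)
        = 33 * f n - 24 * t f n + t (t f) n - t (t (t f)) n" for t and f :: "nat \<Rightarrow> int"
      by (simp add: eval_nat_numeral)
    ultimately show "3 * core_seq (2 * 5 + 1) 5 ((2 * 5 + 1) * n) = int (2 * 5 + 1) *
        (\<Sum>i<4. [33, - 24, 1, - 1] ! i * (hecke2_seq 5 ((- 1) ^ ((5 + 1) div 2)) ^^ i) (core_seq (2 * 5 + 1) 5) n)"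
      by simp
  qed simp_all
  then show ?thesis by simp
qed

theorem corollary6p3:
  fixes m :: int and r :: nat
  assumes "m \<ge> 0" and "r > 0"
  shows "[core_count 5 (5 ^ r * m - 1) = 0] (mod 5 ^ r) \<and>
         [core_count 7 (7 ^ r * m - 2) = 0] (mod 7 ^ r) \<and>
         [core_count 11 (11 ^ r * m - 5) = 0] (mod 11 ^ r)"
  using core_count_5[of r "nat m"] core_count_7[of r "nat m"] core_count_11[of r "nat m"] assms(1)
  by (simp add: cong_0_iff)

end
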